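(* For every positive integer $n$, \[ \sum_{A \in \mathrm{ASM}_n} \omega_A(u,v,w;\mathbf{x}) = \mathcal{A}_{n,1}(1,u,v,w;\mathbf{x}), \] where $\mathbf{x}=(x_1,\ldots,x_n)$.
   Context: Partitions: a partition is a weakly decreasing sequence of non-negative integers; $\lambda'$ denotes the conjugate partition, $\lambda'_i=|\{j:\lambda_j\ge i\}|$. If $l=\max\{i:\lambda_i\ge i\}$ (the side length of the Durfee square), the Frobenius notation of $\lambda$ is $(a_1,\ldots,a_l\mid b_1,\ldots,b_l)$ with $a_i=\lambda_i-i$, $b_i=\lambda'_i-i$; conversely such a symbol with $a_1>\dots>a_l\ge 0$, $b_1>\dots>b_l\ge0$ determines a partition. $s_\lambda(\mathbf{x})$ is the Schur polynomial in the variables $\mathbf{x}$ (zero if $\lambda$ has more nonzero parts than there are variables). Totally symmetric plane partitions: $\mathrm{TSPP}_m$ is the set of arrays $T=(T_{i,j})_{1\le i,j\le m}$ of integers in $\{0,\ldots,m\}$ with weakly decreasing rows and columns such that the set $\{(i,j,c): 1\le c\le T_{i,j}\}\subseteq[m]^3$ is invariant under all permutations of the three coordinates. For $T\in\mathrm{TSPP}_m$ let $\mathrm{diag}(T)$ be the conjugate of the partition $(T_{1,1},T_{2,2},\ldots,T_{m,m})$, with Frobenius notation $(a_1,\ldots,a_l\mid b_1,\ldots,b_l)$. For an integer $k\ge0$, $\pi_k(T)$ is the partition with Frobenius notation $(a_1,\ldots,a_l\mid b_1+k,\ldots,b_l+k)$. For $T\in\mathrm{TSPP}_{n-1}$ put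 \[ \omega(T)=r^l u^{\sum_{i=1}^l(a_i+1)} v^{\binom{n}{2}-\sum_{i=1}^l(b_i+1)} w^{\sum_{i=1}^l(b_i-a_i)}, \] and define $\mathcal{A}_{n,k}(r,u,v,w;\mathbf{x})=\sum_{T\in\mathrm{TSPP}_{n-1}}\omega(T)\,s_{\pi_k(T)}(\mathbf{x})$ with $\mathbf{x}=(x_1,\ldots,x_{n+k-1})$. ASMs and their weight: $\mathrm{ASM}_n$ is the set of $n\times n$ matrices with entries in $\{-1,0,1\}$ whose row and column sums all equal $1$ and whose nonzero entries alternate in sign along every row and column. To $A=(a_{i,j})\in\mathrm{ASM}_n$ associate the monotone triangle $M=(m_{i,j})_{1\le j\le i\le n}$ whose $i$-th row $m_{i,1}<\dots<m_{i,i}$ lists the column indices $j$ with $\sum_{i'\le i}a_{i',j}=1$ (so $m_{i+1,j}\le m_{i,j}\le m_{i+1,j+1}$ and the bottom row is $1,2,\ldots,n$). An entry $m_{i,j}$ with $i<n$ is special if $m_{i+1,j}<m_{i,j}<m_{i+1,j+1}$, left-leaning if $m_{i,j}=m_{i+1,j}$, right-leaning if $m_{i,j}=m_{i+1,j+1}$. For $1\le i\le n-1$ let $s_i(M),l_i(M),r_i(M)$ be the numbers of special, left-leaning, right-leaning entries in row $i$, and $s_0=l_0=r_0=0$; let $l(M)=\sum_i l_i(M)$, $r(M)=\sum_i r_i(M)$. For $1\le i\le n$ let $\widehat d_i(M)=\sum_{j=1}^i m_{i,j}-\sum_{j=1}^{i-1}m_{i-1,j}+r_{i-1}(M)-l_{i-1}(M)-1$.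 Then \[ \omega_A(u,v,w;\mathbf{x})=u^{r(M)}v^{l(M)}\prod_{i=1}^n x_i^{\widehat d_i(M)}\,(u x_i+w+v x_i^{-1})^{s_{i-1}(M)}. \] *)

theory Defs
  imports Complex_Main
begin

text \<open>
  All sequences, arrays and matrices are indexed from 1, as in the usual combinatorial
  notation, and are extended by the value 0 to the remaining indices. This makes each object a
  unique function and the sets of objects below finite.
\<close>

section \<open>Partitions\<close>

definition is_partition :: "(nat \<Rightarrow> nat) \<Rightarrow> bool" where
  "is_partition p \<longleftrightarrow>
     p 0 = 0 \<and> (\<forall>i j. 1 \<le> i \<longrightarrow> i \<le> j \<longrightarrow> p j \<le> p i) \<and> finite {i. p i \<noteq> 0}"

definition conjugate :: "(nat \<Rightarrow> nat) \<Rightarrow> nat \<Rightarrow> nat" where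
  "conjugate p i = (if i = 0 then 0 else card {j. 1 \<le> j \<and> i \<le> p j})"

text \<open>The index 0 always belongs to the set below, so the empty partition has length 0.\<close>

definition durfee :: "(nat \<Rightarrow> nat) \<Rightarrow> nat" where
  "durfee p = Max {i. i \<le> p i}"

text \<open>For \<open>1 \<le> i \<le> durfee p\<close> neither of the following subtractions truncates.\<close>

definition frob_a :: "(nat \<Rightarrow> nat) \<Rightarrow> nat \<Rightarrow> nat" where
  "frob_a p i = p i - i"

definition frob_b :: "(nat \<Rightarrow> nat) \<Rightarrow> nat \<Rightarrow> nat" where
  "frob_b p i = conjugate p i - i"

definition has_frobenius :: "(nat \<Rightarrow> nat) \<Rightarrow> nat \<Rightarrow> (nat \<Rightarrow> nat) \<Rightarrow> (nat \<Rightarrow> nat) \<Rightarrow> bool" where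
  "has_frobenius p l a b \<longleftrightarrow>
     is_partition p \<and> durfee p = l \<and> (\<forall>i\<in>{1..l}. frob_a p i = a i \<and> frob_b p i = b i)"

definition of_frobenius :: "nat \<Rightarrow> (nat \<Rightarrow> nat) \<Rightarrow> (nat \<Rightarrow> nat) \<Rightarrow> nat \<Rightarrow> nat" where
  "of_frobenius l a b = (THE p. has_frobenius p l a b)"

section \<open>Schur polynomials\<close>

definition diagram :: "(nat \<Rightarrow> nat) \<Rightarrow> (nat \<times> nat) set" where
  "diagram p = {(i, j). 1 \<le> i \<and> 1 \<le> j \<and> j \<le> p i}"

definition SSYT :: "nat \<Rightarrow> (nat \<Rightarrow> nat) \<Rightarrow> (nat \<Rightarrow> nat \<Rightarrow> nat) set" where
  "SSYT m p = {t.
     (\<forall>i j. (i, j) \<notin> diagram p \<longrightarrow> t i j = 0) \<and>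
     (\<forall>(i, j) \<in> diagram p. 1 \<le> t i j \<and> t i j \<le> m) \<and>
     (\<forall>i j. (i, j) \<in> diagram p \<longrightarrow> (i, Suc j) \<in> diagram p \<longrightarrow> t i j \<le> t i (Suc j)) \<and>
     (\<forall>i j. (i, j) \<in> diagram p \<longrightarrow> (Suc i, j) \<in> diagram p \<longrightarrow> t i j < t (Suc i) j)}"

text \<open>The Schur polynomial of shape \<open>p\<close>, evaluated at \<open>x 1, \<dots>, x m\<close>.\<close>

definition schur :: "nat \<Rightarrow> (nat \<Rightarrow> nat) \<Rightarrow> (nat \<Rightarrow> 'a::field) \<Rightarrow> 'a" where
  "schur m p x = (\<Sum>t\<in>SSYT m p. \<Prod>(i, j)\<in>diagram p. x (t i j))"

section \<open>Totally symmetric plane partitions\<close>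

definition cells :: "nat \<Rightarrow> (nat \<Rightarrow> nat \<Rightarrow> nat) \<Rightarrow> (nat \<times> nat \<times> nat) set" where
  "cells m T = {(i, j, c). i \<in> {1..m} \<and> j \<in> {1..m} \<and> 1 \<le> c \<and> c \<le> T i j}"

definition TSPP :: "nat \<Rightarrow> (nat \<Rightarrow> nat \<Rightarrow> nat) set" where
  "TSPP m = {T.
     (\<forall>i j. i \<notin> {1..m} \<or> j \<notin> {1..m} \<longrightarrow> T i j = 0) \<and>
     (\<forall>i\<in>{1..m}. \<forall>j\<in>{1..m}. T i j \<le> m) \<and>
     (\<forall>i\<in>{1..m}. \<forall>j\<in>{1..m}. \<forall>j'\<in>{1..m}. j \<le> j' \<longrightarrow> T i j' \<le> T i j) \<and>
     (\<forall>i\<in>{1..m}. \<forall>i'\<in>{1..m}. \<forall>j\<in>{1..m}. i \<le> i' \<longrightarrow> T i' j \<le> T i j) \<and>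
     (\<forall>i j c. (i, j, c) \<in> cells m T \<longrightarrow>
        (i, c, j) \<in> cells m T \<and> (j, i, c) \<in> cells m T \<and> (j, c, i) \<in> cells m T \<and>
        (c, i, j) \<in> cells m T \<and> (c, j, i) \<in> cells m T)}"

definition tspp_diag :: "(nat \<Rightarrow> nat \<Rightarrow> nat) \<Rightarrow> nat \<Rightarrow> nat" where
  "tspp_diag T = conjugate (\<lambda>i. T i i)"

definition tspp_pi :: "nat \<Rightarrow> (nat \<Rightarrow> nat \<Rightarrow> nat) \<Rightarrow> nat \<Rightarrow> nat" where
  "tspp_pi k T =
     of_frobenius (durfee (tspp_diag T)) (frob_a (tspp_diag T)) (\<lambda>i. frob_b (tspp_diag T) i + k)"

text \<open>
  The exponents of \<open>v\<close> and \<open>w\<close> are differences, hence taken as integers; for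
  \<open>T \<in> TSPP (n - 1)\<close> both are non-negative.
\<close>

definition tspp_weight ::
  "nat \<Rightarrow> 'a::field \<Rightarrow> 'a \<Rightarrow> 'a \<Rightarrow> 'a \<Rightarrow> (nat \<Rightarrow> nat \<Rightarrow> nat) \<Rightarrow> 'a" where
  "tspp_weight n r u v w T =
     (let p = tspp_diag T; l = durfee p; a = frob_a p; b = frob_b p in
        r ^ l * u ^ (\<Sum>i=1..l. a i + 1)
        * v powi (int (n choose 2) - (\<Sum>i=1..l. int (b i) + 1))
        * w powi (\<Sum>i=1..l. int (b i) - int (a i)))"

definition tspp_gf ::
  "nat \<Rightarrow> nat \<Rightarrow> 'a::field \<Rightarrow> 'a \<Rightarrow> 'a \<Rightarrow> 'a \<Rightarrow> (nat \<Rightarrow> 'a) \<Rightarrow> 'a" where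
  "tspp_gf n k r u v w x =
     (\<Sum>T\<in>TSPP (n - 1). tspp_weight n r u v w T * schur (n + k - 1) (tspp_pi k T) x)"

section \<open>Alternating sign matrices\<close>

text \<open>Alternation is expressed on pairs of consecutive nonzero entries.\<close>

definition ASM :: "nat \<Rightarrow> (nat \<Rightarrow> nat \<Rightarrow> int) set" where
  "ASM n = {A.
     (\<forall>i j. i \<notin> {1..n} \<or> j \<notin> {1..n} \<longrightarrow> A i j = 0) \<and>
     (\<forall>i\<in>{1..n}. \<forall>j\<in>{1..n}. A i j \<in> {-1, 0, 1}) \<and>
     (\<forall>i\<in>{1..n}. (\<Sum>j=1..n. A i j) = 1) \<and>
     (\<forall>j\<in>{1..n}. (\<Sum>i=1..n. A i j) = 1) \<and>
     (\<forall>i\<in>{1..n}. \<forall>j\<in>{1..n}. \<forall>j'\<in>{1..n}. j < j' \<longrightarrow> A i j \<noteq> 0 \<longrightarrow> A i j' \<noteq> 0 \<longrightarrow>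
        (\<forall>k\<in>{j<..<j'}. A i k = 0) \<longrightarrow> A i j' = - A i j) \<and>
     (\<forall>j\<in>{1..n}. \<forall>i\<in>{1..n}. \<forall>i'\<in>{1..n}. i < i' \<longrightarrow> A i j \<noteq> 0 \<longrightarrow> A i' j \<noteq> 0 \<longrightarrow>
        (\<forall>k\<in>{i<..<i'}. A k j = 0) \<longrightarrow> A i' j = - A i j)}"

text \<open>
  The monotone triangle of \<open>A\<close>: its entry \<open>(i, j)\<close>, meaningful for \<open>1 \<le> j \<le> i \<le> n\<close>, is the
  \<open>j\<close>-th smallest column index whose sum over the first \<open>i\<close> rows is 1.
\<close>

definition monotone_triangle :: "nat \<Rightarrow> (nat \<Rightarrow> nat \<Rightarrow> int) \<Rightarrow> nat \<Rightarrow> nat \<Rightarrow> nat" where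
  "monotone_triangle n A i j =
     sorted_list_of_set {c \<in> {1..n}. (\<Sum>i'=1..i. A i' c) = 1} ! (j - 1)"

text \<open>The following three counts are 0 for the row index 0.\<close>

definition special_count :: "(nat \<Rightarrow> nat \<Rightarrow> nat) \<Rightarrow> nat \<Rightarrow> nat" where
  "special_count M i = card {j \<in> {1..i}. M (i + 1) j < M i j \<and> M i j < M (i + 1) (j + 1)}"

definition left_count :: "(nat \<Rightarrow> nat \<Rightarrow> nat) \<Rightarrow> nat \<Rightarrow> nat" where
  "left_count M i = card {j \<in> {1..i}. M i j = M (i + 1) j}"

definition right_count :: "(nat \<Rightarrow> nat \<Rightarrow> nat) \<Rightarrow> nat \<Rightarrow> nat" where
  "right_count M i = card {j \<in> {1..i}. M i j = M (i + 1) (j + 1)}"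

definition d_hat :: "(nat \<Rightarrow> nat \<Rightarrow> nat) \<Rightarrow> nat \<Rightarrow> int" where
  "d_hat M i = (\<Sum>j=1..i. int (M i j)) - (\<Sum>j=1..i-1. int (M (i - 1) j))
     + int (right_count M (i - 1)) - int (left_count M (i - 1)) - 1"

definition asm_weight ::
  "nat \<Rightarrow> 'a::field \<Rightarrow> 'a \<Rightarrow> 'a \<Rightarrow> (nat \<Rightarrow> 'a) \<Rightarrow> (nat \<Rightarrow> nat \<Rightarrow> int) \<Rightarrow> 'a" where
  "asm_weight n u v w x A =
     (let M = monotone_triangle n A in
        u ^ (\<Sum>i=1..n-1. right_count M i) * v ^ (\<Sum>i=1..n-1. left_count M i)
        * (\<Prod>i=1..n. x i powi d_hat M i
             * (u * x i + w + v * inverse (x i)) ^ special_count M (i - 1)))"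

end

theory Submission
  imports Defs "Jordan_Normal_Form.Determinant" "HOL-Computational_Algebra.Formal_Laurent_Series"
begin

text \<open>
  Removing the bottom row of a monotone triangle shows that the weighted sum over all triangles with
  bottom row \<open>k\<close>, multiplied by the Vandermonde product, is the antisymmetrizer of
  \<open>\<Prod>i<j. (v + w x\<^sub>i + u x\<^sub>i x\<^sub>j) * \<Prod>i. x\<^sub>i ^ k\<^sub>i\<close>; for \<open>u = w = 0\<close>, \<open>v = 1\<close> this is the
  bialternant formula for Schur polynomials. With \<open>f = w + u x\<close> and \<open>g = - v / x\<close> the first product
  is essentially \<open>\<Prod>i<j. (f\<^sub>j - g\<^sub>i)\<close>, whose antisymmetrizer is the determinant of the complete
  homogeneous polynomials in \<open>f\<close> and \<open>g\<close>. Row operations turn its entries into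
  \<open>g ^ j + u x f ^ (j - 1)\<close>. Expanding this determinant by Pascal's rule builds up the layers
  \<open>i - j = t\<close> of the cells \<open>i \<ge> j \<ge> c\<close> of a totally symmetric plane partition one at a time, and
  what remains is an alternant, that is, a Schur polynomial times the Vandermonde product.
\<close>

section \<open>Antisymmetrizers\<close>

text \<open>Two obstacles shape the proof. The strict inequalities within a row couple neighbouring
  entries, so the sum over the row above a given one is not a product of geometric series.
  Neighbours can collide only at their common bound, hence the sum is a continuant: the diagonal
  holds the free sums, the off-diagonal terms weigh the collisions. Multiplied by Vandermonde
  factors, each free sum has just two boundary terms, L and R. Inserting the new variable at a
  position means L before it and R after it, which calls for the continuant that forbids R followed
  by L. Its off-diagonal terms differ from the collision weights, but the difference disappears
  under antisymmetrization. The other obstacle is the division by the Vandermonde product, while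
  variables may coincide and the field may be finite or of characteristic 2. The identity is
  therefore first shown for distinct nonzero variables over any field and then applied to
  \<open>x i + t ^ i\<close> in Laurent series in \<open>t\<close>; comparing constant terms gives
  the general case.\<close>

definition antisymmetrize :: "nat \<Rightarrow> ((nat \<Rightarrow> nat) \<Rightarrow> 'a::comm_ring_1) \<Rightarrow> 'a" where
  "antisymmetrize n F = (\<Sum>p | p permutes {0..<n}. of_int (sign p) * F p)"

lemma antisymmetrize_cong:
  "(\<And>p. p permutes {0..<n} \<Longrightarrow> F p = G p) \<Longrightarrow> antisymmetrize n F = antisymmetrize n G"
  by (auto simp: antisymmetrize_def intro: sum.cong)

lemma antisymmetrize_add: "antisymmetrize n (\<lambda>p. F p + G p) = antisymmetrize n F + antisymmetrize n G"
  by (simp add: antisymmetrize_def sum.distrib distrib_left)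

lemma antisymmetrize_diff: "antisymmetrize n (\<lambda>p. F p - G p) = antisymmetrize n F - antisymmetrize n G"
  by (simp add: antisymmetrize_def sum_subtractf right_diff_distrib)

lemma antisymmetrize_cmult: "antisymmetrize n (\<lambda>p. c * F p) = c * antisymmetrize n F"
  by (simp add: antisymmetrize_def sum_distrib_left mult_ac)

lemma antisymmetrize_sum: "antisymmetrize n (\<lambda>p. \<Sum>i\<in>I. F i p) = (\<Sum>i\<in>I. antisymmetrize n (F i))"
  unfolding antisymmetrize_def sum_distrib_left by (rule sum.swap)

lemma sign_comp_transpose:
  assumes "p permutes {0..<n::nat}" "r \<noteq> s"
  shows "sign (p \<circ> transpose r s) = - sign p"
  using sign_compose[OF permutes_imp_permutation[OF finite_atLeastLessThan assms(1)] permutation_swap_id[of r s]] assms(2)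
  by (simp add: sign_swap_id)

lemma antisymmetrize_transpose:
  assumes "r < n" "s < n" "r \<noteq> s"
  shows "antisymmetrize n (\<lambda>p. F (p \<circ> transpose r s)) = - antisymmetrize n F"
proof -
  have t: "transpose r s permutes {0..<n}"
    by (rule permutes_swap_id) (use assms in auto)
  have "antisymmetrize n F = (\<Sum>p | p permutes {0..<n}. of_int (sign (p \<circ> transpose r s)) * F (p \<circ> transpose r s))"
    unfolding antisymmetrize_def
    by (rule sum.reindex_bij_witness[where i = "\<lambda>p. p \<circ> transpose r s" and j = "\<lambda>p. p \<circ> transpose r s"])
      (auto simp: comp_assoc intro: permutes_compose t)
  also have "\<dots> = (\<Sum>p | p permutes {0..<n}. - (of_int (sign p) * F (p \<circ> transpose r s)))"
  proof (rule sum.cong[OF refl])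
    fix p assume "p \<in> {p. p permutes {0..<n}}"
    hence p: "p permutes {0..<n}" by simp
    show "of_int (sign (p \<circ> transpose r s)) * F (p \<circ> transpose r s)
        = - (of_int (sign p) * F (p \<circ> transpose r s))"
      using sign_comp_transpose[OF p assms(3)] by simp
  qed
  finally show ?thesis by (simp add: antisymmetrize_def sum_negf)
qed

text \<open>The permutations are paired off, so that no division by 2 is needed.\<close>

lemma antisymmetrize_eq_0:
  assumes "r < n" "s < n" "r \<noteq> s"
    and inv: "\<And>p. p permutes {0..<n} \<Longrightarrow> F (p \<circ> transpose r s) = F p"
  shows "antisymmetrize n F = 0"
proof -
  define t where "t = transpose r s"
  define S where "S = {p. p permutes {0..<n} \<and> p r < p s}"
  define S' where "S' = {p. p permutes {0..<n} \<and> p s < p r}"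
  have t: "t permutes {0..<n}"
    unfolding t_def by (rule permutes_swap_id) (use assms in auto)
  have fin: "finite {p. p permutes {0..<n}}" by (simp add: finite_permutations)
  have "p r \<noteq> p s" if "p permutes {0..<n}" for p
    using permutes_inj[OF that] assms(3) by (auto dest: injD)
  hence "{p. p permutes {0..<n}} = S \<union> S'"
    by (auto simp: S_def S'_def linorder_neq_iff)
  moreover have "S \<inter> S' = {}" by (auto simp: S_def S'_def)
  moreover have "finite S" "finite S'"
    by (rule finite_subset[OF _ fin]; auto simp: S_def S'_def)+
  ultimately have "antisymmetrize n F = (\<Sum>p\<in>S. of_int (sign p) * F p) + (\<Sum>p\<in>S'. of_int (sign p) * F p)"
    by (simp add: antisymmetrize_def sum.union_disjoint)
  also have "(\<Sum>p\<in>S'. of_int (sign p) * F p) = (\<Sum>p\<in>S. of_int (sign (p \<circ> t)) * F (p \<circ> t))"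
    by (rule sum.reindex_bij_witness[where i = "\<lambda>p. p \<circ> t" and j = "\<lambda>p. p \<circ> t"])
      (use t in \<open>auto simp: S_def S'_def comp_assoc permutes_compose t_def\<close>)
  also have "\<dots> = (\<Sum>p\<in>S. - (of_int (sign p) * F p))"
  proof (rule sum.cong[OF refl])
    fix p assume "p \<in> S"
    hence p: "p permutes {0..<n}" by (simp add: S_def)
    show "of_int (sign (p \<circ> t)) * F (p \<circ> t) = - (of_int (sign p) * F p)"
      using inv[OF p] sign_comp_transpose[OF p assms(3)] by (simp add: t_def)
  qed
  finally show ?thesis by (simp add: sum_negf)
qed

text \<open>A permutation with \<open>p i = j\<close> arises from one of \<open>n\<close> points by
  inserting the value \<open>j\<close> at place \<open>i\<close>; the sign changes by
  \<open>(-1) ^ (i + j)\<close>, as for a cofactor.\<close>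

lemma sum_permutes_insert:
  assumes "i \<le> n" "j \<le> n"
  shows "(\<Sum>p | p permutes {0..<Suc n} \<and> p i = j. of_int (sign p) * F p)
    = (-1) ^ (i + j) * antisymmetrize n (\<lambda>p. F (permutation_insert i j p))"
proof -
  have i: "i < Suc n" and j: "j < Suc n" using assms by auto
  have "(\<Sum>p | p permutes {0..<Suc n} \<and> p i = j. of_int (sign p) * F p)
    = (\<Sum>q | q permutes {0..<n}. of_int (sign (permutation_insert i j q)) * F (permutation_insert i j q))"
    unfolding permutation_fix[OF i j]
    by (subst sum.reindex) (simp_all add: permutation_insert_inj_on[OF i j])
  also have "\<dots> = (\<Sum>q | q permutes {0..<n}. (-1) ^ (i + j) * (of_int (sign q) * F (permutation_insert i j q)))"
    by (rule sum.cong[OF refl]) (simp add: signof_permutation_insert[OF _ i j] mult.assoc)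
  finally show ?thesis by (simp add: antisymmetrize_def sum_distrib_left)
qed

text \<open>Laplace expansion according to where the value \<open>j\<close> sits. With
  \<open>j = n\<close> it inserts a new last variable into every word of the earlier ones.\<close>

lemma antisymmetrize_insert_position:
  assumes "j \<le> n"
  shows "antisymmetrize (Suc n) F = (\<Sum>i\<le>n. (-1) ^ (i + j) * antisymmetrize n (\<lambda>p. F (permutation_insert i j p)))"
proof -
  let ?Q = "\<lambda>i. {p. p permutes {0..<Suc n} \<and> p i = j}"
  have fin: "finite {p. p permutes {0..<Suc n}}" by (simp add: finite_permutations)
  have "{p. p permutes {0..<Suc n}} = (\<Union>i\<in>{..n}. ?Q i)"
    using permutation_split_ran[of j "{0..<Suc n}"] assms by (auto simp: atLeast0LessThan lessThan_Suc_atMost)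
  hence "antisymmetrize (Suc n) F = (\<Sum>i\<le>n. \<Sum>p\<in>?Q i. of_int (sign p) * F p)"
    unfolding antisymmetrize_def
    using permutation_disjoint_dom[of _ "{0..<Suc n}" _ j] assms
    by (simp only:, intro sum.UNION_disjoint) (auto intro: finite_subset[OF _ fin])
  thus ?thesis using assms by (simp add: sum_permutes_insert)
qed

text \<open>The transposed expansion: the place \<open>i\<close> is fixed and its value varies. With
  \<open>i = n\<close> it singles out the last row of a determinant.\<close>

lemma antisymmetrize_insert_value:
  assumes "i \<le> n"
  shows "antisymmetrize (Suc n) F = (\<Sum>j\<le>n. (-1) ^ (i + j) * antisymmetrize n (\<lambda>p. F (permutation_insert i j p)))"
proof -
  let ?Q = "\<lambda>j. {p. p permutes {0..<Suc n} \<and> p i = j}"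
  have fin: "finite {p. p permutes {0..<Suc n}}" by (simp add: finite_permutations)
  have "{p. p permutes {0..<Suc n}} = (\<Union>j\<in>{..n}. ?Q j)"
    using permutes_in_image[of _ "{0..<Suc n}" i] assms by (fastforce simp: less_Suc_eq_le)
  hence "antisymmetrize (Suc n) F = (\<Sum>j\<le>n. \<Sum>p\<in>?Q j. of_int (sign p) * F p)"
    unfolding antisymmetrize_def
    by (simp only:, intro sum.UNION_disjoint) (auto intro: finite_subset[OF _ fin])
  thus ?thesis using assms by (simp add: sum_permutes_insert)
qed

section \<open>Alternants\<close>

text \<open>The determinant of the matrix with entries \<open>(gs ! i) t\<close>. Its rows form a
  list of functions, so that they can be split, scaled and moved within a segment of the
  list.\<close>

definition alt :: "(nat \<Rightarrow> 'a::comm_ring_1) list \<Rightarrow> 'a" where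
  "alt gs = antisymmetrize (length gs) (\<lambda>p. \<Prod>i<length gs. (gs ! i) (p i))"

lemma prod_lessThan_add:
  "(\<Prod>i<a + b::nat. f i) = (\<Prod>i<a. f i) * (\<Prod>i<b. f (a + i))"
  by (induction b) (simp_all add: mult_ac)

lemma prod_nth_middle:
  fixes h :: "'b \<Rightarrow> nat \<Rightarrow> 'a::comm_monoid_mult"
  shows "(\<Prod>i<length (xs @ a # ys). h ((xs @ a # ys) ! i) i)
    = (\<Prod>i<length xs. h (xs ! i) i) * h a (length xs)
      * (\<Prod>i<length ys. h (ys ! i) (length xs + 1 + i))"
proof -
  let ?f = "\<lambda>i. h ((xs @ a # ys) ! i) i"
  have "(\<Prod>i<length (xs @ a # ys). ?f i) = (\<Prod>i<length xs + Suc (length ys). ?f i)" by simp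
  also have "\<dots> = (\<Prod>i<length xs. ?f i) * (\<Prod>i<Suc (length ys). ?f (length xs + i))"
    by (rule prod_lessThan_add)
  also have "(\<Prod>i<Suc (length ys). ?f (length xs + i)) = h a (length xs) * (\<Prod>i<length ys. ?f (length xs + Suc i))"
    by (subst prod.lessThan_Suc_shift) simp
  finally show ?thesis by (simp add: nth_append mult_ac)
qed

lemma alt_middle:
  "alt (xs @ a # ys) = antisymmetrize (length xs + Suc (length ys)) (\<lambda>p.
     (\<Prod>i<length xs. (xs ! i) (p i)) * a (p (length xs))
      * (\<Prod>i<length ys. (ys ! i) (p (length xs + 1 + i))))"
proof -
  have "(\<Prod>i<length (xs @ a # ys). ((xs @ a # ys) ! i) (p i))
    = (\<Prod>i<length xs. (xs ! i) (p i)) * a (p (length xs))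
      * (\<Prod>i<length ys. (ys ! i) (p (length xs + 1 + i)))" for p
    using prod_nth_middle[where h = "\<lambda>g i. g (p i)"] .
  thus ?thesis by (simp only: alt_def length_append length_Cons)
qed

lemma alt_add:
  "alt (xs @ (\<lambda>t. a t + b t) # ys) = alt (xs @ a # ys) + alt (xs @ b # ys)"
  by (simp add: alt_middle antisymmetrize_add[symmetric] algebra_simps)

lemma alt_cmult: "alt (xs @ (\<lambda>t. c * a t) # ys) = c * alt (xs @ a # ys)"
  by (simp add: alt_middle antisymmetrize_cmult[symmetric] mult_ac)

lemma alt_sum: "alt (xs @ (\<lambda>t. \<Sum>i\<in>I. a i t) # ys) = (\<Sum>i\<in>I. alt (xs @ a i # ys))"
  by (simp add: alt_middle antisymmetrize_sum[symmetric] sum_distrib_left sum_distrib_right)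

lemma prod_nth_transpose:
  assumes "r < n" "s < n"
  shows "(\<Prod>i<n. h (transpose r s i) (p (transpose r s i))) = (\<Prod>i<n. h i (p i))"
  by (rule prod.reindex_bij_witness[where i = "transpose r s" and j = "transpose r s"])
    (use assms in \<open>auto simp: transpose_def\<close>)

lemma alt_equal:
  assumes "r < length gs" "s < length gs" "r \<noteq> s" "gs ! r = gs ! s"
  shows "alt gs = 0"
  unfolding alt_def
proof (rule antisymmetrize_eq_0[OF assms(1-3)])
  fix p
  have "gs ! i = gs ! transpose r s i" for i
    using assms(4) by (simp add: transpose_def)
  hence "(\<Prod>i<length gs. (gs ! i) ((p \<circ> transpose r s) i))
    = (\<Prod>i<length gs. (gs ! transpose r s i) (p (transpose r s i)))" by simp
  also have "\<dots> = (\<Prod>i<length gs. (gs ! i) (p i))"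
    using assms(1,2) prod_nth_transpose[of r "length gs" s "\<lambda>i. gs ! i" p] by simp
  finally show "(\<Prod>i<length gs. (gs ! i) ((p \<circ> transpose r s) i)) = (\<Prod>i<length gs. (gs ! i) (p i))" .
qed

lemma alt_not_distinct: "\<not> distinct gs \<Longrightarrow> alt gs = 0"
  by (metis alt_equal distinct_conv_nth)

lemma alt_swap:
  "alt (xs @ a # b # ys) = - alt (xs @ b # a # ys)"
proof -
  let ?gs = "xs @ a # b # ys" and ?hs = "xs @ b # a # ys" and ?r = "length xs"
  have "?hs ! i = ?gs ! transpose ?r (Suc ?r) i" for i
    by (auto simp: nth_append transpose_def nth_Cons split: nat.split)
  hence "alt ?hs = antisymmetrize (length ?gs) (\<lambda>p. \<Prod>i<length ?gs. (?gs ! transpose ?r (Suc ?r) i) (p i))"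
    by (simp add: alt_def)
  also have "\<dots> = antisymmetrize (length ?gs) (\<lambda>p. (\<lambda>q. \<Prod>i<length ?gs. (?gs ! i) (q i)) (p \<circ> transpose ?r (Suc ?r)))"
  proof (rule antisymmetrize_cong)
    fix p
    have "(\<Prod>i<length ?gs. (?gs ! transpose ?r (Suc ?r) i) ((p \<circ> transpose ?r (Suc ?r)) (transpose ?r (Suc ?r) i)))
      = (\<Prod>i<length ?gs. (?gs ! i) ((p \<circ> transpose ?r (Suc ?r)) i))"
      by (rule prod_nth_transpose[where h = "\<lambda>i. ?gs ! i"]) simp_all
    thus "(\<Prod>i<length ?gs. (?gs ! transpose ?r (Suc ?r) i) (p i))
      = (\<lambda>q. \<Prod>i<length ?gs. (?gs ! i) (q i)) (p \<circ> transpose ?r (Suc ?r))" by simp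
  qed
  also have "\<dots> = - alt ?gs"
    unfolding alt_def by (rule antisymmetrize_transpose) simp_all
  finally show ?thesis by simp
qed

lemma alt_move: "alt (xs @ zs @ a # ys) = (-1) ^ length zs * alt (xs @ a # zs @ ys)"
proof (induction zs arbitrary: xs)
  case (Cons z zs)
  have "alt (xs @ (z # zs) @ a # ys) = (-1) ^ length zs * alt (xs @ z # a # zs @ ys)"
    using Cons[of "xs @ [z]"] by simp
  thus ?case by (simp add: alt_swap[of xs z a])
qed simp

lemma alt_rev: "alt (rev gs) = (-1) ^ (length gs choose 2) * alt gs"
proof -
  have "alt (xs @ rev gs) = (-1) ^ (length gs choose 2) * alt (xs @ gs)" for xs
  proof (induction gs arbitrary: xs)
    case (Cons g gs)
    have "alt (xs @ rev (g # gs)) = (-1) ^ length gs * alt (xs @ g # rev gs)"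
      using alt_move[of xs "rev gs" g "[]"] by simp
    also have "\<dots> = (-1) ^ length gs * ((-1) ^ (length gs choose 2) * alt (xs @ g # gs))"
      using Cons[of "xs @ [g]"] by simp
    finally show ?case by (simp add: numeral_2_eq_2 power_add)
  qed (simp add: numeral_2_eq_2)
  from this[of "[]"] show ?thesis by simp
qed

text \<open>Here the factor depends on the point \<open>t\<close>, so it scales the columns; every
  permutation meets each column once.\<close>

lemma alt_cmult_all:
  "alt (map (\<lambda>g t. c t * g t) gs) = (\<Prod>i<length gs. c i) * alt gs"
proof -
  have "(\<Prod>i<length gs. c (p i)) = (\<Prod>i<length gs. c i)" if "p permutes {0..<length gs}" for p
    using prod.permute[OF that, of c] by (simp add: atLeast0LessThan o_def)
  thus ?thesis
    unfolding alt_def by (auto simp: antisymmetrize_cmult[symmetric] prod.distrib intro!: antisymmetrize_cong)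
qed

lemma alt_segment_cmult:
  "alt (xs @ map (\<lambda>j t. c j * g j t) js @ ys) = (\<Prod>j\<leftarrow>js. c j) * alt (xs @ map g js @ ys)"
proof (induction js arbitrary: xs)
  case (Cons j js)
  show ?case
    using Cons[of "xs @ [\<lambda>t. c j * g j t]"] alt_cmult[of xs "c j" "g j" "map g js @ ys"]
    by (simp add: mult_ac)
qed simp

text \<open>Multilinearity in a block of rows; \<open>E\<close> records the rows that take the
  second summand. These sets later become the places where a layer of a slice array exceeds the next
  one.\<close>

lemma alt_segment_add:
  assumes "distinct js"
  shows "alt (xs @ map (\<lambda>j t. f j t + g j t) js @ ys)
    = (\<Sum>E\<in>Pow (set js). alt (xs @ map (\<lambda>j. if j \<in> E then g j else f j) js @ ys))"
  using assms
proof (induction js arbitrary: xs)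
  case (Cons j js)
  let ?A = "\<lambda>E. alt (xs @ map (\<lambda>j. if j \<in> E then g j else f j) (j # js) @ ys)"
  have A: "alt (xs @ map (\<lambda>j t. f j t + g j t) (j # js) @ ys)
    = (\<Sum>E\<in>Pow (set js). alt ((xs @ [f j]) @ map (\<lambda>j. if j \<in> E then g j else f j) js @ ys))
      + (\<Sum>E\<in>Pow (set js). alt ((xs @ [g j]) @ map (\<lambda>j. if j \<in> E then g j else f j) js @ ys))"
    using Cons.IH[of "xs @ [f j]"] Cons.IH[of "xs @ [g j]"] Cons.prems
      alt_add[of xs "f j" "g j" "map (\<lambda>j t. f j t + g j t) js @ ys"] by simp
  have "(\<Sum>E\<in>Pow (set js). alt ((xs @ [f j]) @ map (\<lambda>j. if j \<in> E then g j else f j) js @ ys))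
    = (\<Sum>E\<in>Pow (set js). ?A E)"
    using Cons.prems by (intro sum.cong refl) auto
  moreover have "(\<Sum>E\<in>Pow (set js). alt ((xs @ [g j]) @ map (\<lambda>j. if j \<in> E then g j else f j) js @ ys))
    = (\<Sum>E\<in>insert j ` Pow (set js). ?A E)"
  proof (subst sum.reindex)
    show "inj_on (insert j) (Pow (set js))"
      using Cons.prems by (auto simp: inj_on_def)
    have map_eq: "map (\<lambda>i. if i \<in> E then g i else f i) js = map (\<lambda>i. if i \<in> insert j E then g i else f i) js" for E
      using Cons.prems by auto
    show "(\<Sum>E\<in>Pow (set js). alt ((xs @ [g j]) @ map (\<lambda>j. if j \<in> E then g j else f j) js @ ys))
      = sum (?A \<circ> insert j) (Pow (set js))"
    proof (rule sum.cong[OF refl])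
      fix E
      show "alt ((xs @ [g j]) @ map (\<lambda>j. if j \<in> E then g j else f j) js @ ys) = (?A \<circ> insert j) E"
        using arg_cong[OF map_eq[of E], of "\<lambda>l. alt (xs @ g j # l @ ys)"]
        by (simp only: o_apply list.map append_assoc append.simps insertI1 if_True)
    qed
  qed
  moreover have "Pow (set js) \<inter> insert j ` Pow (set js) = {}" using Cons.prems by auto
  ultimately show ?case
    unfolding A by (simp add: Pow_insert sum.union_disjoint)
qed simp

text \<open>Replacing entries one at a time, from the last to the first, by entries that differ from them
  by combinations of the earlier ones.\<close>

lemma alt_unitriangular:
  assumes "\<And>j. j < n \<Longrightarrow> \<exists>c. \<forall>t. m j t = h j t + (\<Sum>i<j. c i * h i t)"
  shows "alt (map m [0..<n]) = alt (map h [0..<n])"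
proof -
  have "k \<le> n \<Longrightarrow> alt (map h [0..<k] @ ys) = alt (map m [0..<k] @ ys)" for k ys
  proof (induction k arbitrary: ys)
    case (Suc k)
    obtain c where c: "\<And>t. m k t = h k t + (\<Sum>i<k. c i * h i t)"
      using assms[of k] Suc.prems by auto
    have z: "alt (map h [0..<k] @ h i # ys) = 0" if "i < k" for i
      by (rule alt_equal[of i _ k]) (use that in \<open>auto simp: nth_append\<close>)
    have "alt (map m [0..<Suc k] @ ys) = alt (map h [0..<k] @ m k # ys)"
      using Suc.IH[of "m k # ys"] Suc.prems by simp
    also have "m k = (\<lambda>t. h k t + (\<Sum>i<k. c i * h i t))" using c by auto
    also have "alt (map h [0..<k] @ \<dots> # ys) = alt (map h [0..<Suc k] @ ys)"
      by (simp only: alt_add alt_sum alt_cmult) (simp add: z)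
    finally show ?case by simp
  qed simp
  from this[of n "[]"] show ?thesis by simp
qed

section \<open>Interlacing rows\<close>

definition interlacing :: "(nat \<Rightarrow> nat) \<Rightarrow> nat \<Rightarrow> (nat \<Rightarrow> nat) set" where
  "interlacing k r = {l. (\<forall>j<r. k j \<le> l j \<and> l j \<le> k (Suc j)) \<and>
     (\<forall>j. Suc j < r \<longrightarrow> l j < l (Suc j)) \<and> (\<forall>j\<ge>r. l j = 0)}"

lemma finite_interlacing: "finite (interlacing k r)"
proof (rule finite_subset)
  let ?B = "{..Max (k ` {..r})}"
  show "interlacing k r \<subseteq> {l. \<forall>j. (j \<in> {..<r} \<longrightarrow> l j \<in> ?B) \<and> (j \<notin> {..<r} \<longrightarrow> l j = 0)}"
  proof -
    have "k (Suc j) \<le> Max (k ` {..r})" if "j < r" for j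
      using that by (intro Max_ge) auto
    thus ?thesis by (auto simp: interlacing_def intro: le_trans)
  qed
  show "finite {l. \<forall>j. (j \<in> {..<r} \<longrightarrow> l j \<in> ?B) \<and> (j \<notin> {..<r} \<longrightarrow> l j = 0)}"
    by (rule finite_set_of_finite_funs) simp_all
qed

lemma interlacing_0: "interlacing k 0 = {\<lambda>_. 0}"
  by (auto simp: interlacing_def)

text \<open>The determinant of a tridiagonal matrix with diagonal \<open>a\<close> and products
  \<open>c j\<close> of opposite off-diagonal entries. It evaluates sums over words with a forbidden
  pair at neighbouring places: \<open>a j\<close> is the sum over free choices, \<open>c j\<close>
  the weight of the forbidden pair.\<close>

fun continuant :: "(nat \<Rightarrow> 'a::comm_ring_1) \<Rightarrow> (nat \<Rightarrow> 'a) \<Rightarrow> nat \<Rightarrow> 'a" where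
  "continuant a c 0 = 1"
| "continuant a c (Suc 0) = a 0"
| "continuant a c (Suc (Suc r)) = a (Suc r) * continuant a c (Suc r) - c r * continuant a c r"

lemma continuant_cong:
  "(\<And>j. j < r \<Longrightarrow> a j = a' j) \<Longrightarrow> (\<And>j. Suc j < r \<Longrightarrow> c j = c' j)
    \<Longrightarrow> continuant a c r = continuant a' c' r"
  by (induction a c r rule: continuant.induct) auto

text \<open>Append the last entry \<open>t\<close> without regard to strictness. Strictness then
  fails only if \<open>t\<close> and its left neighbour both equal \<open>k (Suc r)\<close>. The
  entries before them are at most \<open>k r\<close>, which is smaller, so the failing rows are
  indexed freely by \<open>interlacing k r\<close>.\<close>

lemma interlacing_sum_step:
  fixes f :: "nat \<Rightarrow> nat \<Rightarrow> 'a::comm_ring_1" and k :: "nat \<Rightarrow> nat"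
  defines "I \<equiv> \<lambda>r. \<Sum>l\<in>interlacing k r. \<Prod>j<r. f j (l j)"
  assumes k: "\<And>j. j < Suc (Suc r) \<Longrightarrow> k j < k (Suc j)"
  shows "I (Suc (Suc r)) = (\<Sum>t\<in>{k (Suc r)..k (Suc (Suc r))}. f (Suc r) t) * I (Suc r)
     - f r (k (Suc r)) * f (Suc r) (k (Suc r)) * I r"
proof -
  let ?T = "{k (Suc r)..k (Suc (Suc r))}"
  define g where "g = (\<lambda>(l, t). (\<Prod>j<Suc r. f j (l j)) * f (Suc r) t)"
  define X where "X = interlacing k (Suc r) \<times> ?T"
  define G where "G = {(l, t) \<in> X. l r < t}"
  define D where "D = {(l, t) \<in> X. \<not> l r < t}"
  have fin: "finite X" by (simp add: X_def finite_interlacing)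
  have D: "l r = k (Suc r) \<and> t = k (Suc r)" if "(l, t) \<in> D" for l t
  proof -
    have "l r \<le> k (Suc r)" "k (Suc r) \<le> t" "t \<le> l r"
      using that by (auto simp: D_def X_def interlacing_def)
    thus ?thesis by simp
  qed
  have "(\<Sum>t\<in>?T. f (Suc r) t) * I (Suc r) = (\<Sum>x\<in>X. g x)"
    unfolding I_def X_def g_def
    by (subst mult.commute) (simp add: sum_product sum.cartesian_product del: prod.lessThan_Suc)
  also have "X = G \<union> D" "G \<inter> D = {}" by (auto simp: G_def D_def)
  hence "(\<Sum>x\<in>X. g x) = (\<Sum>x\<in>G. g x) + (\<Sum>x\<in>D. g x)"
    using fin by (metis finite_Un sum.union_disjoint)
  also have "(\<Sum>x\<in>G. g x) = I (Suc (Suc r))"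
    unfolding I_def
  proof (rule sum.reindex_bij_witness[where i = "\<lambda>l. (l(Suc r := 0), l (Suc r))" and j = "\<lambda>(l, t). l(Suc r := t)"], goal_cases)
    case (1 x)
    thus ?case by (auto simp: G_def X_def interlacing_def fun_eq_iff)
  next
    case (2 x)
    thus ?case by (auto simp: G_def X_def interlacing_def less_Suc_eq)
  next
    case (3 l)
    thus ?case by auto
  next
    case (4 l)
    thus ?case by (auto simp: G_def X_def interlacing_def)
  next
    case (5 x)
    thus ?case by (auto simp: g_def split: prod.split)
  qed
  also have "(\<Sum>x\<in>D. g x) = (\<Sum>l\<in>interlacing k r. f r (k (Suc r)) * f (Suc r) (k (Suc r)) * (\<Prod>j<r. f j (l j)))"
  proof (rule sum.reindex_bij_witness[where i = "\<lambda>l. (l(r := k (Suc r)), k (Suc r))" and j = "\<lambda>(l, t). l(r := 0)"], goal_cases)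
    case (1 x)
    obtain l t where x: "x = (l, t)" by (cases x)
    from 1 D[of l t] have "l r = k (Suc r)" "t = k (Suc r)" by (auto simp: x)
    thus ?case by (auto simp: x fun_eq_iff)
  next
    case (2 x)
    thus ?case by (auto simp: D_def X_def interlacing_def)
  next
    case (3 l)
    thus ?case by (auto simp: interlacing_def)
  next
    case (4 l)
    have "l j < k (Suc r)" if "Suc j = r" for j
      using 4 k[of r] that by (auto simp: interlacing_def intro: le_less_trans)
    thus ?case using 4 k[of r] k[of "Suc r"]
      by (auto simp: D_def X_def interlacing_def less_Suc_eq)
  next
    case (5 x)
    obtain l t where x: "x = (l, t)" by (cases x)
    from 5 D[of l t] have "l r = k (Suc r)" "t = k (Suc r)" by (auto simp: x)
    thus ?case by (simp add: x g_def mult_ac)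
  qed
  finally show ?thesis by (simp add: I_def sum_distrib_left)
qed

lemma interlacing_sum:
  fixes f :: "nat \<Rightarrow> nat \<Rightarrow> 'a::comm_ring_1"
  assumes "\<And>j. j < r \<Longrightarrow> k j < k (Suc j)"
  shows "(\<Sum>l\<in>interlacing k r. \<Prod>j<r. f j (l j))
    = continuant (\<lambda>j. \<Sum>t\<in>{k j..k (Suc j)}. f j t) (\<lambda>j. f j (k (Suc j)) * f (Suc j) (k (Suc j))) r"
  using assms
proof (induction r rule: induct_nat_012)
  case 0
  thus ?case by (simp add: interlacing_0)
next
  case 1
  have "(\<Sum>l\<in>interlacing k (Suc 0). f 0 (l 0)) = (\<Sum>t\<in>{k 0..k (Suc 0)}. f 0 t)"
    by (rule sum.reindex_bij_witness[where i = "\<lambda>t. (\<lambda>_. 0)(0 := t)" and j = "\<lambda>l. l 0"])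
      (auto simp: interlacing_def fun_eq_iff)
  thus ?case by simp
next
  case (ge2 r)
  show ?case
    by (subst interlacing_sum_step) (use ge2 in auto)
qed

text \<open>A word in \<open>a\<close> and \<open>b\<close> without a \<open>b\<close> directly
  followed by an \<open>a\<close> is a block of \<open>a\<close> and then a block of
  \<open>b\<close>. The left side lists these words by the boundary \<open>m\<close>, the continuant
  by excluding the forbidden pairs.\<close>

lemma sorted_choice_sum:
  fixes a b :: "nat \<Rightarrow> 'a::comm_ring_1"
  shows "(\<Sum>m\<le>r. (\<Prod>j<m. a j) * (\<Prod>j\<in>{m..<r}. b j))
    = continuant (\<lambda>j. a j + b j) (\<lambda>j. b j * a (Suc j)) r"
proof -
  define S where "S = (\<lambda>r. \<Sum>m\<le>r. (\<Prod>j<m. a j) * (\<Prod>j\<in>{m..<r}. b j))"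
  have S: "S (Suc r) = b r * S r + (\<Prod>j<Suc r. a j)" for r
    by (simp add: S_def sum_distrib_left mult_ac)
  have "S r = continuant (\<lambda>j. a j + b j) (\<lambda>j. b j * a (Suc j)) r"
  proof (induction r rule: induct_nat_012)
    case (ge2 r)
    have "(\<Prod>j<Suc r. a j) = S (Suc r) - b r * S r" by (simp only: S) simp
    hence "S (Suc (Suc r)) = b (Suc r) * S (Suc r) + a (Suc r) * (S (Suc r) - b r * S r)"
      by (simp only: S[of "Suc r"] prod.lessThan_Suc) (simp add: mult_ac)
    thus ?case by (simp add: ge2 algebra_simps)
  qed (simp_all add: S_def)
  thus ?thesis by (simp add: S_def)
qed

section \<open>Products over pairs of positions\<close>

definition pair_prod :: "('b \<Rightarrow> 'b \<Rightarrow> 'a::comm_monoid_mult) \<Rightarrow> nat \<Rightarrow> (nat \<Rightarrow> 'b) \<Rightarrow> 'a" where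
  "pair_prod P n z = (\<Prod>(i, j)\<in>{(i, j). i < j \<and> j < n}. P (z i) (z j))"

lemma finite_pairs: "finite {(i, j). i < j \<and> j < (n::nat)}"
  by (rule finite_subset[of _ "{..<n} \<times> {..<n}"]) auto

lemma pair_prod_eq: "pair_prod P n z = (\<Prod>j<n. \<Prod>i<j. P (z i) (z j))"
proof -
  have "pair_prod P n z = (\<Prod>(j, i)\<in>Sigma {..<n} (\<lambda>j. {..<j}). P (z i) (z j))"
    unfolding pair_prod_def
    by (rule prod.reindex_bij_witness[where i = "\<lambda>(i, j). (j, i)" and j = "\<lambda>(i, j). (j, i)"]) auto
  thus ?thesis by (simp add: prod.Sigma)
qed

lemma pair_prod_cong: "(\<And>j. j < n \<Longrightarrow> z j = z' j) \<Longrightarrow> pair_prod P n z = pair_prod P n z'"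
  by (auto simp: pair_prod_eq intro!: prod.cong)

text \<open>An adjacent transposition reverses the order of the pair \<open>(r, r + 1)\<close> only
  and permutes the remaining ordered pairs, whose product is \<open>Q\<close>.\<close>

lemma pair_prod_split:
  assumes "Suc r < n"
  obtains Q where "pair_prod P n z = P (z r) (z (Suc r)) * Q"
    "pair_prod P n (z \<circ> transpose r (Suc r)) = P (z (Suc r)) (z r) * Q"
proof -
  let ?t = "transpose r (Suc r)"
  let ?D = "{(i, j). i < j \<and> j < n}"
  let ?D' = "?D - {(r, Suc r)}"
  have mem: "(r, Suc r) \<in> ?D" using assms by simp
  have 1: "pair_prod P n y = P (y r) (y (Suc r)) * (\<Prod>(i, j)\<in>?D'. P (y i) (y j))" for y
    unfolding pair_prod_def by (subst prod.remove[OF finite_pairs mem]) simp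
  have "(\<Prod>(i, j)\<in>?D'. P ((z \<circ> ?t) i) ((z \<circ> ?t) j)) = (\<Prod>(i, j)\<in>?D'. P (z i) (z j))"
  proof (rule prod.reindex_bij_witness[where i = "\<lambda>(i, j). (?t i, ?t j)" and j = "\<lambda>(i, j). (?t i, ?t j)"])
    fix x assume "x \<in> ?D'"
    thus "(case x of (i, j) \<Rightarrow> (?t i, ?t j)) \<in> ?D'"
      using assms by (auto simp: transpose_def split: if_splits)
    thus "(case x of (i, j) \<Rightarrow> (?t i, ?t j)) \<in> ?D'" .
  qed auto
  thus thesis using that[of "\<Prod>(i, j)\<in>?D'. P (z i) (z j)"] 1[of z] 1[of "z \<circ> ?t"] by simp
qed

text \<open>Expanding the difference of the two continuants one place at a time, every term contains the
  difference of the coefficients at exactly one place \<open>r\<close>, and no other factor depends on the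
  order of the variables at the positions \<open>r\<close> and \<open>r + 1\<close>.\<close>

lemma antisymmetrize_continuant:
  fixes x :: "nat \<Rightarrow> 'b" and a :: "nat \<Rightarrow> 'b \<Rightarrow> 'a::comm_ring_1"
  defines "S \<equiv> \<lambda>c r z. continuant (\<lambda>j. a j (z j)) (\<lambda>j. c j (z j) (z (Suc j))) r"
  assumes sym: "\<And>j s t. Suc j < n \<Longrightarrow> (c j s t - c' j s t) * P s t = (c j t s - c' j t s) * P t s"
    and "r \<le> n"
    and "\<And>z z'. (\<And>j. r \<le> j \<Longrightarrow> z j = z' j) \<Longrightarrow> H z = H z'"
  shows "antisymmetrize n (\<lambda>p. pair_prod P n (x \<circ> p) * (S c r (x \<circ> p) - S c' r (x \<circ> p)) * H (x \<circ> p)) = 0"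
  using assms(3,4)
proof (induction r arbitrary: H rule: induct_nat_012)
  case 0
  show ?case by (simp add: S_def antisymmetrize_def)
next
  case 1
  show ?case by (simp add: S_def antisymmetrize_def)
next
  case (ge2 r)
  let ?z = "\<lambda>p. x \<circ> p" and ?PP = "\<lambda>p. pair_prod P n (x \<circ> p)"
  let ?F1 = "\<lambda>p. ?PP p * (S c (Suc r) (?z p) - S c' (Suc r) (?z p)) * (a (Suc r) (?z p (Suc r)) * H (?z p))"
  let ?F2 = "\<lambda>p. ?PP p * (S c r (?z p) - S c' r (?z p)) * (c' r (?z p r) (?z p (Suc r)) * H (?z p))"
  let ?F3 = "\<lambda>p. ?PP p * ((c r (?z p r) (?z p (Suc r)) - c' r (?z p r) (?z p (Suc r))) * S c r (?z p) * H (?z p))"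
  have H: "H z = H z'" if "\<And>j. Suc (Suc r) \<le> j \<Longrightarrow> z j = z' j" for z z'
    using ge2.prems(2) that by blast
  \<comment> \<open>The new factor reads position \<open>Suc r\<close> only, so it may join
    \<open>H\<close>; this is why the induction is over all \<open>H\<close> that ignore the first
    positions.\<close>
  have "antisymmetrize n ?F1 = 0"
  proof (rule ge2.IH(2)[where H = "\<lambda>z. a (Suc r) (z (Suc r)) * H z"])
    fix z z' :: "nat \<Rightarrow> 'b" assume eq: "\<And>j. Suc r \<le> j \<Longrightarrow> z j = z' j"
    thus "a (Suc r) (z (Suc r)) * H z = a (Suc r) (z' (Suc r)) * H z'"
      using H[of z z'] by simp
  qed (use ge2.prems(1) in simp)
  moreover have "antisymmetrize n ?F2 = 0"
  proof (rule ge2.IH(1)[where H = "\<lambda>z. c' r (z r) (z (Suc r)) * H z"])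
    fix z z' :: "nat \<Rightarrow> 'b" assume eq: "\<And>j. r \<le> j \<Longrightarrow> z j = z' j"
    thus "c' r (z r) (z (Suc r)) * H z = c' r (z' r) (z' (Suc r)) * H z'"
      using H[of z z'] by simp
  qed (use ge2.prems(1) in simp)
  moreover have "antisymmetrize n ?F3 = 0"
  proof (rule antisymmetrize_eq_0[of r n "Suc r"])
    fix p :: "nat \<Rightarrow> nat"
    let ?q = "p \<circ> transpose r (Suc r)"
    obtain Q where Q: "?PP p = P (?z p r) (?z p (Suc r)) * Q"
      "pair_prod P n ((x \<circ> p) \<circ> transpose r (Suc r)) = P (?z p (Suc r)) (?z p r) * Q"
      using pair_prod_split[of r n P "?z p"] ge2.prems(1) by auto
    have e1: "S c r (?z ?q) = S c r (?z p)"
      unfolding S_def by (rule continuant_cong) (auto simp: transpose_def)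
    have e2: "H (?z ?q) = H (?z p)"
      by (rule H) (auto simp: transpose_def)
    have e3: "pair_prod P n (x \<circ> ?q) = P (?z p (Suc r)) (?z p r) * Q"
      using Q(2) by (simp only: comp_assoc)
    have e4: "?z ?q r = ?z p (Suc r)" "?z ?q (Suc r) = ?z p r" by simp_all
    have e5: "(c r (?z p (Suc r)) (?z p r) - c' r (?z p (Suc r)) (?z p r)) * P (?z p (Suc r)) (?z p r)
        = (c r (?z p r) (?z p (Suc r)) - c' r (?z p r) (?z p (Suc r))) * P (?z p r) (?z p (Suc r))"
      using sym[of r] ge2.prems(1) by simp
    have e6: "p2 * Q * (d2 * s * h) = p1 * Q * (d1 * s * h)" if "d2 * p2 = d1 * p1"
      for p1 p2 d1 d2 s h :: 'a
    proof -
      have "p2 * Q * (d2 * s * h) = (d2 * p2) * (Q * s * h)" by (simp only: mult_ac)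
      also have "\<dots> = p1 * Q * (d1 * s * h)" unfolding that by (simp only: mult_ac)
      finally show ?thesis .
    qed
    show "?F3 ?q = ?F3 p"
      unfolding e1 e2 e3 e4 Q(1) by (rule e6[OF e5])
  qed (use ge2.prems(1) in auto)
  moreover have "antisymmetrize n (\<lambda>p. ?PP p * (S c (Suc (Suc r)) (?z p) - S c' (Suc (Suc r)) (?z p)) * H (?z p))
    = antisymmetrize n (\<lambda>p. ?F1 p - ?F2 p - ?F3 p)"
  proof (rule antisymmetrize_cong)
    fix p :: "nat \<Rightarrow> nat"
    have S: "S c (Suc (Suc r)) (?z p) = a (Suc r) (?z p (Suc r)) * S c (Suc r) (?z p)
        - c r (?z p r) (?z p (Suc r)) * S c r (?z p)" for c
      unfolding S_def continuant.simps(3) ..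
    have "q * (A * s - d * t - (A * s' - d' * t')) * h
      = q * (s - s') * (A * h) - q * (t - t') * (d' * h) - q * ((d - d') * t * h)"
      for q A s d t s' d' t' h :: 'a by (simp add: algebra_simps)
    thus "?PP p * (S c (Suc (Suc r)) (?z p) - S c' (Suc (Suc r)) (?z p)) * H (?z p) = ?F1 p - ?F2 p - ?F3 p"
      unfolding S .
  qed
  ultimately show ?case by (simp only: antisymmetrize_diff) simp
qed

section \<open>Weighted monotone triangles\<close>

definition edge_weight :: "'a::field \<Rightarrow> 'a \<Rightarrow> 'a \<Rightarrow> 'a \<Rightarrow> 'a \<Rightarrow> 'a" where
  "edge_weight u v w s t = v + w * s + u * s * t"

text \<open>The powers of \<open>X\<close> for leaning entries come from \<open>right_count\<close>
  and \<open>left_count\<close> in \<open>d_hat\<close>: leaning right raises the exponent by 1,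
  leaning left lowers it by 1.\<close>

definition entry_weight :: "'a::field \<Rightarrow> 'a \<Rightarrow> 'a \<Rightarrow> 'a \<Rightarrow> nat \<Rightarrow> nat \<Rightarrow> nat \<Rightarrow> 'a" where
  "entry_weight u v w X a b t =
     (if t = a then v / X else if t = b then u * X else u * X + w + v / X)"

text \<open>The weighted number of monotone triangles with bottom row \<open>k 0 < \<dots> < k (n - 1)\<close>; the exponents
  of the variables are larger by 1 than those of the weight of an alternating sign matrix.\<close>

fun triangle_sum :: "'a::field \<Rightarrow> 'a \<Rightarrow> 'a \<Rightarrow> (nat \<Rightarrow> 'a) \<Rightarrow> nat \<Rightarrow> (nat \<Rightarrow> nat) \<Rightarrow> 'a" where
  "triangle_sum u v w x 0 k = 1"
| "triangle_sum u v w x (Suc r) k = (\<Sum>l\<in>interlacing k r. x r ^ (\<Sum>j\<le>r. k j)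
     * (\<Prod>j<r. entry_weight u v w (x r) (k j) (k (Suc j)) (l j) / x r ^ l j)
     * triangle_sum u v w x r l)"

text \<open>The factor \<open>X - z\<close> sums the geometric series in \<open>z / X\<close>. The
  special weights at both ends turn the two boundary coefficients into edge weights, one for each
  order of \<open>z\<close> and \<open>X\<close>.\<close>

lemma entry_weight_sum:
  fixes X z :: "'a::field"
  assumes "X \<noteq> 0" "a < b"
  shows "(\<Sum>t\<in>{a..b}. entry_weight u v w X a b t / X ^ t * z ^ t * (X - z))
    = edge_weight u v w z X * (z / X) ^ a - edge_weight u v w X z * (z / X) ^ b"
proof -
  define y where "y = z / X"
  have z: "z = y * X" using assms by (simp add: y_def)
  have e: "(\<Sum>t\<in>{a..b}. entry_weight u v w X a b t / X ^ t * z ^ t * (X - z))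
    = (\<Sum>t\<in>{a..b}. entry_weight u v w X a b t * y ^ t * (X - z))"
    by (simp add: y_def power_divide mult_ac)
  have s: "{a..b} = insert a (insert b {Suc a..<b})" using assms(2) by auto
  have g: "(\<Sum>t\<in>{Suc a..<b}. y ^ t) * (1 - y) = y ^ Suc a - y ^ b"
  proof -
    have "(\<Sum>t\<in>{Suc a..<b}. y ^ t * (1 - y)) = (\<Sum>t\<in>{Suc a..<b}. y ^ t - y ^ Suc t)"
      by (simp add: algebra_simps)
    also have "\<dots> = y ^ Suc a - y ^ b"
      using sum_Suc_diff'[of "Suc a" b "\<lambda>t. - (y ^ t)"] assms(2) by simp
    finally show ?thesis by (simp add: sum_distrib_right)
  qed
  have "(\<Sum>t\<in>{a..b}. entry_weight u v w X a b t * y ^ t * (X - z))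
    = v / X * y ^ a * (X - z) + u * X * y ^ b * (X - z)
      + (\<Sum>t\<in>{Suc a..<b}. (u * X + w + v / X) * y ^ t * (X - z))"
    unfolding s using assms(2) by (simp add: entry_weight_def add_ac)
  also have "(u * X + w + v / X) * y ^ t * (X - z) = (u * X + w + v / X) * X * (1 - y) * y ^ t" for t
  proof -
    have "X - z = X * (1 - y)" by (simp add: z algebra_simps)
    thus ?thesis by (simp only: mult_ac)
  qed
  hence "(\<Sum>t\<in>{Suc a..<b}. (u * X + w + v / X) * y ^ t * (X - z))
    = (u * X + w + v / X) * X * ((\<Sum>t\<in>{Suc a..<b}. y ^ t) * (1 - y))"
    by (simp only: sum_distrib_left[symmetric]) (simp only: mult_ac)
  finally have "(\<Sum>t\<in>{a..b}. entry_weight u v w X a b t * y ^ t * (X - z))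
    = v / X * y ^ a * (X - z) + u * X * y ^ b * (X - z)
      + (u * X + w + v / X) * X * (y ^ Suc a - y ^ b)"
    by (simp only: g)
  also have "\<dots> = edge_weight u v w z X * y ^ a - edge_weight u v w X z * y ^ b"
    using assms(1) by (simp add: edge_weight_def z field_simps)
  finally show ?thesis
    unfolding e y_def[symmetric] .
qed

text \<open>Up to powers and Vandermonde factors, \<open>c'\<close> is the weight of two neighbours
  colliding at \<open>e\<close>: the left one leans right, the right one leans left.
  \<open>c\<close> is the forbidden product of boundary terms. Both share the symmetric factor
  \<open>(s / X) ^ e * (t / X) ^ e\<close>, and a polynomial identity remains.\<close>

lemma edge_weight_exchange:
  fixes u v w X s t :: "'a::field" and e :: nat
  assumes "X \<noteq> 0"
  defines "c \<equiv> \<lambda>s t. - (edge_weight u v w X s * (s / X) ^ e) * (edge_weight u v w t X * (t / X) ^ e)"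
    and "c' \<equiv> \<lambda>s t. (u * X / X ^ e * s ^ e * (X - s)) * (v / X / X ^ e * t ^ e * (X - t))"
  shows "(c s t - c' s t) * edge_weight u v w s t = (c t s - c' t s) * edge_weight u v w t s"
proof -
  have c: "c s t = - (edge_weight u v w X s * edge_weight u v w t X) * ((s / X) ^ e * (t / X) ^ e)" for s t
    by (simp add: c_def)
  have c': "c' s t = u * v * (X - s) * (X - t) * ((s / X) ^ e * (t / X) ^ e)" for s t
    using assms(1) by (simp add: c'_def power_divide)
  show ?thesis
  proof -
    have "(- (edge_weight u v w X s * edge_weight u v w t X) - u * v * (X - s) * (X - t)) * edge_weight u v w s t
      = (- (edge_weight u v w X t * edge_weight u v w s X) - u * v * (X - t) * (X - s)) * edge_weight u v w t s"
      by (simp add: edge_weight_def algebra_simps)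
    hence "(- (edge_weight u v w X s * edge_weight u v w t X) - u * v * (X - s) * (X - t)) * edge_weight u v w s t
        * ((s / X) ^ e * (t / X) ^ e)
      = (- (edge_weight u v w X t * edge_weight u v w s X) - u * v * (X - t) * (X - s)) * edge_weight u v w t s
        * ((t / X) ^ e * (s / X) ^ e)" by simp
    moreover have "c s t - c' s t = (- (edge_weight u v w X s * edge_weight u v w t X) - u * v * (X - s) * (X - t))
        * ((s / X) ^ e * (t / X) ^ e)" for s t
      unfolding c c' left_diff_distrib ..
    ultimately show ?thesis by (simp only: mult_ac)
  qed
qed

lemma prod_insert:
  fixes f :: "nat \<Rightarrow> 'a::comm_monoid_mult"
  assumes "m \<le> r"
  shows "(\<Prod>i<Suc r. f i) = (\<Prod>i<m. f i) * f m * (\<Prod>i\<in>{m..<r}. f (Suc i))"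
  using assms by (induction r rule: dec_induct) (simp_all add: mult_ac)

text \<open>Variables left of the inserted \<open>X\<close> precede it in their pairs, those on its
  right follow it. This matches the two orders of arguments in
  \<open>entry_weight_sum\<close>.\<close>

lemma pair_prod_insert:
  fixes z :: "nat \<Rightarrow> 'b"
  assumes "m \<le> r" "\<And>i. i < m \<Longrightarrow> y i = z i" "y m = X" "\<And>i. m \<le> i \<Longrightarrow> i < r \<Longrightarrow> y (Suc i) = z i"
  shows "pair_prod P (Suc r) y = pair_prod P r z * (\<Prod>i<m. P (z i) X) * (\<Prod>i\<in>{m..<r}. P X (z i))"
proof -
  have "pair_prod P (Suc n) y = pair_prod P n z * (\<Prod>i<m. P (z i) X) * (\<Prod>i\<in>{m..<n}. P X (z i))"
    if "m \<le> n" "n \<le> r" for n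
    using that
  proof (induction n rule: dec_induct)
    case base
    have "pair_prod P m y = pair_prod P m z"
      by (rule pair_prod_cong) (use assms in auto)
    thus ?case using assms by (simp add: pair_prod_eq)
  next
    case (step n)
    have "(\<Prod>i<Suc n. P (y i) (y (Suc n)))
      = (\<Prod>i<m. P (y i) (y (Suc n))) * P (y m) (y (Suc n)) * (\<Prod>i\<in>{m..<n}. P (y (Suc i)) (y (Suc n)))"
      by (rule prod_insert) (use step in simp)
    also have "(\<Prod>i\<in>{m..<n}. P (y (Suc i)) (y (Suc n))) = (\<Prod>i\<in>{m..<n}. P (z i) (z n))"
      by (rule prod.cong) (use assms step in auto)
    also have "(\<Prod>i<m. P (y i) (y (Suc n))) = (\<Prod>i<m. P (z i) (z n))"
      by (rule prod.cong) (use assms step in auto)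
    finally have "(\<Prod>i<Suc n. P (y i) (y (Suc n)))
      = (\<Prod>i<m. P (z i) (z n)) * (\<Prod>i\<in>{m..<n}. P (z i) (z n)) * P X (z n)"
      using assms step by (simp add: mult_ac)
    also have "(\<Prod>i<m. P (z i) (z n)) * (\<Prod>i\<in>{m..<n}. P (z i) (z n)) = (\<Prod>i<n. P (z i) (z n))"
      using step.hyps prod.atLeastLessThan_concat[of 0 m n "\<lambda>i. P (z i) (z n)"]
      by (simp add: atLeast0LessThan)
    finally show ?case
      using step by (simp add: pair_prod_eq mult_ac)
  qed
  from this[of r] assms(1) show ?thesis by simp
qed

text \<open>The induction removes the bottom row together with its variable \<open>X\<close>. Once
  the collision weights are exchanged, the continuant splits into terms with \<open>phiL\<close>
  before a position \<open>m\<close> and \<open>phiR\<close> from \<open>m\<close> on; each is the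
  summand of the larger antisymmetrizer in which \<open>X\<close> stands at position
  \<open>m\<close>.\<close>

theorem triangle_sum_antisymmetrize:
  fixes u v w :: "'a::field"
  assumes "\<And>j. j < n \<Longrightarrow> x j \<noteq> 0" and "\<And>j. Suc j < n \<Longrightarrow> k j < k (Suc j)"
  shows "triangle_sum u v w x n k * pair_prod (\<lambda>s t. t - s) n x
    = antisymmetrize n (\<lambda>p. pair_prod (edge_weight u v w) n (x \<circ> p) * (\<Prod>i<n. x (p i) ^ k i))"
  using assms
proof (induction n arbitrary: k)
  case 0
  have "{p. p permutes {0..<0::nat}} = {id}" by auto
  thus ?case by (simp add: antisymmetrize_def pair_prod_eq)
next
  case (Suc r)
  define X where "X = x r"
  have X: "X \<noteq> 0" using Suc.prems(1)[of r] by (simp add: X_def)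
  define K where "K = (\<Sum>j\<le>r. k j)"
  let ?P = "edge_weight u v w"
  let ?PP = "\<lambda>p. pair_prod ?P r (x \<circ> p)"
  let ?E = "\<lambda>l. \<Prod>j<r. entry_weight u v w X (k j) (k (Suc j)) (l j) / X ^ l j"
  let ?Z = "\<lambda>p l. \<Prod>i<r. x (p i) ^ l i" and ?V = "\<Prod>i<r. X - x i"
  let ?T = "\<lambda>m p. (-1) ^ (m + r) * (pair_prod ?P (Suc r) (x \<circ> permutation_insert m r p)
    * (\<Prod>i<Suc r. x (permutation_insert m r p i) ^ k i))"
  define phiL where "phiL = (\<lambda>j z. ?P z X * (z / X) ^ k j)"
  define phiR where "phiR = (\<lambda>j z. - ?P X z * (z / X) ^ k (Suc j))"
  define a where "a = (\<lambda>j z. phiL j z + phiR j z)"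
  define c where "c = (\<lambda>j s t. phiR j s * phiL (Suc j) t)"
  define f where "f = (\<lambda>j z t. entry_weight u v w X (k j) (k (Suc j)) t / X ^ t * z ^ t * (X - z))"
  define c' where "c' = (\<lambda>j s t. f j s (k (Suc j)) * f (Suc j) t (k (Suc j)))"
  let ?S = "\<lambda>c p. continuant (\<lambda>j. a j ((x \<circ> p) j)) (\<lambda>j. c j ((x \<circ> p) j) ((x \<circ> p) (Suc j))) r"

  have strict: "l j < l (Suc j)" if "l \<in> interlacing k r" "Suc j < r" for l j
    using that by (auto simp: interlacing_def)
  have IH: "triangle_sum u v w x r l * pair_prod (\<lambda>s t. t - s) r x
      = antisymmetrize r (\<lambda>p. ?PP p * ?Z p l)" if "l \<in> interlacing k r" for l
    by (rule Suc.IH) (use Suc.prems(1) strict[OF that] in auto)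

  have "triangle_sum u v w x (Suc r) k * pair_prod (\<lambda>s t. t - s) (Suc r) x
    = (\<Sum>l\<in>interlacing k r. X ^ K * ?E l
         * ?V *  (triangle_sum u v w x r l * pair_prod (\<lambda>s t. t - s) r x))"
    by (simp add: pair_prod_eq sum_distrib_left sum_distrib_right X_def K_def mult_ac)
  also have "\<dots> = (\<Sum>l\<in>interlacing k r. antisymmetrize r (\<lambda>p. X ^ K * ?E l
         * ?V *  (?PP p * ?Z p l)))"
    by (rule sum.cong[OF refl]) (simp only: IH antisymmetrize_cmult)
  also have "\<dots> = antisymmetrize r (\<lambda>p. \<Sum>l\<in>interlacing k r. X ^ K * ?E l
         * ?V *  (?PP p * ?Z p l))"
    by (rule antisymmetrize_sum[symmetric])
  also have "\<dots> = antisymmetrize r (\<lambda>p. X ^ K * (?PP p * ?S c' p))"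
  proof (rule antisymmetrize_cong)
    fix p assume "p permutes {0..<r}"
    \<comment> \<open>The Vandermonde factors that involve \<open>X\<close> are symmetric in the
      other variables, so each position can absorb one of them into its \<open>f\<close>.\<close>
    hence "(\<Prod>i<r. X - x i) = (\<Prod>i<r. X - x (p i))"
      using prod.permute[of p "{0..<r}" "\<lambda>i. X - x i"] by (simp add: atLeast0LessThan o_def)
    hence "?E l
         * ?V *  (?PP p * ?Z p l) = ?PP p * (\<Prod>j<r. f j (x (p j)) (l j))" for l
      unfolding f_def prod.distrib by (simp only: mult_ac)
    hence "(\<Sum>l\<in>interlacing k r. X ^ K * ?E l
         * ?V *  (?PP p * ?Z p l))
      = X ^ K * (?PP p * (\<Sum>l\<in>interlacing k r. \<Prod>j<r. f j (x (p j)) (l j)))"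
      by (simp only: sum_distrib_left mult.assoc)
    also have "(\<Sum>l\<in>interlacing k r. \<Prod>j<r. f j (x (p j)) (l j))
      = continuant (\<lambda>j. \<Sum>t\<in>{k j..k (Suc j)}. f j (x (p j)) t)
         (\<lambda>j. f j (x (p j)) (k (Suc j)) * f (Suc j) (x (p (Suc j))) (k (Suc j))) r"
      by (rule interlacing_sum) (use Suc.prems in simp)
    also have "\<dots> = ?S c' p"
    proof (rule continuant_cong)
      fix j assume "j < r"
      hence "k j < k (Suc j)" using Suc.prems by simp
      thus "(\<Sum>t\<in>{k j..k (Suc j)}. f j (x (p j)) t) = a j ((x \<circ> p) j)"
        using entry_weight_sum[OF X, of "k j" "k (Suc j)" u v w "x (p j)"]
        by (simp add: f_def a_def phiL_def phiR_def)
    qed (simp add: c'_def)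
    finally show "(\<Sum>l\<in>interlacing k r. X ^ K * ?E l
         * ?V *  (?PP p * ?Z p l)) = X ^ K * (?PP p * ?S c' p)" .
  qed
  also have "\<dots> = antisymmetrize r (\<lambda>p. X ^ K * (?PP p * ?S c p))"
  proof -
    have "antisymmetrize r (\<lambda>p. ?PP p * (?S c p - ?S c' p) * (\<lambda>_. 1) (x \<circ> p)) = 0"
    proof (rule antisymmetrize_continuant)
      fix j s t assume j: "Suc j < r"
      have kj: "k j < k (Suc j)" "k (Suc j) < k (Suc (Suc j))" using Suc.prems(2) j by auto
      show "(c j s t - c' j s t) * ?P s t = (c j t s - c' j t s) * ?P t s"
        using edge_weight_exchange[OF X, of u v w s "k (Suc j)" t] kj
        by (simp add: c_def c'_def phiL_def phiR_def f_def entry_weight_def)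
    qed simp_all
    hence "antisymmetrize r (\<lambda>p. ?PP p * ?S c p) = antisymmetrize r (\<lambda>p. ?PP p * ?S c' p)"
      by (simp add: antisymmetrize_diff right_diff_distrib)
    thus ?thesis by (simp only: antisymmetrize_cmult)
  qed
  also have "\<dots> = antisymmetrize r (\<lambda>p. \<Sum>m\<le>r. ?T m p)"
  proof (rule antisymmetrize_cong)
    fix p assume p: "p permutes {0..<r}"
    have "X ^ K * (?PP p * ?S c p)
      = X ^ K * (?PP p * (\<Sum>m\<le>r. (\<Prod>j<m. phiL j (x (p j))) * (\<Prod>j\<in>{m..<r}. phiR j (x (p j)))))"
      by (simp add: sorted_choice_sum a_def c_def)
    also have "\<dots> = (\<Sum>m\<le>r. ?PP p * (X ^ K * ((\<Prod>j<m. phiL j (x (p j))) * (\<Prod>j\<in>{m..<r}. phiR j (x (p j))))))"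
      by (simp add: sum_distrib_left mult_ac)
    also have "\<dots> = (\<Sum>m\<le>r. ?T m p)"
    proof (rule sum.cong[OF refl])
      fix m assume "m \<in> {..r}"
      hence m: "m \<le> r" by simp
      let ?q = "permutation_insert m r p"
      have pr: "p i < r" if "i < r" for i
        using permutes_in_image[OF p, of i] that by simp
      have q1: "?q i = p i" if "i < m" for i
        using that m pr[of i] by (simp add: permutation_insert_expand)
      have q2: "?q (Suc i) = p i" if "m \<le> i" "i < r" for i
        using that m pr[of i] by (simp add: permutation_insert_expand)
      have e1: "pair_prod ?P (Suc r) (x \<circ> ?q)
        = ?PP p * (\<Prod>i<m. ?P ((x \<circ> p) i) X) * (\<Prod>i\<in>{m..<r}. ?P X ((x \<circ> p) i))"
        by (rule pair_prod_insert[OF m]) (use q1 q2 in \<open>auto simp: X_def\<close>)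
      have e2: "(\<Prod>i<Suc r. x (?q i) ^ k i)
        = (\<Prod>i<m. x (p i) ^ k i) * X ^ k m * (\<Prod>i\<in>{m..<r}. x (p i) ^ k (Suc i))"
        unfolding prod_insert[OF m] using q1 q2 by (simp add: X_def)
      \<comment> \<open>The denominators of \<open>phiL\<close> and \<open>phiR\<close> consume
        every exponent \<open>k i\<close> except \<open>k m\<close>, which remains for
        \<open>X\<close> at position \<open>m\<close>.\<close>
      have e3: "X ^ K = (\<Prod>i<m. X ^ k i) * X ^ k m * (\<Prod>i\<in>{m..<r}. X ^ k (Suc i))"
        using prod_insert[OF m, of "\<lambda>i. X ^ k i"] by (simp add: K_def power_sum lessThan_Suc_atMost)
      \<comment> \<open>The \<open>r - m\<close> signs of \<open>phiR\<close> make up the sign of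
        inserting the value \<open>r\<close> at position \<open>m\<close>.\<close>
      have e4: "(\<Prod>i\<in>{m..<r}. - ?P X (x (p i))) = (-1) ^ (m + r) * (\<Prod>i\<in>{m..<r}. ?P X (x (p i)))"
      proof -
        have "(\<Prod>i\<in>{m..<r}. - ?P X (x (p i))) = (-1) ^ (r - m) * (\<Prod>i\<in>{m..<r}. ?P X (x (p i)))"
          using prod.distrib[of "\<lambda>_. -1" "\<lambda>i. ?P X (x (p i))" "{m..<r}"] by simp
        moreover have "m + r = (r - m) + 2 * m" using m by simp
        hence "(-1 :: 'a) ^ (m + r) = (-1) ^ (r - m)" by (simp only: power_add power_mult) simp
        ultimately show ?thesis by simp
      qed
      have nz: "(\<Prod>i<m. X ^ k i) \<noteq> 0" "(\<Prod>i\<in>{m..<r}. X ^ k (Suc i)) \<noteq> 0"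
        using X by simp_all
      have e5: "q * (a * y * b * (pl * (zl / a) * (s * pr * (zr / b)))) = s * (q * pl * pr * (zl * y * zr))"
        if "a \<noteq> 0" "b \<noteq> 0" for q a y b pl zl s pr zr :: 'a
        using that by (simp add: field_simps)
      show "?PP p * (X ^ K * ((\<Prod>j<m. phiL j (x (p j))) * (\<Prod>j\<in>{m..<r}. phiR j (x (p j)))))
        = (-1) ^ (m + r) * (pair_prod ?P (Suc r) (x \<circ> ?q) * (\<Prod>i<Suc r. x (?q i) ^ k i))"
        unfolding phiL_def phiR_def prod.distrib power_divide prod_dividef e1 e2 e3 e4 o_apply
        by (rule e5[OF nz])
    qed
    finally show "X ^ K * (?PP p * ?S c p) = (\<Sum>m\<le>r. ?T m p)" .
  qed
  also have "\<dots> = antisymmetrize (Suc r) (\<lambda>p. pair_prod ?P (Suc r) (x \<circ> p) * (\<Prod>i<Suc r. x (p i) ^ k i))"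
    unfolding antisymmetrize_insert_position[OF le_refl] by (simp only: antisymmetrize_sum antisymmetrize_cmult)
  finally show ?case .
qed

section \<open>From antisymmetrizer to determinant\<close>

definition complete_hom :: "nat \<Rightarrow> 'a::comm_ring_1 \<Rightarrow> 'a \<Rightarrow> 'a" where
  "complete_hom k a b = (\<Sum>i\<le>k. a ^ i * b ^ (k - i))"

lemma complete_hom_0: "complete_hom 0 a b = 1"
  by (simp add: complete_hom_def)

lemma complete_hom_Suc: "complete_hom (Suc k) a b = a ^ Suc k + b * complete_hom k a b"
  by (simp add: complete_hom_def sum_distrib_left Suc_diff_le mult_ac)

lemma complete_hom_Suc': "complete_hom (Suc k) a b = b ^ Suc k + a * complete_hom k a b"
proof (induction k)
  case (Suc k)
  have "complete_hom (Suc (Suc k)) a b = a ^ Suc (Suc k) + b * (b ^ Suc k + a * complete_hom k a b)"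
    using Suc by (simp only: complete_hom_Suc[of "Suc k"])
  thus ?case by (simp add: complete_hom_Suc algebra_simps)
qed (simp add: complete_hom_Suc complete_hom_0)

text \<open>The polynomial \<open>[:-b, 1:] * q\<close> vanishes at \<open>b\<close>, so
  \<open>poly q a\<close> is its divided difference at \<open>a\<close> and \<open>b\<close>;
  \<open>complete_hom k a b\<close> is the divided difference of the power \<open>Suc k\<close>.
  Telescoping avoids a division by \<open>a - b\<close>.\<close>

lemma poly_eq_sum_complete_hom:
  assumes "degree q \<le> n"
  shows "poly q a = (\<Sum>k\<le>n. coeff ([:-b, 1:] * q) (Suc k) * complete_hom k a b)"
proof -
  have c: "coeff ([:-b, 1:] * q) (Suc k) = coeff q k - b * coeff q (Suc k)" for k
    by simp
  have "(\<Sum>k\<le>n. (coeff q k - b * coeff q (Suc k)) * complete_hom k a b)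
    = (\<Sum>k\<le>n. coeff q k * a ^ k) - b * coeff q (Suc n) * complete_hom n a b" for n
    by (induction n) (simp_all add: complete_hom_Suc complete_hom_0 algebra_simps)
  moreover have "coeff q (Suc n) = 0" using assms by (simp add: coeff_eq_0)
  moreover have "poly q a = (\<Sum>k\<le>n. coeff q k * a ^ k)"
    unfolding poly_altdef using assms
    by (intro sum.mono_neutral_left) (auto simp: coeff_eq_0)
  ultimately show ?thesis by (simp only: c) simp
qed

text \<open>Laplace expansion along the last row; \<open>insert_index j\<close> skips the column
  used there.\<close>

lemma alt_snoc:
  "alt (gs @ [L]) = (\<Sum>j\<le>length gs. (-1) ^ (length gs + j) * (L j * alt (map (\<lambda>g t. g (insert_index j t)) gs)))"
proof -
  let ?n = "length gs"
  have "alt (gs @ [L]) = antisymmetrize (Suc ?n) (\<lambda>p. (\<Prod>i<?n. (gs ! i) (p i)) * L (p ?n))"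
    using alt_middle[of gs L "[]"] by simp
  also have "\<dots> = (\<Sum>j\<le>?n. (-1) ^ (?n + j) *
      antisymmetrize ?n (\<lambda>p. L j * (\<Prod>i<?n. (gs ! i) (insert_index j (p i)))))"
    unfolding antisymmetrize_insert_value[OF le_refl]
  proof (rule sum.cong[OF refl])
    fix j
    have "antisymmetrize ?n (\<lambda>p. (\<Prod>i<?n. (gs ! i) (permutation_insert ?n j p i)) * L (permutation_insert ?n j p ?n))
      = antisymmetrize ?n (\<lambda>p. L j * (\<Prod>i<?n. (gs ! i) (insert_index j (p i))))"
      by (rule antisymmetrize_cong)
        (simp add: permutation_insert_def insert_dom_def insert_ran_def mult.commute)
    thus "(-1) ^ (?n + j) * antisymmetrize ?n (\<lambda>p. (\<Prod>i<?n. (gs ! i) (permutation_insert ?n j p i)) * L (permutation_insert ?n j p ?n))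
      = (-1) ^ (?n + j) * antisymmetrize ?n (\<lambda>p. L j * (\<Prod>i<?n. (gs ! i) (insert_index j (p i))))"
      by simp
  qed
  finally show ?thesis by (simp add: alt_def antisymmetrize_cmult)
qed

text \<open>When the last position is occupied by \<open>j\<close>, its factors do not depend on the order of the other
  indices. Their product \<open>\<Prod>i\<noteq>j. (f j - g i)\<close> is the value at \<open>f j\<close> of \<open>G / (X - g j)\<close>, where
  \<open>G = \<Prod>i. (X - g i)\<close>, hence a combination of the \<open>complete_hom k (f j) (g j)\<close> whose
  coefficients do not depend on \<open>j\<close>.\<close>

theorem antisymmetrize_pair_prod:
  fixes f g :: "nat \<Rightarrow> 'a::idom"
  shows "antisymmetrize n (pair_prod (\<lambda>s t. f t - g s) n)
    = alt (map (\<lambda>k t. complete_hom k (f t) (g t)) [0..<n])"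
proof (induction n arbitrary: f g)
  case 0
  show ?case by (simp add: alt_def antisymmetrize_def pair_prod_eq)
next
  case (Suc n)
  let ?H = "\<lambda>k t. complete_hom k (f t) (g t)"
  define L where "L = (\<lambda>j. \<Prod>i<n. f j - g (insert_index j i))"
  define G where "G = (\<Prod>i\<le>n. [:- g i, 1:])"
  have lead: "coeff G (Suc n) = 1"
    using lead_coeff_prod[of "\<lambda>i. [:- g i, 1:]" "{..n}"]
      degree_prod_eq_sum_degree[of "{..n}" "\<lambda>i. [:- g i, 1:]"]
    by (simp add: G_def)
  have L: "L j = (\<Sum>k\<le>n. coeff G (Suc k) * ?H k j)" if "j \<le> n" for j
  proof -
    define q where "q = (\<Prod>i<n. [:- g (insert_index j i), 1:])"
    have "insert_index j ` {..<n} = {..n} - {j}"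
    proof (intro equalityI subsetI)
      fix i assume "i \<in> {..n} - {j}"
      hence "i = insert_index j (delete_index j i)" "delete_index j i < n"
        using that by (auto simp: insert_index_def delete_index_def)
      thus "i \<in> insert_index j ` {..<n}" by blast
    qed (auto simp: insert_index_def split: if_splits)
    moreover have "inj_on (insert_index j) {..<n}"
      by (auto simp: inj_on_def insert_index_def split: if_splits)
    ultimately have "q = (\<Prod>i\<in>{..n} - {j}. [:- g i, 1:])"
      using prod.reindex[of "insert_index j" "{..<n}" "\<lambda>i. [:- g i, 1:]"] by (simp add: q_def)
    hence G: "G = [:- g j, 1:] * q"
      unfolding G_def using that by (simp only: prod.remove[of "{..n}" j] finite_atMost atMost_iff)
    have "degree q \<le> n"
      unfolding q_def by (subst degree_prod_eq_sum_degree) simp_all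
    from poly_eq_sum_complete_hom[OF this, of "f j" "g j"] show ?thesis
      by (simp only: L_def G q_def poly_prod) (simp add: poly_prod)
  qed
  have "antisymmetrize (Suc n) (pair_prod (\<lambda>s t. f t - g s) (Suc n))
    = (\<Sum>j\<le>n. (-1) ^ (n + j) * antisymmetrize n (\<lambda>p.
         pair_prod (\<lambda>s t. f t - g s) (Suc n) (permutation_insert n j p)))"
    by (rule antisymmetrize_insert_value) simp
  also have "\<dots> = (\<Sum>j\<le>n. (-1) ^ (n + j) * (L j * alt (map (\<lambda>k t. ?H k (insert_index j t)) [0..<n])))"
  proof (intro sum.cong refl arg_cong2[where f = "(*)"])
    fix j assume "j \<in> {..n}"
    have "antisymmetrize n (\<lambda>p. pair_prod (\<lambda>s t. f t - g s) (Suc n) (permutation_insert n j p))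
      = antisymmetrize n (\<lambda>p. L j *
          pair_prod (\<lambda>s t. f (insert_index j t) - g (insert_index j s)) n p)"
    proof (rule antisymmetrize_cong)
      fix p assume "p permutes {0..<n}"
      hence "L j = (\<Prod>i<n. f j - g (insert_index j (p i)))"
        unfolding L_def using prod.permute[of p "{0..<n}" "\<lambda>i. f j - g (insert_index j i)"]
        by (simp add: atLeast0LessThan o_def)
      thus "pair_prod (\<lambda>s t. f t - g s) (Suc n) (permutation_insert n j p)
        = L j * pair_prod (\<lambda>s t. f (insert_index j t) - g (insert_index j s)) n p"
        by (simp add: pair_prod_eq permutation_insert_def insert_dom_def insert_ran_def mult.commute)
    qed
    also have "\<dots> = L j * alt (map (\<lambda>k t. ?H k (insert_index j t)) [0..<n])"
      using Suc.IH[of "\<lambda>t. f (insert_index j t)" "\<lambda>t. g (insert_index j t)"]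
      by (simp add: antisymmetrize_cmult)
    finally show "antisymmetrize n (\<lambda>p. pair_prod (\<lambda>s t. f t - g s) (Suc n) (permutation_insert n j p))
      = L j * alt (map (\<lambda>k t. ?H k (insert_index j t)) [0..<n])" .
  qed
  also have "\<dots> = (\<Sum>j\<le>n. (-1) ^ (n + j) * ((\<Sum>k\<le>n. coeff G (Suc k) * ?H k j)
      * alt (map (\<lambda>k t. ?H k (insert_index j t)) [0..<n])))"
    by (rule sum.cong) (simp_all add: L)
  also have "\<dots> = alt (map ?H [0..<n] @ [\<lambda>j. \<Sum>k\<le>n. coeff G (Suc k) * ?H k j])"
    by (simp add: alt_snoc o_def)
  also have "\<dots> = (\<Sum>k\<le>n. coeff G (Suc k) * alt (map ?H [0..<n] @ [?H k]))"
    by (simp only: alt_sum alt_cmult)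
  \<comment> \<open>The terms with \<open>k < n\<close> repeat a row, and \<open>G\<close> is monic,
    so \<open>?H n\<close> enters with coefficient 1.\<close>
  also have "\<dots> = alt (map ?H [0..<n] @ [?H n])"
  proof -
    have "alt (map ?H [0..<n] @ [?H k]) = 0" if "k < n" for k
      by (rule alt_equal[of k _ n]) (use that in \<open>auto simp: nth_append\<close>)
    thus ?thesis by (simp add: lead lessThan_Suc_atMost[symmetric])
  qed
  finally show ?case by simp
qed

lemma alt_map_cong:
  assumes "\<And>j t. j \<in> set js \<Longrightarrow> t < length js \<Longrightarrow> f j t = g j t"
  shows "alt (map f js) = alt (map g js)"
  unfolding alt_def length_map
proof (intro antisymmetrize_cong prod.cong refl)
  fix p i assume "p permutes {0..<length js}" "i \<in> {..<length js}"
  thus "(map f js ! i) (p i) = (map g js ! i) (p i)"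
    using assms[of "js ! i" "p i"] permutes_in_image[of p "{0..<length js}" i] by simp
qed

lemma prod_list_sign: "(\<Prod>j\<leftarrow>rev [0..<n]. (-1) ^ j) = ((-1) ^ (n choose 2) :: 'a::comm_ring_1)"
  by (induction n) (simp_all add: numeral_2_eq_2 power_add)

lemma rev_upt_Suc: "rev [0..<Suc m] = map Suc (rev [0..<m]) @ [0]"
  by (simp add: upt_conv_Cons rev_map del: upt_Suc flip: map_Suc_upt)

text \<open>Each \<open>z i\<close> is extracted once for every one of the \<open>n - 1 - i\<close>
  later positions. Together with \<open>z i ^ i\<close> this makes the exponent \<open>n - 1\<close>
  for all variables, hence a symmetric factor.\<close>

lemma pair_prod_mult_powers:
  fixes z :: "nat \<Rightarrow> 'a::comm_ring_1"
  assumes "\<And>i j. i < n \<Longrightarrow> j < n \<Longrightarrow> P (z i) (z j) = z i * Q (z i) (z j)"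
  shows "pair_prod P n z * (\<Prod>i<n. z i ^ i) = (\<Prod>i<n. z i ^ (n - 1)) * pair_prod Q n z"
proof -
  have "m \<le> n \<Longrightarrow> pair_prod P m z * (\<Prod>i<m. z i ^ i) = (\<Prod>i<m. z i ^ (m - 1)) * pair_prod Q m z" for m
  proof (induction m)
    case (Suc m)
    have "(\<Prod>i<m. P (z i) (z m)) = (\<Prod>i<m. z i) * (\<Prod>i<m. Q (z i) (z m))"
      using Suc.prems by (simp add: assms prod.distrib)
    moreover have "(\<Prod>i<m. z i ^ m) = (\<Prod>i<m. z i ^ (m - 1)) * (\<Prod>i<m. z i)"
      by (cases m) (simp_all add: prod.distrib mult_ac)
    moreover have "A * (D * E) * (Z * y) = (X * D) * y * (B * E)" if "A * Z = X * B" for A B D E X Z y :: 'a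
    proof -
      have "A * (D * E) * (Z * y) = (A * Z) * (D * E * y)" by (simp only: mult_ac)
      thus ?thesis unfolding that by (simp only: mult_ac)
    qed
    ultimately show ?case
      using Suc by (simp add: pair_prod_eq)
  qed (simp add: pair_prod_eq)
  thus ?thesis by simp
qed

text \<open>With \<open>f = w + u * x\<close> and \<open>g = - v / x\<close> we have \<open>f * g = w * g - u * v\<close>, which turns the
  complete homogeneous polynomials in \<open>f\<close> and \<open>g\<close> into \<open>g ^ k + u * x * f ^ (k - 1)\<close>.\<close>

theorem antisymmetrize_edge_weight:
  fixes u v w :: "'a::field" and x :: "nat \<Rightarrow> 'a"
  assumes "\<And>t. t < Suc m \<Longrightarrow> x t \<noteq> 0"
  shows "antisymmetrize (Suc m) (\<lambda>p. pair_prod (edge_weight u v w) (Suc m) (x \<circ> p) * (\<Prod>i<Suc m. x (p i) ^ i))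
    = alt (map (\<lambda>b t. v ^ Suc b * x t ^ (m - Suc b) - (-1) ^ b * (u * x t ^ Suc m * (w + u * x t) ^ b)) (rev [0..<m])
        @ [\<lambda>t. x t ^ m])"
proof -
  define f where "f = (\<lambda>t. w + u * x t)"
  define g where "g = (\<lambda>t. - v / x t)"
  define h where "h = (\<lambda>k t. complete_hom k (f t) (g t))"
  \<comment> \<open>Row \<open>k\<close> becomes
    \<open>h k - w * h (k - 1) + u * v * h (k - 2)\<close>, terms of negative index being absent;
    the coefficients do not depend on \<open>t\<close>, so this is a row operation.\<close>
  define d where "d = (\<lambda>k t. h k t + (\<Sum>i<k. (if Suc i = k then - w else if Suc (Suc i) = k then u * v else 0) * h i t))"
  let ?n = "Suc m"
  have fg: "f t * g t = w * g t - u * v" if "t < ?n" for t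
    using assms[OF that] by (simp add: f_def g_def field_simps)
  have d0: "d 0 t = 1" for t by (simp add: d_def h_def complete_hom_0)
  have dS: "d (Suc k) t = g t ^ Suc k + u * x t * f t ^ k" if "t < ?n" for k t
  proof (cases k)
    case 0
    thus ?thesis by (simp add: d_def h_def complete_hom_0 complete_hom_Suc f_def)
  next
    case (Suc k')
    have "(\<Sum>i<Suc k. (if Suc i = Suc k then - w else if Suc (Suc i) = Suc k then u * v else 0) * h i t)
      = - w * h k t + u * v * h k' t"
      using Suc by simp
    hence "d (Suc k) t = h (Suc k) t - w * h k t + u * v * h k' t" by (simp add: d_def)
    also have "h (Suc k) t = g t ^ Suc k + f t * h k t"
      by (simp add: h_def complete_hom_Suc')
    also have "h k t = f t ^ k + g t * h k' t"
      unfolding h_def Suc by (rule complete_hom_Suc)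
    also have "g t ^ Suc k + f t * (f t ^ k + g t * h k' t) - w * (f t ^ k + g t * h k' t) + u * v * h k' t
      = g t ^ Suc k + (f t - w) * f t ^ k + (f t * g t - (w * g t - u * v)) * h k' t"
      by (simp add: algebra_simps)
    finally show ?thesis unfolding fg[OF that] by (simp add: f_def)
  qed
  have "antisymmetrize ?n (\<lambda>p. pair_prod (edge_weight u v w) ?n (x \<circ> p) * (\<Prod>i<?n. x (p i) ^ i))
    = antisymmetrize ?n (\<lambda>p. (\<Prod>i<?n. x i ^ m) * pair_prod (\<lambda>s t. f t - g s) ?n p)"
  proof (rule antisymmetrize_cong)
    fix p assume p: "p permutes {0..<?n}"
    have pn: "p i < ?n" if "i < ?n" for i
      using permutes_in_image[OF p, of i] that by simp
    have "pair_prod (edge_weight u v w) ?n (x \<circ> p) * (\<Prod>i<?n. (x \<circ> p) i ^ i)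
      = (\<Prod>i<?n. (x \<circ> p) i ^ (?n - 1)) * pair_prod (\<lambda>a b. w + u * b - (- v / a)) ?n (x \<circ> p)"
      by (rule pair_prod_mult_powers) (use assms pn in \<open>simp add: edge_weight_def field_simps\<close>)
    also have "pair_prod (\<lambda>a b. w + u * b - (- v / a)) ?n (x \<circ> p) = pair_prod (\<lambda>s t. f t - g s) ?n p"
      by (simp add: pair_prod_def f_def g_def)
    also have "(\<Prod>i<?n. (x \<circ> p) i ^ (?n - 1)) = (\<Prod>i<?n. x i ^ m)"
      using prod.permute[OF p, of "\<lambda>i. x i ^ m"] by (simp add: atLeast0LessThan o_def del: prod.lessThan_Suc)
    finally show "pair_prod (edge_weight u v w) ?n (x \<circ> p) * (\<Prod>i<?n. x (p i) ^ i)
      = (\<Prod>i<?n. x i ^ m) * pair_prod (\<lambda>s t. f t - g s) ?n p" by (simp only: comp_def)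
  qed
  also have "\<dots> = (\<Prod>i<?n. x i ^ m) * alt (map h [0..<?n])"
    by (simp only: antisymmetrize_cmult h_def antisymmetrize_pair_prod[of ?n f g])
  also have "alt (map h [0..<?n]) = alt (map d [0..<?n])"
    by (rule sym, rule alt_unitriangular) (auto simp: d_def)
  also have "(\<Prod>i<?n. x i ^ m) * \<dots> = alt (map (\<lambda>k t. x t ^ m * d k t) [0..<?n])"
    using alt_cmult_all[of "\<lambda>t. x t ^ m" "map d [0..<?n]"] by (simp add: o_def del: prod.lessThan_Suc upt_Suc)
  also have "\<dots> = (-1) ^ (?n choose 2) * alt (map (\<lambda>k t. x t ^ m * d k t) (rev [0..<?n]))"
    using alt_rev[of "map (\<lambda>k t. x t ^ m * d k t) (rev [0..<?n])"] by (simp add: rev_map del: upt_Suc)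
  \<comment> \<open>The sign of reversing the rows is spread over them as \<open>(-1) ^ k\<close>,
    which turns \<open>(- v / x t) ^ k\<close> into \<open>(v / x t) ^ k\<close>.\<close>
  also have "\<dots> = alt (map (\<lambda>k t. (-1) ^ k * (x t ^ m * d k t)) (rev [0..<?n]))"
    by (rule sym[OF alt_segment_cmult[of "[]" "\<lambda>k. (-1) ^ k" "\<lambda>k t. x t ^ m * d k t" "rev [0..<?n]" "[]",
          unfolded append_Nil append_Nil2 prod_list_sign]])
  also have "\<dots> = alt (map (\<lambda>k t. case k of 0 \<Rightarrow> x t ^ m | Suc b \<Rightarrow>
      v ^ Suc b * x t ^ (m - Suc b) - (-1) ^ b * (u * x t ^ Suc m * (w + u * x t) ^ b)) (rev [0..<?n]))"
  proof (rule alt_map_cong)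
    fix k t assume "k \<in> set (rev [0..<?n])" "t < length (rev [0..<?n])"
    hence k: "k \<le> m" and t: "t < ?n" by auto
    show "(-1) ^ k * (x t ^ m * d k t) = (case k of 0 \<Rightarrow> x t ^ m | Suc b \<Rightarrow>
      v ^ Suc b * x t ^ (m - Suc b) - (-1) ^ b * (u * x t ^ Suc m * (w + u * x t) ^ b))"
    proof (cases k)
      case (Suc b)
      have "x t ^ m = x t ^ (m - Suc b) * x t ^ Suc b" using k Suc by (metis le_add_diff_inverse2 power_add)
      hence "(-1) ^ k * (x t ^ m * g t ^ Suc b) = x t ^ (m - Suc b) * ((-1) * x t * g t) ^ Suc b"
        by (simp only: Suc power_mult_distrib mult_ac)
      also have "(-1) * x t * g t = v" using assms[OF t] by (simp add: g_def)
      finally have "(-1) ^ k * (x t ^ m * g t ^ Suc b) = v ^ Suc b * x t ^ (m - Suc b)"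
        by (simp only: mult.commute)
      thus ?thesis using Suc by (simp add: dS[OF t] f_def distrib_left mult_ac)
    qed (simp add: d0)
  qed
  also note rev_upt_Suc
  finally show ?thesis by (simp add: o_def)
qed

section \<open>Arrays of strict partitions\<close>

definition strict_parts :: "(nat \<Rightarrow> nat) \<Rightarrow> bool" where
  "strict_parts s \<longleftrightarrow> (\<forall>c. s (Suc c) < s c \<or> s (Suc c) = 0)"

definition num_parts :: "(nat \<Rightarrow> nat) \<Rightarrow> nat" where
  "num_parts s = (LEAST c. s c = 0)"

text \<open>Strict partitions obtained from \<open>s'\<close> by adding a vertical strip.\<close>

definition lifts :: "(nat \<Rightarrow> nat) \<Rightarrow> (nat \<Rightarrow> nat) set" where
  "lifts s' = {s. strict_parts s \<and> (\<forall>c. s' c \<le> s c \<and> s c \<le> Suc (s' c))}"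

text \<open>For a totally symmetric plane partition, \<open>\<alpha> t c\<close> will be the number of cells
  \<open>(j + t, j, c + 1)\<close> with \<open>j > c\<close>. The Frobenius coordinates of its diagonal are then
  \<open>\<alpha> 0 c - 1\<close> and \<open>heights \<alpha> c - 1\<close>; note that \<open>c\<close> is counted from 0.\<close>

definition slice_arrays :: "nat \<Rightarrow> (nat \<Rightarrow> nat \<Rightarrow> nat) set" where
  "slice_arrays m = {\<alpha>. (\<forall>t. \<alpha> t \<in> lifts (\<alpha> (Suc t))) \<and> (\<forall>t\<ge>m. \<alpha> t = (\<lambda>_. 0))}"

definition heights :: "(nat \<Rightarrow> nat \<Rightarrow> nat) \<Rightarrow> nat \<Rightarrow> nat" where
  "heights \<alpha> c = card {t. 0 < \<alpha> t c}"

text \<open>In Frobenius coordinates a part contributes \<open>w ^ (b - a) * u ^ a\<close>. The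
  factor \<open>u\<close> that is missing from \<open>u ^ (a + 1)\<close> is later supplied by the
  functions \<open>e\<close> of the alternant.\<close>

definition slice_weight :: "'a::comm_ring_1 \<Rightarrow> 'a \<Rightarrow> (nat \<Rightarrow> nat \<Rightarrow> nat) \<Rightarrow> 'a" where
  "slice_weight u w \<alpha> = (\<Prod>c<num_parts (\<alpha> 0). w ^ (heights \<alpha> c - \<alpha> 0 c) * u ^ (\<alpha> 0 c - 1))"

text \<open>These leg lengths index the functions \<open>Q\<close> that survive in the expanded
  alternant, in the order of \<open>rev [0..<m]\<close>.\<close>

definition free_legs :: "nat \<Rightarrow> (nat \<Rightarrow> nat \<Rightarrow> nat) \<Rightarrow> nat list" where
  "free_legs m \<alpha> = filter (\<lambda>b. b \<notin> (\<lambda>c. heights \<alpha> c - 1) ` {..<num_parts (\<alpha> 0)}) (rev [0..<m])"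

lemma strict_parts_le: "strict_parts s \<Longrightarrow> s c \<le> s 0 - c"
proof (induction c)
  case (Suc c)
  hence "s (Suc c) < s c \<or> s (Suc c) = 0" by (simp add: strict_parts_def)
  thus ?case using Suc by auto
qed simp

lemma num_parts_iff:
  assumes "strict_parts s"
  shows "c < num_parts s \<longleftrightarrow> 0 < s c"
proof
  assume "c < num_parts s"
  thus "0 < s c" unfolding num_parts_def using not_less_Least by blast
next
  assume c: "0 < s c"
  have "s (s 0) = 0" using strict_parts_le[OF assms, of "s 0"] by simp
  hence z: "s (num_parts s) = 0" unfolding num_parts_def by (rule LeastI)
  have "num_parts s \<le> d \<Longrightarrow> s d = 0" for d
  proof (induction d rule: dec_induct)
    case (step d)
    moreover have "s (Suc d) < s d \<or> s (Suc d) = 0" using assms by (simp add: strict_parts_def)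
    ultimately show ?case by simp
  qed (rule z)
  thus "c < num_parts s" using c by (metis not_less less_irrefl)
qed

text \<open>Beyond the existing parts only place \<open>num_parts s'\<close> can become positive: it
  reaches at most 1, so strictness forces 0 afterwards. A lift is therefore a finite set
  \<open>E\<close> of incremented places.\<close>

lemma lifts_eq:
  assumes "strict_parts s'"
  shows "lifts s' = (\<lambda>E c. s' c + (if c \<in> E then 1 else 0)) `
    {E \<in> Pow {..num_parts s'}. strict_parts (\<lambda>c. s' c + (if c \<in> E then 1 else 0))}"
proof (intro equalityI subsetI)
  fix s assume s: "s \<in> lifts s'"
  let ?l = "num_parts s'"
  let ?E = "{c. s c \<noteq> s' c}"
  have sE: "s = (\<lambda>c. s' c + (if c \<in> ?E then 1 else 0))"
  proof
    fix c
    have "s' c \<le> s c" "s c \<le> Suc (s' c)" using s by (auto simp: lifts_def)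
    thus "s c = s' c + (if c \<in> ?E then 1 else 0)" by auto
  qed
  have "s' ?l = 0" using num_parts_iff[OF assms, of ?l] by simp
  moreover have "s ?l \<le> Suc (s' ?l)" using s by (auto simp: lifts_def)
  ultimately have l1: "s ?l \<le> 1" by simp
  have st: "s (Suc c) < s c \<or> s (Suc c) = 0" for c
    using s by (auto simp: lifts_def strict_parts_def)
  have "Suc ?l \<le> d \<Longrightarrow> s d = 0" for d
  proof (induction d rule: dec_induct)
    case base
    show ?case using st[of ?l] l1 by auto
  next
    case (step d)
    thus ?case using st[of d] by auto
  qed
  moreover have "s' d = 0" if "Suc ?l \<le> d" for d
    using num_parts_iff[OF assms, of d] that by simp
  ultimately have eq: "s d = s' d" if "Suc ?l \<le> d" for d
    using that by simp
  have "?E \<subseteq> {..?l}"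
  proof
    fix d assume "d \<in> ?E"
    thus "d \<in> {..?l}" using eq[of d] by (cases "Suc ?l \<le> d") auto
  qed
  thus "s \<in> (\<lambda>E c. s' c + (if c \<in> E then 1 else 0)) `
    {E \<in> Pow {..num_parts s'}. strict_parts (\<lambda>c. s' c + (if c \<in> E then 1 else 0))}"
    using sE s by (intro image_eqI[of _ _ ?E]) (auto simp: lifts_def)
qed (auto simp: lifts_def)

lemma finite_lifts: "strict_parts s' \<Longrightarrow> finite (lifts s')"
  by (simp add: lifts_eq)

lemma sum_lifts:
  assumes "strict_parts s'"
  shows "(\<Sum>s\<in>lifts s'. G s) = (\<Sum>E | E \<subseteq> {..num_parts s'} \<and> strict_parts (\<lambda>c. s' c + (if c \<in> E then 1 else 0)).
     G (\<lambda>c. s' c + (if c \<in> E then 1 else 0)))"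
  unfolding lifts_eq[OF assms]
  by (subst sum.reindex) (auto simp: inj_on_def fun_eq_iff split: if_splits)

lemma slice_arrays_strict: "\<alpha> \<in> slice_arrays m \<Longrightarrow> strict_parts (\<alpha> t)"
  by (auto simp: slice_arrays_def lifts_def)

lemma slice_arrays_0: "slice_arrays 0 = {\<lambda>_ _. 0}"
  by (auto simp: slice_arrays_def lifts_def strict_parts_def)

text \<open>The new layer becomes layer 0 and the others move one step away from the diagonal:
  arrays grow from the outermost layer inwards.\<close>

lemma slice_arrays_Suc:
  "slice_arrays (Suc m) = (\<lambda>(\<alpha>, s). case_nat s \<alpha>) ` (SIGMA \<alpha>:slice_arrays m. lifts (\<alpha> 0))"
proof (intro equalityI subsetI)
  fix \<beta> assume b: "\<beta> \<in> slice_arrays (Suc m)"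
  have "(\<lambda>t. \<beta> (Suc t), \<beta> 0) \<in> (SIGMA \<alpha>:slice_arrays m. lifts (\<alpha> 0))"
    using b by (auto simp: slice_arrays_def)
  moreover have "\<beta> = case_nat (\<beta> 0) (\<lambda>t. \<beta> (Suc t))" by (auto simp: fun_eq_iff split: nat.split)
  ultimately show "\<beta> \<in> (\<lambda>(\<alpha>, s). case_nat s \<alpha>) ` (SIGMA \<alpha>:slice_arrays m. lifts (\<alpha> 0))"
    by (intro image_eqI[of _ _ "(\<lambda>t. \<beta> (Suc t), \<beta> 0)"]) auto
next
  fix \<beta> assume "\<beta> \<in> (\<lambda>(\<alpha>, s). case_nat s \<alpha>) ` (SIGMA \<alpha>:slice_arrays m. lifts (\<alpha> 0))"
  then obtain \<alpha> s where *: "\<beta> = case_nat s \<alpha>" "\<alpha> \<in> slice_arrays m" "s \<in> lifts (\<alpha> 0)" by auto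
  show "\<beta> \<in> slice_arrays (Suc m)"
    using *(2,3) by (auto simp: *(1) slice_arrays_def split: nat.split)
qed

lemma finite_slice_arrays: "finite (slice_arrays m)"
  by (induction m) (auto simp: slice_arrays_0 slice_arrays_Suc intro!: finite_lifts slice_arrays_strict)

lemma sum_slice_arrays_Suc:
  "(\<Sum>\<beta>\<in>slice_arrays (Suc m). G \<beta>) = (\<Sum>\<alpha>\<in>slice_arrays m. \<Sum>s\<in>lifts (\<alpha> 0). G (case_nat s \<alpha>))"
proof -
  have "inj_on (\<lambda>(\<alpha>, s). case_nat s \<alpha>) (SIGMA \<alpha>:slice_arrays m. lifts (\<alpha> 0))"
  proof (rule inj_onI, clarify)
    fix \<alpha> \<alpha>' :: "nat \<Rightarrow> nat \<Rightarrow> nat" and s s' assume eq: "case_nat s \<alpha> = case_nat s' \<alpha>'"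
    have "s = s'" using fun_cong[OF eq, of 0] by simp
    moreover have "\<alpha> = \<alpha>'" using fun_cong[OF eq, of "Suc t" for t] by auto
    ultimately show "\<alpha> = \<alpha>' \<and> s = s'" by simp
  qed
  hence "(\<Sum>\<beta>\<in>slice_arrays (Suc m). G \<beta>) = (\<Sum>(\<alpha>, s)\<in>(SIGMA \<alpha>:slice_arrays m. lifts (\<alpha> 0)). G (case_nat s \<alpha>))"
    unfolding slice_arrays_Suc by (subst sum.reindex) (auto intro: sum.cong)
  also have "\<dots> = (\<Sum>\<alpha>\<in>slice_arrays m. \<Sum>s\<in>lifts (\<alpha> 0). G (case_nat s \<alpha>))"
    by (rule sum.Sigma[symmetric]) (auto intro: finite_slice_arrays finite_lifts slice_arrays_strict)
  finally show ?thesis .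
qed

lemma slice_arrays_decreasing:
  assumes "\<alpha> \<in> slice_arrays m"
  shows "\<alpha> (t + d) c \<le> \<alpha> t c" "\<alpha> t c \<le> \<alpha> (t + d) c + d"
proof -
  have step: "\<alpha> (Suc t) c \<le> \<alpha> t c" "\<alpha> t c \<le> Suc (\<alpha> (Suc t) c)" for t
    using assms by (auto simp: slice_arrays_def lifts_def)
  show "\<alpha> (t + d) c \<le> \<alpha> t c"
    by (induction d) (auto intro: le_trans step)
  show "\<alpha> t c \<le> \<alpha> (t + d) c + d"
  proof (induction d)
    case (Suc d)
    thus ?case using step(2)[of "t + d"] by simp
  qed simp
qed

lemma slice_arrays_positive:
  assumes "\<alpha> \<in> slice_arrays m"
  shows "0 < \<alpha> t c \<longleftrightarrow> t < heights \<alpha> c"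
proof -
  have sub: "{t. 0 < \<alpha> t c} \<subseteq> {..<m}"
    using assms by (auto simp: slice_arrays_def) (metis gr_implies_not0 not_less)
  have down: "0 < \<alpha> t c \<Longrightarrow> t' \<le> t \<Longrightarrow> 0 < \<alpha> t' c" for t t'
    using slice_arrays_decreasing(1)[OF assms, of t' "t - t'" c] by auto
  define N where "N = (LEAST t. \<not> 0 < \<alpha> t c)"
  have "\<alpha> m c = 0" using assms by (simp add: slice_arrays_def)
  hence N: "\<not> 0 < \<alpha> N c" unfolding N_def by (metis LeastI less_irrefl)
  have "0 < \<alpha> t c \<longleftrightarrow> t < N" for t
  proof
    assume "0 < \<alpha> t c"
    with N down[of t N] show "t < N" by (metis not_less)
  next
    assume "t < N"
    thus "0 < \<alpha> t c" unfolding N_def using not_less_Least by blast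
  qed
  moreover from this have "heights \<alpha> c = N" by (simp add: heights_def)
  ultimately show ?thesis by simp
qed

text \<open>For fixed \<open>c\<close> the entries drop by at most 1 per layer, and they are 0 at
  layer \<open>heights \<alpha> c\<close>. Thus no arm exceeds its leg, and the exponents of
  \<open>w\<close> do not truncate.\<close>

lemma slice_arrays_le_heights:
  assumes "\<alpha> \<in> slice_arrays m"
  shows "\<alpha> 0 c \<le> heights \<alpha> c"
  using slice_arrays_decreasing(2)[OF assms, of 0 c "heights \<alpha> c"]
    slice_arrays_positive[OF assms, of "heights \<alpha> c" c] by simp

lemma heights_pos_iff:
  assumes "\<alpha> \<in> slice_arrays m"
  shows "0 < heights \<alpha> c \<longleftrightarrow> c < num_parts (\<alpha> 0)"
  using slice_arrays_positive[OF assms, of 0 c] num_parts_iff[OF slice_arrays_strict[OF assms], of c 0] by simp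

lemma heights_case_nat:
  assumes "\<alpha> \<in> slice_arrays m" "s \<in> lifts (\<alpha> 0)"
  shows "heights (case_nat s \<alpha>) c = (if 0 < s c then Suc (heights \<alpha> c) else 0)"
proof (cases "0 < s c")
  case True
  have "{t. 0 < case_nat s \<alpha> t c} = insert 0 (Suc ` {t. 0 < \<alpha> t c})"
    unfolding set_eq_iff
  proof
    fix t
    show "t \<in> {t. 0 < case_nat s \<alpha> t c} \<longleftrightarrow> t \<in> insert 0 (Suc ` {t. 0 < \<alpha> t c})"
      using True by (cases t) auto
  qed
  moreover have "{t. 0 < \<alpha> t c} = {..<heights \<alpha> c}"
    using slice_arrays_positive[OF assms(1)] by auto
  ultimately have "heights (case_nat s \<alpha>) c = card (insert 0 (Suc ` {..<heights \<alpha> c}))"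
    unfolding heights_def[of "case_nat s \<alpha>"] by simp
  thus ?thesis using True by (simp add: card_image)
next
  case False
  have "case_nat s \<alpha> \<in> slice_arrays (Suc m)" using assms by (auto simp: slice_arrays_Suc)
  from slice_arrays_positive[OF this, of 0 c] False show ?thesis by simp
qed

lemma num_parts_lifts:
  assumes "strict_parts s'" "s \<in> lifts s'"
  shows "num_parts s = (if s (num_parts s') = 0 then num_parts s' else Suc (num_parts s'))"
proof -
  let ?l = "num_parts s'"
  have s: "strict_parts s" using assms by (simp add: lifts_def)
  have b: "s' c \<le> s c" "s c \<le> Suc (s' c)" for c using assms by (auto simp: lifts_def)
  have "0 < s c" if "c < ?l" for c
    using b(1)[of c] that num_parts_iff[OF assms(1), of c] by simp
  hence 1: "c < num_parts s" if "c < ?l" for c using that num_parts_iff[OF s] by blast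
  have "s' ?l = 0" using num_parts_iff[OF assms(1), of ?l] by simp
  have "s (Suc ?l) = 0"
  proof -
    have "s ?l \<le> 1" using \<open>s' ?l = 0\<close> b(2)[of ?l] by simp
    moreover have "s (Suc ?l) < s ?l \<or> s (Suc ?l) = 0" using s by (simp add: strict_parts_def)
    ultimately show ?thesis by linarith
  qed
  hence 2: "num_parts s \<le> Suc ?l" using num_parts_iff[OF s, of "Suc ?l"] by simp
  have 3: "?l \<le> num_parts s" using 1[of "num_parts s"] by (metis less_irrefl not_less)
  have 4: "?l < num_parts s \<longleftrightarrow> s ?l \<noteq> 0" using num_parts_iff[OF s, of ?l] by simp
  show ?thesis using 2 3 4 by auto
qed

text \<open>A new layer lengthens every existing leg by 1, so the free lengths shift as well. A part
  created now has leg 0, and 0 stays free exactly if none is created.\<close>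

lemma free_legs_case_nat:
  assumes "\<alpha> \<in> slice_arrays m" "s \<in> lifts (\<alpha> 0)"
  shows "free_legs (Suc m) (case_nat s \<alpha>)
    = map Suc (free_legs m \<alpha>) @ (if s (num_parts (\<alpha> 0)) = 0 then [0] else [])"
proof -
  let ?l = "num_parts (\<alpha> 0)"
  let ?B = "(\<lambda>c. heights \<alpha> c - 1) ` {..<?l}"
  let ?B' = "(\<lambda>c. heights (case_nat s \<alpha>) c - 1) ` {..<num_parts s}"
  note st = slice_arrays_strict[OF assms(1), of 0]
  have np: "num_parts s = (if s ?l = 0 then ?l else Suc ?l)" by (rule num_parts_lifts[OF st assms(2)])
  have pos: "0 < s c" if "c < ?l" for c
  proof -
    have "\<alpha> 0 c \<le> s c" using assms(2) by (simp add: lifts_def)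
    thus ?thesis using num_parts_iff[OF st, of c] that by simp
  qed
  have h: "heights (case_nat s \<alpha>) c - 1 = Suc (heights \<alpha> c - 1)" if "c < ?l" for c
    using pos[OF that] heights_pos_iff[OF assms(1), of c] that by (simp add: heights_case_nat[OF assms])
  hence "(\<lambda>c. heights (case_nat s \<alpha>) c - 1) ` {..<?l} = (\<lambda>c. Suc (heights \<alpha> c - 1)) ` {..<?l}"
    by (intro image_cong) auto
  moreover have "heights (case_nat s \<alpha>) ?l - 1 = 0"
    using heights_pos_iff[OF assms(1), of ?l] by (simp add: heights_case_nat[OF assms])
  ultimately have B': "?B' = Suc ` ?B \<union> (if s ?l = 0 then {} else {0})"
    unfolding np by (auto simp: lessThan_Suc image_image)
  define C where "C = ?B'"
  define D where "D = ?B"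
  have mem: "Suc b \<in> C \<longleftrightarrow> b \<in> D" "0 \<in> C \<longleftrightarrow> s ?l \<noteq> 0" for b
    unfolding C_def D_def B' by auto
  show ?thesis
    unfolding free_legs_def rev_upt_Suc nat.case C_def[symmetric] D_def[symmetric]
    by (simp add: filter_map o_def mem)
qed

text \<open>The leg of an old part grows by 1. If its arm stays, this costs a factor
  \<open>w\<close>; if the arm grows too, a factor \<open>u\<close>. A newly created part has arm
  and leg 0 and contributes 1.\<close>

lemma slice_weight_case_nat:
  assumes "\<alpha> \<in> slice_arrays m" "s \<in> lifts (\<alpha> 0)"
  shows "slice_weight u w (case_nat s \<alpha>)
    = slice_weight u w \<alpha> * (\<Prod>c<num_parts (\<alpha> 0). if s c = \<alpha> 0 c then w else u)"
proof -
  let ?l = "num_parts (\<alpha> 0)"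
  let ?f = "\<lambda>c. w ^ (heights (case_nat s \<alpha>) c - s c) * u ^ (s c - 1)"
  note st = slice_arrays_strict[OF assms(1), of 0]
  have b: "\<alpha> 0 c \<le> s c" "s c \<le> Suc (\<alpha> 0 c)" for c using assms by (auto simp: lifts_def)
  have z: "\<alpha> 0 ?l = 0" using num_parts_iff[OF st, of ?l] by simp
  have "?f ?l = 1" if "s ?l \<noteq> 0"
    using that b(2)[of ?l] heights_pos_iff[OF assms(1), of ?l] z
    by (simp add: heights_case_nat[OF assms])
  hence "slice_weight u w (case_nat s \<alpha>) = (\<Prod>c<?l. ?f c)"
    by (auto simp: slice_weight_def num_parts_lifts[OF st assms(2)])
  also have "\<dots> = (\<Prod>c<?l. w ^ (heights \<alpha> c - \<alpha> 0 c) * u ^ (\<alpha> 0 c - 1) * (if s c = \<alpha> 0 c then w else u))"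
  proof (rule prod.cong[OF refl])
    fix c assume "c \<in> {..<?l}"
    hence a: "0 < \<alpha> 0 c" using num_parts_iff[OF st, of c] by simp
    hence h: "heights (case_nat s \<alpha>) c = Suc (heights \<alpha> c)"
      using b(1)[of c] by (simp add: heights_case_nat[OF assms])
    note le = slice_arrays_le_heights[OF assms(1), of c]
    consider "s c = \<alpha> 0 c" | "s c = Suc (\<alpha> 0 c)" using b[of c] by linarith
    thus "?f c = w ^ (heights \<alpha> c - \<alpha> 0 c) * u ^ (\<alpha> 0 c - 1) * (if s c = \<alpha> 0 c then w else u)"
    proof cases
      case 1
      thus ?thesis using h le by (simp add: Suc_diff_le mult_ac)
    next
      case 2
      have "u ^ \<alpha> 0 c = u ^ (\<alpha> 0 c - 1) * u" using a by (metis Suc_diff_1 power_Suc2)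
      thus ?thesis using h 2 by (simp add: mult_ac)
    qed
  qed
  finally show ?thesis by (simp add: slice_weight_def prod.distrib)
qed

section \<open>Expansion of an alternant\<close>

text \<open>The column of the smallest index is moved in front of the columns \<open>e\<close>, which absorbs the sign
  of the substitution \<open>e a \<mapsto> - (w e a + u e (a + 1))\<close>; the summands with two equal columns vanish.\<close>

theorem alt_expand_slice_arrays:
  fixes u w :: "'a::comm_ring_1"
  shows "alt (map (\<lambda>b t. Q b t + (-1) ^ b * (\<Sum>a\<le>b. of_nat (b choose a) * w ^ (b - a) * u ^ a * e a t)) (rev [0..<m]) @ ys)
    = (\<Sum>\<alpha>\<in>slice_arrays m. slice_weight u w \<alpha> *
         alt (map Q (free_legs m \<alpha>) @ map (\<lambda>c. e (\<alpha> 0 c - 1)) (rev [0..<num_parts (\<alpha> 0)]) @ ys))"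
proof (induction m arbitrary: Q e ys)
  case 0
  have "num_parts (\<lambda>_. 0) = 0" by (simp add: num_parts_def)
  thus ?case by (simp add: slice_arrays_0 slice_weight_def free_legs_def)
next
  case (Suc m)
  define F where "F = (\<lambda>e b (t::nat). \<Sum>a\<le>b. of_nat (b choose a) * w ^ (b - a) * u ^ a * (e a t :: 'a))"
  \<comment> \<open>The sign is chosen so that \<open>(-1) ^ Suc b * F e (Suc b)\<close> becomes
    \<open>(-1) ^ b * F e' b\<close>, the form of the induction hypothesis.\<close>
  define e' where "e' = (\<lambda>a t. (-1) * (w * e a t + u * e (Suc a) t))"
  have pascal: "F e (Suc b) t = - F e' b t" for b t
  proof -
    have "F e (Suc b) t = w ^ Suc b * e 0 t
        + (\<Sum>a\<le>b. of_nat (Suc b choose Suc a) * w ^ (b - a) * u ^ Suc a * e (Suc a) t)"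
      unfolding F_def by (subst sum.atMost_Suc_shift) simp
    also have "\<dots> = (w ^ Suc b * e 0 t + (\<Sum>a\<le>b. of_nat (b choose Suc a) * w ^ (b - a) * u ^ Suc a * e (Suc a) t))
        + (\<Sum>a\<le>b. of_nat (b choose a) * w ^ (b - a) * u ^ Suc a * e (Suc a) t)"
      by (simp add: sum.distrib[symmetric] algebra_simps)
    also have "w ^ Suc b * e 0 t + (\<Sum>a\<le>b. of_nat (b choose Suc a) * w ^ (b - a) * u ^ Suc a * e (Suc a) t)
        = (\<Sum>a\<le>Suc b. of_nat (b choose a) * w ^ (Suc b - a) * u ^ a * e a t)"
      by (subst sum.atMost_Suc_shift) simp
    also have "\<dots> = (\<Sum>a\<le>b. of_nat (b choose a) * w ^ (b - a) * u ^ a * (w * e a t))"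
      by (simp add: Suc_diff_le binomial_eq_0 mult_ac)
    finally show ?thesis
      by (simp add: F_def e'_def sum.distrib[symmetric] sum_negf[symmetric] algebra_simps)
  qed
  \<comment> \<open>Uniform names for what a layer can pick: a part of size \<open>k\<close> stands
    for \<open>V k\<close>, and an absent part, of size 0, for \<open>Q 0\<close>.\<close>
  define V where "V = (\<lambda>k. case k of 0 \<Rightarrow> Q 0 | Suc a \<Rightarrow> e a)"
  let ?A = "\<lambda>\<alpha> s. alt (map Q (free_legs (Suc m) (case_nat s \<alpha>)) @ map (\<lambda>c. e (s c - 1)) (rev [0..<num_parts s]) @ ys)"
  let ?g = "\<lambda>t. Q 0 t + e 0 t"
  have "alt (map (\<lambda>b t. Q b t + (-1) ^ b * F e b t) (rev [0..<Suc m]) @ ys)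
    = alt (map (\<lambda>b t. Q (Suc b) t + (-1) ^ b * F e' b t) (rev [0..<m]) @ ?g # ys)"
  proof -
    have "F e 0 t = e 0 t" for t by (simp add: F_def)
    thus ?thesis unfolding rev_upt_Suc by (simp add: pascal o_def)
  qed
  also have "\<dots> = (\<Sum>\<alpha>\<in>slice_arrays m. slice_weight u w \<alpha> *
         alt (map (\<lambda>b. Q (Suc b)) (free_legs m \<alpha>) @ map (\<lambda>c. e' (\<alpha> 0 c - 1)) (rev [0..<num_parts (\<alpha> 0)])
           @ ?g # ys))"
    unfolding F_def by (rule Suc.IH)
  also have "\<dots> = (\<Sum>\<alpha>\<in>slice_arrays m. slice_weight u w \<alpha> *
      (\<Sum>s\<in>lifts (\<alpha> 0). (\<Prod>c<num_parts (\<alpha> 0). if s c = \<alpha> 0 c then w else u) *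
         ?A \<alpha> s))"
  proof (rule sum.cong[OF refl])
    fix \<alpha> assume \<alpha>: "\<alpha> \<in> slice_arrays m"
    define s' where "s' = \<alpha> 0"
    define l where "l = num_parts s'"
    note st = slice_arrays_strict[OF \<alpha>, of 0, folded s'_def]
    have z: "s' l = 0" using num_parts_iff[OF st, of l] by (simp add: l_def)
    have pos: "0 < s' c" if "c < l" for c using num_parts_iff[OF st, of c] that by (simp add: l_def)
    let ?xs = "map (\<lambda>b. Q (Suc b)) (free_legs m \<alpha>)"
    let ?M = "map (\<lambda>c t. w * e (s' c - 1) t + u * e (Suc (s' c - 1)) t) (rev [0..<l])"
    let ?p = "\<lambda>E. \<Prod>c<l. if c \<in> E then u else w" and ?q = "\<lambda>s. \<Prod>c<l. if s c = s' c then w else u"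
    let ?a = "\<lambda>s. alt (?xs @ map (\<lambda>c. V (s c)) (rev [0..<Suc l]) @ ys)"
    define s where "s = (\<lambda>E c. s' c + (if c \<in> E then 1 else 0))"
    \<comment> \<open>Place \<open>l\<close> holds the combined function \<open>Q 0 + e 0\<close>,
      whose summands carry no weight; elsewhere a kept part costs \<open>w\<close> and an enlarged
      one \<open>u\<close>.\<close>
    define kA where "kA = (\<lambda>c. if c = l then 1 else w)"
    define kB where "kB = (\<lambda>c. if c = l then 1 else u)"
    have "alt (?xs @ map (\<lambda>c. e' (s' c - 1)) (rev [0..<l]) @ ?g # ys)
      = (-1) ^ l * alt (?xs @ ?g # map (\<lambda>c. e' (s' c - 1)) (rev [0..<l]) @ ys)"
      by (subst alt_move) simp
    also have "alt (?xs @ ?g # map (\<lambda>c. e' (s' c - 1)) (rev [0..<l]) @ ys)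
      = (-1) ^ l * alt (?xs @ ?g #
          ?M @ ys)"
    proof -
      have "map (\<lambda>_. -1) (rev [0..<l]) = replicate l (-1 :: 'a)" by (simp add: map_replicate_const)
      thus ?thesis
        unfolding e'_def
        using alt_segment_cmult[of "?xs @ [\<lambda>t. Q 0 t + e 0 t]" "\<lambda>_. -1" "\<lambda>c t. w * e (s' c - 1) t + u * e (Suc (s' c - 1)) t" "rev [0..<l]" ys]
        by (simp only: prod_list_replicate append_assoc append.simps)
    qed
    also have "(-1) ^ l * ((-1) ^ l * alt (?xs @ ?g #
          ?M @ ys))
      = alt (?xs @ ?g #
          ?M @ ys)"
      by (simp flip: mult.assoc power_mult_distrib)
    also have "?g # ?M @ ys
      = map (\<lambda>c t. kA c * V (s' c) t + kB c * V (Suc (s' c)) t) (rev [0..<Suc l]) @ ys"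
    proof -
      have "(\<lambda>t. w * e (s' c - 1) t + u * e (Suc (s' c - 1)) t) = (\<lambda>t. kA c * V (s' c) t + kB c * V (Suc (s' c)) t)"
        if "c < l" for c
        using pos[OF that] that by (cases "s' c") (simp_all add: V_def kA_def kB_def)
      thus ?thesis by (simp add: V_def kA_def kB_def z)
    qed
    also have "alt (?xs @ \<dots>) = (\<Sum>E\<in>Pow {..l}. alt (?xs @
        map (\<lambda>c. if c \<in> E then (\<lambda>t. kB c * V (Suc (s' c)) t) else (\<lambda>t. kA c * V (s' c) t)) (rev [0..<Suc l]) @ ys))"
      by (subst alt_segment_add) (simp_all add: atLeast0LessThan lessThan_Suc_atMost del: upt_Suc)
    also have "\<dots> = (\<Sum>E\<in>Pow {..l}. ?p E *
        ?a (s E))"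
    proof (rule sum.cong[OF refl])
      fix E
      have "(\<lambda>c. if c \<in> E then (\<lambda>t. kB c * V (Suc (s' c)) t) else (\<lambda>t. kA c * V (s' c) t))
        = (\<lambda>c t. (if c \<in> E then kB c else kA c) * V (s E c) t)"
        by (auto simp: s_def fun_eq_iff)
      moreover have "(\<Prod>c\<leftarrow>rev [0..<Suc l]. if c \<in> E then kB c else kA c) = ?p E"
      proof -
        have "(\<Prod>c\<leftarrow>rev [0..<l]. if c \<in> E then kB c else kA c) = (\<Prod>c<l. if c \<in> E then kB c else kA c)"
          by (induction l) (simp_all add: mult.commute)
        also have "\<dots> = ?p E"
          by (rule prod.cong) (auto simp: kA_def kB_def)
        finally show ?thesis by (simp add: kA_def kB_def)
      qed
      ultimately show "alt (?xs @ map (\<lambda>c. if c \<in> E then (\<lambda>t. kB c * V (Suc (s' c)) t) else (\<lambda>t. kA c * V (s' c) t)) (rev [0..<Suc l]) @ ys)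
        = ?p E * ?a (s E)"
        by (simp only: alt_segment_cmult)
    qed
    also have "\<dots> = (\<Sum>E | E \<subseteq> {..l} \<and> strict_parts (s E). ?p E *
        ?a (s E))"
    proof (rule sum.mono_neutral_right)
      show "\<forall>E\<in>Pow {..l} - {E. E \<subseteq> {..l} \<and> strict_parts (s E)}. ?p E *
        ?a (s E) = 0"
      proof
        fix E assume "E \<in> Pow {..l} - {E. E \<subseteq> {..l} \<and> strict_parts (s E)}"
        hence E: "E \<subseteq> {..l}" "\<not> strict_parts (s E)" by auto
        then obtain c where c: "s E c \<le> s E (Suc c)" "s E (Suc c) \<noteq> 0"
          by (auto simp: strict_parts_def not_less)
        have "s' (Suc c) < s' c \<or> s' (Suc c) = 0" using st by (simp add: strict_parts_def)
        moreover have "Suc c \<le> l"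
        proof (rule ccontr)
          assume "\<not> Suc c \<le> l"
          hence "Suc c \<notin> E" "s' (Suc c) = 0"
            using E(1) num_parts_iff[OF st, of "Suc c"] by (auto simp: l_def)
          thus False using c(2) by (simp add: s_def)
        qed
        moreover from this have "0 < s' c" by (intro pos) simp
        ultimately have "s E c = s E (Suc c)" using c by (auto simp: s_def split: if_splits)
        hence eq: "V (s E c) = V (s E (Suc c))" by simp
        have "\<not> distinct (map (\<lambda>c. V (s E c)) (rev [0..<Suc l]))"
        proof
          assume "distinct (map (\<lambda>c. V (s E c)) (rev [0..<Suc l]))"
          hence "inj_on (\<lambda>c. V (s E c)) (set (rev [0..<Suc l]))" by (simp only: distinct_map)
          from inj_onD[OF this, of c "Suc c"] eq \<open>Suc c \<le> l\<close> show False by (simp del: upt_Suc)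
        qed
        hence "?a (s E) = 0"
          by (intro alt_not_distinct) (simp del: upt_Suc)
        thus "?p E *
          ?a (s E) = 0" by simp
      qed
    qed auto
    also have "\<dots> = (\<Sum>E | E \<subseteq> {..l} \<and> strict_parts (s E). (\<Prod>c<l. if s E c = s' c then w else u) *
        ?a (s E))"
      by (intro sum.cong refl arg_cong2[where f = "(*)"] prod.cong) (auto simp: s_def)
    also have "\<dots> = (\<Sum>s\<in>lifts s'. ?q s *
        ?a s)"
      unfolding sum_lifts[OF st] s_def l_def ..
    also have "\<dots> = (\<Sum>s\<in>lifts s'. ?q s *
        ?A \<alpha> s)"
    proof (rule sum.cong[OF refl])
      fix s assume s: "s \<in> lifts s'"
      have "map (\<lambda>c. V (s c)) (rev [0..<l]) = map (\<lambda>c. e (s c - 1)) (rev [0..<l])"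
      proof (rule map_cong[OF refl])
        fix c assume "c \<in> set (rev [0..<l])"
        hence "0 < s' c" by (intro pos) simp
        moreover have "s' c \<le> s c" using s by (simp add: lifts_def)
        ultimately show "V (s c) = e (s c - 1)" by (cases "s c") (simp_all add: V_def)
      qed
      \<comment> \<open>So \<open>V (s l)\<close> is \<open>Q 0\<close> or \<open>e 0\<close>:
        either leg 0 stays free and the function ends the block of \<open>Q\<close>, or a part of
        size 1 opens and it starts the block of \<open>e\<close>.\<close>
      moreover have "s l \<le> 1" using s z by (auto simp: lifts_def dest: spec[of _ l])
      ultimately have "?xs @ map (\<lambda>c. V (s c)) (rev [0..<Suc l]) @ ys
        = map Q (free_legs (Suc m) (case_nat s \<alpha>)) @ map (\<lambda>c. e (s c - 1)) (rev [0..<num_parts s]) @ ys"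
        using free_legs_case_nat[OF \<alpha>] num_parts_lifts[OF st s] s
        by (cases "s l") (simp_all add: V_def s'_def[symmetric] l_def[symmetric] o_def)
      thus "?q s * ?a s
        = ?q s *
        ?A \<alpha> s"
        by (simp only:)
    qed
    finally show "slice_weight u w \<alpha> *
         alt (?xs @ map (\<lambda>c. e' (\<alpha> 0 c - 1)) (rev [0..<num_parts (\<alpha> 0)]) @ ?g # ys)
      = slice_weight u w \<alpha> * (\<Sum>s\<in>lifts (\<alpha> 0). (\<Prod>c<num_parts (\<alpha> 0). if s c = \<alpha> 0 c then w else u) *
         ?A \<alpha> s)"
      by (simp only: s'_def l_def)
  qed
  also have "\<dots> = (\<Sum>\<alpha>\<in>slice_arrays m. \<Sum>s\<in>lifts (\<alpha> 0). slice_weight u w (case_nat s \<alpha>) *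
         alt (map Q (free_legs (Suc m) (case_nat s \<alpha>)) @ map (\<lambda>c. e (case_nat s \<alpha> 0 c - 1)) (rev [0..<num_parts (case_nat s \<alpha> 0)]) @ ys))"
    by (intro sum.cong refl) (simp add: sum_distrib_left slice_weight_case_nat mult.assoc)
  finally show ?case by (simp only: sum_slice_arrays_Suc F_def)
qed

section \<open>Schur polynomials as quotients of alternants\<close>

lemma partition_antimono: "is_partition p \<Longrightarrow> 1 \<le> i \<Longrightarrow> i \<le> j \<Longrightarrow> p j \<le> p i"
  by (auto simp: is_partition_def)

lemma partition_0: "is_partition p \<Longrightarrow> p 0 = 0"
  by (simp add: is_partition_def)

lemma diagram_Sigma:
  assumes "is_partition p" "p (Suc r) = 0"
  shows "diagram p = Sigma {1..r} (\<lambda>i. {1..p i})"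
proof -
  have "p i = 0" if "r < i" for i
    using partition_antimono[OF assms(1), of "Suc r" i] that assms(2) by simp
  hence "i \<le> r" if "1 \<le> j" "j \<le> p i" for i j
    using that by (metis not_le not_one_le_zero le_trans)
  thus ?thesis by (auto simp: diagram_def)
qed

lemma finite_diagram:
  assumes "is_partition p"
  shows "finite (diagram p)"
proof -
  have "finite {i. p i \<noteq> 0}" using assms by (simp add: is_partition_def)
  then obtain r where "\<forall>i\<in>{i. p i \<noteq> 0}. i \<le> r" by (meson finite_nat_set_iff_bounded_le)
  hence "p (Suc r) = 0" by force
  thus ?thesis using diagram_Sigma[OF assms] by simp
qed

lemma card_diagram:
  assumes "is_partition p" "p (Suc r) = 0"
  shows "card (diagram p) = (\<Sum>i=1..r. p i)"
  by (simp add: diagram_Sigma[OF assms])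

lemma finite_SSYT:
  assumes "is_partition p"
  shows "finite (SSYT m p)"
proof (rule finite_subset)
  let ?F = "{f. \<forall>c. (c \<in> diagram p \<longrightarrow> f c \<in> {..m}) \<and> (c \<notin> diagram p \<longrightarrow> f c = 0)}"
  show "SSYT m p \<subseteq> (\<lambda>f i j. f (i, j)) ` ?F"
  proof
    fix t assume "t \<in> SSYT m p"
    thus "t \<in> (\<lambda>f i j. f (i, j)) ` ?F"
      by (intro image_eqI[of _ _ "\<lambda>(i, j). t i j"]) (auto simp: SSYT_def)
  qed
  show "finite ((\<lambda>f i j. f (i, j)) ` ?F)"
    by (intro finite_imageI finite_set_of_finite_funs finite_diagram assms) simp
qed

lemma SSYT_0:
  assumes "is_partition p" "p (Suc 0) = 0"
  shows "SSYT 0 p = {\<lambda>_ _. 0}"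
  using diagram_Sigma[OF assms] by (auto simp: SSYT_def fun_eq_iff)

section \<open>Removing the largest entries of a tableau\<close>

definition horizontal_strips :: "nat \<Rightarrow> (nat \<Rightarrow> nat) \<Rightarrow> (nat \<Rightarrow> nat) set" where
  "horizontal_strips r p = {q. is_partition q \<and> q (Suc r) = 0 \<and> (\<forall>i\<ge>1. p (Suc i) \<le> q i \<and> q i \<le> p i)}"

lemma finite_horizontal_strips:
  assumes "is_partition p"
  shows "finite (horizontal_strips r p)"
proof (rule finite_subset)
  let ?F = "{q. \<forall>i. (i \<in> {1..r} \<longrightarrow> q i \<in> {..p 1}) \<and> (i \<notin> {1..r} \<longrightarrow> q i = 0)}"
  show "horizontal_strips r p \<subseteq> ?F"
  proof
    fix q assume q: "q \<in> horizontal_strips r p"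
    have "q i \<le> p 1" if "1 \<le> i" for i
      using q partition_antimono[OF assms, of 1 i] that
      by (auto simp: horizontal_strips_def intro: le_trans)
    moreover have "q i = 0" if "r < i" for i
      using q partition_antimono[of q "Suc r" i] that by (auto simp: horizontal_strips_def)
    moreover have "q 0 = 0" using q by (simp add: horizontal_strips_def is_partition_def)
    ultimately show "q \<in> ?F" by (auto simp: not_le Suc_le_eq)
  qed
  show "finite ?F" by (rule finite_set_of_finite_funs) simp_all
qed

lemma down_closed_nat:
  fixes S :: "nat set"
  assumes "S \<subseteq> {1..N}" "\<And>j. 1 \<le> j \<Longrightarrow> Suc j \<in> S \<Longrightarrow> j \<in> S"
  shows "S = {1..card S}"
proof -
  have d: "j' \<in> S" if "j \<in> S" "1 \<le> j'" "j' \<le> j" for j j'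
    using that(3,1,2)
  proof (induction j' rule: inc_induct)
    case (step n)
    thus ?case using assms(2)[of n] by simp
  qed simp
  have fin: "finite S" by (rule finite_subset[OF assms(1)]) simp
  show ?thesis
  proof (cases "S = {}")
    case False
    have "S = {1..Max S}"
    proof (intro equalityI subsetI)
      fix j assume "j \<in> S"
      thus "j \<in> {1..Max S}" using assms(1) fin by auto
    next
      fix j assume "j \<in> {1..Max S}"
      thus "j \<in> S" using d[OF Max_in[OF fin False], of j] by simp
    qed
    moreover from this have "card S = Max S" by (metis card_atLeastAtMost diff_Suc_1)
    ultimately show ?thesis by simp
  qed simp
qed

lemma horizontal_strips_diagram: "q \<in> horizontal_strips r p \<Longrightarrow> diagram q \<subseteq> diagram p"
  by (auto simp: horizontal_strips_def diagram_def intro: le_trans)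

text \<open>A consequence of column strictness; it confines the entries that are at most
  \<open>r\<close> to the first \<open>r\<close> rows.\<close>

lemma SSYT_ge_row:
  assumes "is_partition p" "t \<in> SSYT m p" "(i, j) \<in> diagram p"
  shows "i \<le> t i j"
  using assms(3)
proof (induction i)
  case (Suc i)
  show ?case
  proof (cases "i = 0")
    case True
    thus ?thesis using assms(2) Suc.prems by (auto simp: SSYT_def)
  next
    case False
    have "(i, j) \<in> diagram p"
      using Suc.prems False partition_antimono[OF assms(1), of i "Suc i"] by (auto simp: diagram_def)
    thus ?thesis using Suc assms(2) by (fastforce simp: SSYT_def)
  qed
qed simp

definition small_part :: "nat \<Rightarrow> (nat \<Rightarrow> nat) \<Rightarrow> (nat \<Rightarrow> nat \<Rightarrow> nat) \<Rightarrow> nat \<Rightarrow> nat" where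
  "small_part r p t i = card {j. (i, j) \<in> diagram p \<and> t i j \<le> r}"

lemma small_part_iff:
  assumes "t \<in> SSYT m p"
  shows "(i, j) \<in> diagram p \<and> t i j \<le> r \<longleftrightarrow> 1 \<le> j \<and> j \<le> small_part r p t i"
proof -
  let ?S = "{j. (i, j) \<in> diagram p \<and> t i j \<le> r}"
  have "?S = {1..card ?S}"
  proof (rule down_closed_nat[where N = "p i"])
    fix j assume j: "1 \<le> j" "Suc j \<in> ?S"
    hence "(i, j) \<in> diagram p" by (auto simp: diagram_def)
    moreover from this have "t i j \<le> t i (Suc j)" using j assms by (auto simp: SSYT_def)
    ultimately show "j \<in> ?S" using j by auto
  qed (auto simp: diagram_def)
  thus ?thesis unfolding small_part_def by (metis (no_types, lifting) atLeastAtMost_iff mem_Collect_eq)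
qed

lemma diagram_small_part:
  assumes "t \<in> SSYT m p"
  shows "(i, j) \<in> diagram (small_part r p t) \<longleftrightarrow> (i, j) \<in> diagram p \<and> t i j \<le> r"
  using small_part_iff[OF assms, of i j r] by (auto simp: diagram_def)

lemma small_part_strip:
  assumes "is_partition p" "t \<in> SSYT (Suc r) p"
  shows "small_part r p t \<in> horizontal_strips r p"
proof -
  let ?q = "small_part r p t"
  have up: "?q i \<le> p i" if "1 \<le> i" for i
  proof (cases "?q i = 0")
    case False
    hence "(i, ?q i) \<in> diagram p" using small_part_iff[OF assms(2), of i "?q i" r] by simp
    thus ?thesis by (simp add: diagram_def)
  qed simp
  have lo: "p (Suc i) \<le> ?q i" if "1 \<le> i" for i
  proof (cases "p (Suc i) = 0")
    case False
    let ?j = "p (Suc i)"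
    have j: "(Suc i, ?j) \<in> diagram p" "(i, ?j) \<in> diagram p"
      using False that partition_antimono[OF assms(1), of i "Suc i"] by (auto simp: diagram_def)
    hence "t i ?j < t (Suc i) ?j" "t (Suc i) ?j \<le> Suc r" using assms(2) by (auto simp: SSYT_def)
    thus ?thesis using small_part_iff[OF assms(2), of i ?j r] j(2) by simp
  qed simp
  have dec: "?q j \<le> ?q i" if "1 \<le> i" "i \<le> j" for i j
    using that(2,1)
  proof (induction j rule: dec_induct)
    case (step n)
    thus ?case using up[of "Suc n"] lo[of n] by simp
  qed simp
  have "?q (Suc r) = 0"
  proof (rule ccontr)
    assume "?q (Suc r) \<noteq> 0"
    hence "(Suc r, 1) \<in> diagram p \<and> t (Suc r) 1 \<le> r" using small_part_iff[OF assms(2), of "Suc r" 1 r] by simp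
    thus False using SSYT_ge_row[OF assms, of "Suc r" 1] by simp
  qed
  moreover have "?q 0 = 0" by (simp add: small_part_def diagram_def)
  moreover have "finite {i. ?q i \<noteq> 0}"
  proof (rule finite_subset)
    show "{i. ?q i \<noteq> 0} \<subseteq> {i. p i \<noteq> 0}"
      using up \<open>?q 0 = 0\<close> by (auto simp: Suc_le_eq) (metis gr0I le_zero_eq Suc_le_eq One_nat_def)
    show "finite {i. p i \<noteq> 0}" using assms(1) by (simp add: is_partition_def)
  qed
  ultimately show ?thesis
    using up lo dec by (simp add: horizontal_strips_def is_partition_def)
qed

text \<open>A column holds the entry \<open>Suc r\<close> at most once, at its bottom, so these
  cells form a horizontal strip. A tableau is thus the same as an inner shape \<open>q\<close> with
  a filling of \<open>q\<close> by smaller entries.\<close>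

lemma schur_branching:
  assumes "is_partition p"
  shows "schur (Suc r) p x = (\<Sum>q\<in>horizontal_strips r p.
     x (Suc r) ^ (card (diagram p) - card (diagram q)) * schur r q x)"
proof -
  define rest where "rest = (\<lambda>(t :: nat \<Rightarrow> nat \<Rightarrow> nat) i j. if t i j \<le> r then t i j else (0::nat))"
  define ext where "ext = (\<lambda>q t i j. if (i, j) \<in> diagram q then t i j else if (i, j) \<in> diagram p then Suc r else (0::nat))"
  let ?w = "\<lambda>t. \<Prod>(i, j)\<in>diagram p. x (t i j)"
  have part: "is_partition q" if "q \<in> horizontal_strips r p" for q
    using that by (simp add: horizontal_strips_def)
  have inv: "ext (small_part r p t) (rest t) = t" if t: "t \<in> SSYT (Suc r) p" for t
  proof (intro HOL.ext)
    fix i j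
    note d = diagram_small_part[OF t, of i j r]
    show "ext (small_part r p t) (rest t) i j = t i j"
    proof (cases "(i, j) \<in> diagram p")
      case True
      hence "t i j \<le> Suc r" using t by (auto simp: SSYT_def)
      thus ?thesis using True d by (auto simp: ext_def rest_def)
    next
      case False
      hence "t i j = 0" using t by (auto simp: SSYT_def)
      thus ?thesis using False d by (simp add: ext_def)
    qed
  qed
  have "schur (Suc r) p x = (\<Sum>(q, t)\<in>(SIGMA q:horizontal_strips r p. SSYT r q). ?w (ext q t))"
    unfolding schur_def
  proof (rule sum.reindex_bij_witness[where i = "\<lambda>(q, t). ext q t" and j = "\<lambda>t. (small_part r p t, rest t)"], goal_cases)
    case (1 t)
    thus ?case using inv by simp
  next
    case (2 t)
    note d = diagram_small_part[OF 2, of _ _ r]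
    have "rest t \<in> SSYT r (small_part r p t)"
      using 2 by (auto simp: SSYT_def d rest_def)
    thus ?case using small_part_strip[OF assms 2] by simp
  next
    case (3 y)
    then obtain q t where y: "y = (q, t)" and q: "q \<in> horizontal_strips r p" and t: "t \<in> SSYT r q" by auto
    note sub = horizontal_strips_diagram[OF q]
    have le: "ext q t i j \<le> r \<longleftrightarrow> (i, j) \<in> diagram q" if "(i, j) \<in> diagram p" for i j
      using that t by (auto simp: ext_def SSYT_def)
    have "{j. (i, j) \<in> diagram p \<and> ext q t i j \<le> r} = {j. (i, j) \<in> diagram q}" for i
      using le sub by auto
    moreover have "card {j. (i, j) \<in> diagram q} = q i" for i
    proof (cases "i = 0")
      case True
      thus ?thesis using partition_0[OF part[OF q]] by (simp add: diagram_def)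
    next
      case False
      hence "{j. (i, j) \<in> diagram q} = {1..q i}" by (auto simp: diagram_def)
      thus ?thesis by simp
    qed
    ultimately have "small_part r p (ext q t) = q" by (simp add: small_part_def fun_eq_iff)
    moreover have "rest (ext q t) = t"
      using t sub by (auto simp: rest_def ext_def SSYT_def fun_eq_iff)
    ultimately show ?case by (simp add: y)
  next
    case (4 y)
    then obtain q t where y: "y = (q, t)" and q: "q \<in> horizontal_strips r p" and t: "t \<in> SSYT r q" by auto
    note sub = horizontal_strips_diagram[OF q]
    have "ext q t i j < ext q t (Suc i) j" if "(i, j) \<in> diagram p" "(Suc i, j) \<in> diagram p" for i j
    proof -
      have "p (Suc i) \<le> q i" using q that by (auto simp: horizontal_strips_def diagram_def)
      hence "(i, j) \<in> diagram q" using that by (auto simp: diagram_def)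
      thus ?thesis using that t by (auto simp: ext_def SSYT_def less_Suc_eq_le)
    qed
    moreover have "ext q t i j \<le> ext q t i (Suc j)" if "(i, j) \<in> diagram p" "(i, Suc j) \<in> diagram p" for i j
    proof (cases "(i, Suc j) \<in> diagram q")
      case True
      hence "(i, j) \<in> diagram q" using that by (auto simp: diagram_def)
      thus ?thesis using True t by (auto simp: ext_def SSYT_def)
    next
      case False
      thus ?thesis using that t by (auto simp: ext_def SSYT_def le_Suc_eq)
    qed
    moreover have "1 \<le> ext q t i j \<and> ext q t i j \<le> Suc r" if "(i, j) \<in> diagram p" for i j
      using that t by (auto simp: ext_def SSYT_def)
    moreover have "ext q t i j = 0" if "(i, j) \<notin> diagram p" for i j
      using that sub by (auto simp: ext_def)
    ultimately show ?case by (auto simp: y SSYT_def)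
  next
    case (5 t)
    thus ?case using inv by simp
  qed
  also have "\<dots> = (\<Sum>q\<in>horizontal_strips r p. \<Sum>t\<in>SSYT r q. ?w (ext q t))"
    by (rule sum.Sigma[symmetric]) (auto intro: finite_horizontal_strips finite_SSYT assms part)
  also have "\<dots> = (\<Sum>q\<in>horizontal_strips r p.
     x (Suc r) ^ (card (diagram p) - card (diagram q)) * schur r q x)"
  proof (rule sum.cong[OF refl])
    fix q assume q: "q \<in> horizontal_strips r p"
    note sub = horizontal_strips_diagram[OF q]
    have "?w (ext q t) = x (Suc r) ^ (card (diagram p) - card (diagram q)) * (\<Prod>(i, j)\<in>diagram q. x (t i j))" for t
    proof -
      have "?w (ext q t) = (\<Prod>(i, j)\<in>diagram p - diagram q. x (ext q t i j)) * (\<Prod>(i, j)\<in>diagram q. x (ext q t i j))"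
        by (rule prod.subset_diff[OF sub finite_diagram[OF assms]])
      also have "(\<Prod>(i, j)\<in>diagram p - diagram q. x (ext q t i j)) = (\<Prod>_\<in>diagram p - diagram q. x (Suc r))"
        by (rule prod.cong) (auto simp: ext_def)
      also have "\<dots> = x (Suc r) ^ (card (diagram p) - card (diagram q))"
        using sub finite_diagram[OF part[OF q]] by (simp add: card_Diff_subset)
      also have "(\<Prod>(i, j)\<in>diagram q. x (ext q t i j)) = (\<Prod>(i, j)\<in>diagram q. x (t i j))"
        by (rule prod.cong) (auto simp: ext_def)
      finally show ?thesis .
    qed
    thus "(\<Sum>t\<in>SSYT r q. ?w (ext q t)) = x (Suc r) ^ (card (diagram p) - card (diagram q)) * schur r q x"
      by (simp add: schur_def sum_distrib_left)
  qed
  finally show ?thesis .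
qed

lemma triangle_sum_cong:
  assumes "\<And>j. j < n \<Longrightarrow> k j = k' j"
  shows "triangle_sum u v w x n k = triangle_sum u v w x n k'"
proof (cases n)
  case (Suc r)
  have "interlacing k r = interlacing k' r" using assms Suc by (auto simp: interlacing_def)
  thus ?thesis using assms Suc by (auto intro!: sum.cong prod.cong arg_cong2[where f = "(*)"] arg_cong[where f = "(^) _"])
qed simp

section \<open>Beta numbers and the bialternant formula\<close>

definition beta_numbers :: "nat \<Rightarrow> (nat \<Rightarrow> nat) \<Rightarrow> nat \<Rightarrow> nat" where
  "beta_numbers n p i = p (n - i) + i"

lemma sum_rev_index: "(\<Sum>j<n. f (n - j)) = (\<Sum>i=1..n. f (i::nat) :: 'a::comm_monoid_add)"
  by (rule sum.reindex_bij_witness[where i = "\<lambda>i. n - i" and j = "\<lambda>j. n - j"]) auto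

text \<open>With \<open>j = r - i\<close>, the bounds \<open>p (Suc i) \<le> q i \<le> p i\<close>
  gain the shifts \<open>j\<close>, \<open>j\<close> and \<open>j + 1\<close> in beta numbers. The
  upper bound therefore becomes strict, and strictness within the row is automatic.\<close>

lemma interlacing_horizontal_strips:
  assumes p: "is_partition p" "p (Suc (Suc r)) = 0"
  shows "bij_betw (\<lambda>q j. if j < r then beta_numbers r q j else 0) (horizontal_strips r p)
    {l \<in> interlacing (beta_numbers (Suc r) p) r. \<forall>j<r. l j < beta_numbers (Suc r) p (Suc j)}"
proof (rule bij_betw_byWitness[where f' = "\<lambda>l i. if 1 \<le> i \<and> i \<le> r then l (r - i) - (r - i) else 0"])
  let ?f = "\<lambda>q j. if j < r then beta_numbers r q j else 0"
  let ?g = "\<lambda>l i. if 1 \<le> i \<and> i \<le> r then l (r - i) - (r - i) else 0"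
  let ?k = "beta_numbers (Suc r) p"
  let ?L = "{l \<in> interlacing ?k r. \<forall>j<r. l j < ?k (Suc j)}"
  have zero: "q i = 0" if "q \<in> horizontal_strips r p" "\<not> (1 \<le> i \<and> i \<le> r)" for q i
    using that partition_antimono[of q "Suc r" i] by (cases "i = 0") (auto simp: horizontal_strips_def is_partition_def)
  show "\<forall>q\<in>horizontal_strips r p. ?g (?f q) = q"
    using zero by (auto simp: fun_eq_iff beta_numbers_def)
  have ge: "j \<le> l j" if "l \<in> ?L" "j < r" for l j
  proof -
    have "?k j \<le> l j" using that by (simp add: interlacing_def)
    thus ?thesis by (simp add: beta_numbers_def)
  qed
  show "\<forall>l\<in>?L. ?f (?g l) = l"
    using ge by (auto simp: fun_eq_iff beta_numbers_def interlacing_def)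
  show "?f ` horizontal_strips r p \<subseteq> ?L"
  proof clarify
    fix q assume q: "q \<in> horizontal_strips r p"
    have b: "p (Suc i) \<le> q i" "q i \<le> p i" if "1 \<le> i" for i
      using q that by (auto simp: horizontal_strips_def)
    have lt: "?f q j < ?k (Suc j)" "?k j \<le> ?f q j" if "j < r" for j
      using b[of "r - j"] that by (auto simp: beta_numbers_def Suc_diff_le Suc_le_eq)
    have "?f q j < ?f q (Suc j)" if "Suc j < r" for j
      using partition_antimono[of q "r - Suc j" "r - j"] q that
      by (simp add: beta_numbers_def horizontal_strips_def Suc_le_eq diff_le_mono2)
    thus "?f q \<in> interlacing ?k r \<and> (\<forall>j<r. ?f q j < ?k (Suc j))"
      using lt by (auto simp: interlacing_def less_imp_le)
  qed
  show "?g ` ?L \<subseteq> horizontal_strips r p"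
  proof
    fix q assume "q \<in> ?g ` ?L"
    then obtain l where l: "l \<in> ?L" and q: "q = ?g l" by blast
    have b: "p (Suc i) \<le> q i" "q i \<le> p i" if "1 \<le> i" for i
    proof -
      have "p (Suc i) \<le> q i \<and> q i \<le> p i"
      proof (cases "i \<le> r")
        case True
        hence "?k (r - i) \<le> l (r - i)" "l (r - i) < ?k (Suc (r - i))"
          using l that by (auto simp: interlacing_def)
        thus ?thesis using that True by (auto simp: q beta_numbers_def Suc_diff_le)
      next
        case False
        hence "p (Suc i) = 0" using partition_antimono[OF p(1), of "Suc (Suc r)" "Suc i"] p(2) by simp
        thus ?thesis using False by (simp add: q)
      qed
      thus "p (Suc i) \<le> q i" "q i \<le> p i" by auto
    qed
    have "q j \<le> q i" if "1 \<le> i" "i \<le> j" for i j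
      using that(2,1)
    proof (induction j rule: dec_induct)
      case (step n)
      thus ?case using b(2)[of "Suc n"] b(1)[of n] by simp
    qed simp
    moreover have "finite {i. q i \<noteq> 0}"
      by (rule finite_subset[of _ "{1..r}"]) (auto simp: q split: if_splits)
    moreover have "q 0 = 0" "q (Suc r) = 0" by (simp_all add: q)
    ultimately show "q \<in> horizontal_strips r p"
      using b by (simp add: horizontal_strips_def is_partition_def)
  qed
qed

text \<open>For \<open>u = w = 0\<close> and \<open>v = 1\<close> right-leaning entries have weight
  0 and all others \<open>1 / X\<close>. The surviving triangles are the chains of shapes of a
  tableau, written in beta numbers; the factors \<open>1 / X\<close> compensate the growth of the
  staircase from one row to the next.\<close>

lemma schur_triangle_sum:
  assumes "is_partition p" "p (Suc n) = 0" "\<And>i. i < n \<Longrightarrow> x (Suc i) \<noteq> (0 :: 'a::field)"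
  shows "schur n p x = triangle_sum 0 1 0 (\<lambda>i. x (Suc i)) n (beta_numbers n p)"
  using assms
proof (induction n arbitrary: p)
  case 0
  have "diagram p = {}" using diagram_Sigma[OF 0(1), of 0] 0(2) by simp
  thus ?case using 0 by (simp add: schur_def SSYT_0)
next
  case (Suc r)
  let ?k = "beta_numbers (Suc r) p" and ?X = "x (Suc r)"
  let ?f = "\<lambda>q j. if j < r then beta_numbers r q j else 0"
  let ?T = "triangle_sum 0 1 0 (\<lambda>i. x (Suc i)) r"
  let ?L = "{l \<in> interlacing ?k r. \<forall>j<r. l j < ?k (Suc j)}"
  let ?E = "\<lambda>l. \<Prod>j<r. entry_weight 0 1 0 ?X (?k j) (?k (Suc j)) (l j) / ?X ^ l j"
  let ?S = "?X ^ (\<Sum>j\<le>r. ?k j)"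
  have X: "?X \<noteq> 0" using Suc.prems(3)[of r] by simp
  have k: "?k j < ?k (Suc j)" if "j < r" for j
    using partition_antimono[OF Suc.prems(1), of "r - j" "Suc r - j"] that
    by (simp add: beta_numbers_def Suc_le_eq diff_le_mono diff_le_mono2)
  have "triangle_sum 0 1 0 (\<lambda>i. x (Suc i)) (Suc r) ?k
    = (\<Sum>l\<in>?L. ?S * ?E l * ?T l)"
    unfolding triangle_sum.simps
  proof (rule sum.mono_neutral_right)
    show "\<forall>l\<in>interlacing ?k r - ?L. ?S
      * ?E l * ?T l = 0"
    proof
      fix l assume "l \<in> interlacing ?k r - ?L"
      then obtain j where j: "j < r" "l j = ?k (Suc j)"
        by (auto simp: interlacing_def not_less intro: le_antisym)
      hence "entry_weight 0 1 0 ?X (?k j) (?k (Suc j)) (l j) / ?X ^ l j = 0"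
        using k[of j] by (simp add: entry_weight_def)
      hence "?E l = 0"
        using j(1) by (intro prod_zero) auto
      thus "?S
        * ?E l * ?T l = 0" by simp
    qed
  qed (auto simp: finite_interlacing)
  also have "\<dots> = (\<Sum>q\<in>horizontal_strips r p. ?S
      * ?E (?f q) * ?T (?f q))"
    by (rule sum.reindex_bij_betw[symmetric, OF interlacing_horizontal_strips[OF Suc.prems(1,2)]])
  also have "\<dots> = (\<Sum>q\<in>horizontal_strips r p. ?X ^ (card (diagram p) - card (diagram q)) * schur r q x)"
  proof (rule sum.cong[OF refl])
    fix q assume q: "q \<in> horizontal_strips r p"
    hence part: "is_partition q" "q (Suc r) = 0" by (auto simp: horizontal_strips_def)
    have L: "?f q \<in> ?L"
      using bij_betwE[OF interlacing_horizontal_strips[OF Suc.prems(1,2)]] q by blast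
    have "?E (?f q)
      = (\<Prod>j<r. 1 / ?X ^ Suc (beta_numbers r q j))"
    proof (rule prod.cong[OF refl])
      fix j assume "j \<in> {..<r}"
      hence "j < r" "?f q j \<noteq> ?k (Suc j)" using L by auto
      thus "entry_weight 0 1 0 ?X (?k j) (?k (Suc j)) (?f q j) / ?X ^ ?f q j = 1 / ?X ^ Suc (beta_numbers r q j)"
        by (simp add: entry_weight_def)
    qed
    also have "\<dots> = 1 / ?X ^ (\<Sum>j<r. Suc (beta_numbers r q j))"
      by (simp add: prod_dividef power_sum del: power_Suc)
    finally have E: "?E (?f q)
      = 1 / ?X ^ (\<Sum>j<r. Suc (beta_numbers r q j))" .
    have c: "card (diagram q) \<le> card (diagram p)"
      by (rule card_mono[OF finite_diagram[OF Suc.prems(1)] horizontal_strips_diagram[OF q]])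
    have "(\<Sum>j\<le>r. ?k j) = (\<Sum>j<Suc r. p (Suc r - j)) + (\<Sum>j<Suc r. j)"
      by (simp only: beta_numbers_def sum.distrib lessThan_Suc_atMost)
    also have "(\<Sum>j<Suc r. p (Suc r - j)) = card (diagram p)"
      by (simp only: sum_rev_index card_diagram[OF Suc.prems(1,2)])
    also have "(\<Sum>j<Suc r. j) = (\<Sum>j<r. Suc j)" by (subst sum.lessThan_Suc_shift) simp
    also have "card (diagram p) + (\<Sum>j<r. Suc j) = (card (diagram p) - card (diagram q)) + (\<Sum>j<r. Suc (beta_numbers r q j))"
    proof -
      have "(\<Sum>j<r. Suc (beta_numbers r q j)) = (\<Sum>j<r. q (r - j)) + (\<Sum>j<r. Suc j)"
        by (simp add: beta_numbers_def sum.distrib[symmetric])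
      thus ?thesis using c by (simp add: sum_rev_index card_diagram[OF part])
    qed
    finally have "?S * (1 / ?X ^ (\<Sum>j<r. Suc (beta_numbers r q j)))
      = ?X ^ (card (diagram p) - card (diagram q))"
      using X by (simp add: power_add)
    moreover have "?T (?f q) = schur r q x"
      using Suc.IH[OF part] Suc.prems(3) triangle_sum_cong[of r "?f q" "beta_numbers r q"] by simp
    ultimately show "?S
      * ?E (?f q) * ?T (?f q)
      = ?X ^ (card (diagram p) - card (diagram q)) * schur r q x"
      by (simp only: E)
  qed
  finally show ?case by (simp only: schur_branching[OF Suc.prems(1)])
qed

theorem schur_alternant:
  assumes "is_partition p" "p (Suc n) = 0" "\<And>i. i < n \<Longrightarrow> x (Suc i) \<noteq> (0 :: 'a::field)"
  shows "schur n p x * pair_prod (\<lambda>s t. t - s) n (\<lambda>i. x (Suc i))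
    = alt (map (\<lambda>i t. x (Suc t) ^ beta_numbers n p i) [0..<n])"
proof -
  have "edge_weight 0 1 0 = (\<lambda>s t. 1 :: 'a)" by (simp add: edge_weight_def fun_eq_iff)
  hence one: "pair_prod (edge_weight 0 1 0) n z = (1 :: 'a)" for z by (simp add: pair_prod_eq)
  have "beta_numbers n p j < beta_numbers n p (Suc j)" if "Suc j < n" for j
    using partition_antimono[OF assms(1), of "n - Suc j" "n - j"] that by (simp add: beta_numbers_def Suc_le_eq diff_le_mono diff_le_mono2)
  moreover have "schur n p x = triangle_sum 0 1 0 (\<lambda>i. x (Suc i)) n (beta_numbers n p)"
    by (rule schur_triangle_sum) (use assms in auto)
  ultimately show ?thesis
    using triangle_sum_antisymmetrize[of n "\<lambda>i. x (Suc i)" "beta_numbers n p" 0 1 0] assms(3)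
    by (simp add: one alt_def)
qed

section \<open>Alternating sign matrices as monotone triangles\<close>

text \<open>The partial sums of an alternating sequence stay in \<open>{0, 1}\<close> or in
  \<open>{-1, 0}\<close>, according to its first nonzero entry, and the total 1 excludes the latter.
  Conversely, entries are differences of neighbouring sums, which are constant between nonzero
  entries.\<close>

lemma alternating_partial_sums:
  fixes a :: "nat \<Rightarrow> int"
  defines "S \<equiv> \<lambda>j. \<Sum>k=1..j. a k"
  assumes total: "S N = 1"
  shows "(\<forall>j\<in>{1..N}. a j \<in> {-1, 0, 1}) \<and>
      (\<forall>j\<in>{1..N}. \<forall>j'\<in>{1..N}. j < j' \<longrightarrow> a j \<noteq> 0 \<longrightarrow> a j' \<noteq> 0 \<longrightarrow>
        (\<forall>k\<in>{j<..<j'}. a k = 0) \<longrightarrow> a j' = - a j)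
    \<longleftrightarrow> (\<forall>j\<le>N. S j \<in> {0, 1})" (is "?ent \<and> ?alt \<longleftrightarrow> ?sums")
proof
  have S: "S (Suc j) = S j + a (Suc j)" for j by (simp add: S_def)
  have S0: "S 0 = 0" by (simp add: S_def)
  {
    assume *: "?ent \<and> ?alt"
    \<comment> \<open>Here \<open>p\<close> is the last nonzero position up to \<open>j\<close>, and
      \<open>e\<close> is the sign with which the sequence started: the sum is \<open>e\<close> or 0
      according to the sign at \<open>p\<close>.\<close>
    define Q where "Q = (\<lambda>e j. \<exists>p\<in>{1..j}. (\<forall>k\<in>{p<..j}. a k = 0) \<and> (a p = e \<and> S j = e \<or> a p = - e \<and> S j = 0))"
    have persist: "Q e (Suc j)" if Qj: "Q e j" and j: "Suc j \<le> N" and e: "e \<noteq> 0" for e j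
    proof (cases "a (Suc j) = 0")
      case True
      obtain p where p: "p \<in> {1..j}" "\<forall>k\<in>{p<..j}. a k = 0" "a p = e \<and> S j = e \<or> a p = - e \<and> S j = 0"
        using Qj unfolding Q_def by blast
      show ?thesis unfolding Q_def by (rule bexI[of _ p]) (use p True in \<open>auto simp: S le_Suc_eq\<close>)
    next
      case False
      obtain p where p: "p \<in> {1..j}" "\<forall>k\<in>{p<..j}. a k = 0" "a p = e \<and> S j = e \<or> a p = - e \<and> S j = 0"
        using Qj unfolding Q_def by blast
      have "a (Suc j) = - a p"
      proof -
        have "a p \<noteq> 0" "p < Suc j" "p \<in> {1..N}" "Suc j \<in> {1..N}" using p e j by auto
        moreover have "\<forall>k\<in>{p<..<Suc j}. a k = 0" using p(2) by auto
        ultimately show ?thesis using * False by blast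
      qed
      thus ?thesis using p(3) unfolding Q_def by (intro bexI[of _ "Suc j"]) (auto simp: S)
    qed
    have zero_or: "(\<forall>k\<in>{1..j}. a k = 0) \<and> S j = 0 \<or> Q 1 j \<or> Q (-1) j" if "j \<le> N" for j
      using that
    proof (induction j)
      case (Suc j)
      show ?case
      proof (cases "(\<forall>k\<in>{1..j}. a k = 0) \<and> S j = 0")
        case True
        consider "a (Suc j) = 0" | "a (Suc j) = 1" | "a (Suc j) = -1" using * Suc.prems by fastforce
        thus ?thesis
        proof cases
          case 1
          thus ?thesis using True by (auto simp: S le_Suc_eq)
        next
          case 2
          hence "Q 1 (Suc j)" unfolding Q_def using True by (intro bexI[of _ "Suc j"]) (auto simp: S)
          thus ?thesis by simp
        next
          case 3
          hence "Q (-1) (Suc j)" unfolding Q_def using True by (intro bexI[of _ "Suc j"]) (auto simp: S)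
          thus ?thesis by simp
        qed
      next
        case False
        thus ?thesis using Suc persist[of 1 j] persist[of "-1" j] by auto
      qed
    qed (simp add: S0)
    have no: "\<not> Q (-1) j" if "j \<le> N" for j
    proof
      assume Qj: "Q (-1) j"
      have "i \<le> N \<Longrightarrow> Q (-1) i" if "j \<le> i" for i
        using that by (induction i rule: dec_induct) (use Qj persist in auto)
      hence "Q (-1) N" using that by simp
      thus False using total by (auto simp: Q_def)
    qed
    show ?sums
    proof (intro allI impI)
      fix j assume "j \<le> N"
      with zero_or[of j] no[of j] show "S j \<in> {0, 1}" by (auto simp: Q_def)
    qed
  next
    assume *: ?sums
    have Sj: "S j = 0 \<or> S j = 1" if "j \<le> N" for j using * that by auto
    have a: "a j = S j - S (j - 1)" if "1 \<le> j" for j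
      using that S[of "j - 1"] by simp
    have ?ent
    proof
      fix j assume "j \<in> {1..N}"
      thus "a j \<in> {-1, 0, 1}" using a[of j] Sj[of j] Sj[of "j - 1"] by auto
    qed
    moreover have ?alt
    proof (intro ballI impI)
      fix j j' assume j: "j \<in> {1..N}" "j' \<in> {1..N}" "j < j'" "a j \<noteq> 0" "a j' \<noteq> 0"
        "\<forall>k\<in>{j<..<j'}. a k = 0"
      have const: "i < j' \<Longrightarrow> S i = S j" if "j \<le> i" for i
        using that by (induction i rule: dec_induct) (use j in \<open>auto simp: S\<close>)
      have "S (j' - 1) = S j" using j(3) by (intro const) auto
      thus "a j' = - a j"
        using j a[of j] a[of j'] Sj[of j] Sj[of j'] Sj[of "j - 1"] by auto
    qed
    ultimately show "?ent \<and> ?alt" by blast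
  }
qed

section \<open>Sets of columns and their increasing enumerations\<close>

lemma down_closed_lessThan:
  assumes "finite S" "\<And>i j. j \<in> S \<Longrightarrow> i \<le> j \<Longrightarrow> i \<in> S"
  shows "S = {..<card S}"
proof -
  define m where "m = (LEAST i. i \<notin> S)"
  have "\<exists>i. i \<notin> S" using ex_new_if_finite[OF infinite_UNIV_nat assms(1)] .
  hence "m \<notin> S" unfolding m_def by (rule LeastI_ex)
  hence "i < m" if "i \<in> S" for i using assms(2)[OF that, of m] by (metis not_less)
  moreover have "i \<in> S" if "i < m" for i using not_less_Least[OF that[unfolded m_def]] by simp
  ultimately have "S = {..<m}" by auto
  thus ?thesis by simp
qed

definition strict_below :: "nat \<Rightarrow> (nat \<Rightarrow> nat) \<Rightarrow> bool" where
  "strict_below r k \<longleftrightarrow> (\<forall>i j. i < j \<longrightarrow> j < r \<longrightarrow> k i < k j)"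

lemma strict_below_eq: "strict_below r k \<longleftrightarrow> strict_mono_on {..<r} k"
  by (auto simp: strict_below_def strict_mono_on_def)

lemma strict_belowI:
  assumes "\<And>j. Suc j < r \<Longrightarrow> k j < k (Suc j)"
  shows "strict_below r k"
  unfolding strict_below_def
proof (intro allI impI)
  fix i j :: nat assume "i < j"
  thus "j < r \<Longrightarrow> k i < k j"
  proof (induction j)
    case (Suc j)
    thus ?case using assms[of j] by (cases "i = j") auto
  qed simp
qed

lemma strict_below_Suc: "strict_below r k \<Longrightarrow> Suc j < r \<Longrightarrow> k j < k (Suc j)"
  by (simp add: strict_below_def)

lemma strict_below_inj: "strict_below r k \<Longrightarrow> inj_on k {..<r}"
  unfolding strict_below_eq by (rule strict_mono_on_imp_inj_on)

lemma strict_below_interlacing: "l \<in> interlacing k r \<Longrightarrow> strict_below r l"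
  by (rule strict_belowI) (simp add: interlacing_def)

lemma sorted_list_of_image:
  assumes "strict_below r k"
  shows "sorted_list_of_set (k ` {..<r}) = map k [0..<r]"
proof -
  have "sorted (map k [0..<r])"
    using assms by (force simp: sorted_iff_nth_mono_less strict_below_def intro: less_imp_le)
  moreover have "distinct (map k [0..<r])"
    using strict_below_inj[OF assms] by (simp add: distinct_map atLeast0LessThan)
  ultimately have "sorted_list_of_set (set (map k [0..<r])) = map k [0..<r]"
    by (rule sorted_list_of_set.idem_if_sorted_distinct)
  thus ?thesis by (simp add: atLeast0LessThan)
qed

lemma nth_sorted_list_strict:
  assumes "finite K" "card K = r"
  shows "strict_below r ((!) (sorted_list_of_set K))" "(!) (sorted_list_of_set K) ` {..<r} = K"
proof -
  show "strict_below r ((!) (sorted_list_of_set K))"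
    using sorted_wrt_nth_less[OF strict_sorted_list_of_set[of K]] assms
    by (auto simp: strict_below_def)
  show "(!) (sorted_list_of_set K) ` {..<r} = K"
    using nth_image[of r "sorted_list_of_set K"] assms by (simp add: atLeast0LessThan)
qed

lemma card_below:
  assumes "strict_below m k" "k ` {..<m} \<subseteq> {1..N}" "j < m"
  shows "j < card (k ` {..<m} \<inter> {1..t}) \<longleftrightarrow> k j \<le> t"
proof -
  let ?I = "{i. i < m \<and> k i \<le> t}"
  have "k ` {..<m} \<inter> {1..t} = k ` ?I" using assms(2) by auto
  moreover have "inj_on k ?I" by (rule inj_on_subset[OF strict_below_inj[OF assms(1)]]) auto
  ultimately have c: "card (k ` {..<m} \<inter> {1..t}) = card ?I" by (simp add: card_image)
  have mono: "k i' \<le> k i" if "i' \<le> i" "i < m" for i i'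
    using assms(1) that by (cases "i' = i") (auto simp: strict_below_def less_imp_le)
  have "?I = {..<card ?I}"
    by (rule down_closed_lessThan) (auto intro: le_trans mono)
  hence "j < card ?I \<longleftrightarrow> j \<in> ?I" by blast
  thus ?thesis unfolding c using assms(3) by simp
qed

text \<open>A matrix row is the difference of the indicators of two consecutive column sets, so its
  partial sums are differences of counting functions. The claim turns the condition on these sums
  into the interlacing of triangle rows.\<close>

lemma interlacing_iff_counts:
  assumes k: "strict_below (Suc r) k" "k ` {..<Suc r} \<subseteq> {1..N}"
    and l: "strict_below r l" "l ` {..<r} \<subseteq> {1..N}"
  shows "(\<forall>t\<le>N. int (card (k ` {..<Suc r} \<inter> {1..t})) - int (card (l ` {..<r} \<inter> {1..t})) \<in> {0, 1})
    \<longleftrightarrow> (\<forall>j<r. k j \<le> l j \<and> l j \<le> k (Suc j))" (is "?counts \<longleftrightarrow> ?il")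
proof -
  define a where "a = (\<lambda>t. card (k ` {..<Suc r} \<inter> {1..t}))"
  define b where "b = (\<lambda>t. card (l ` {..<r} \<inter> {1..t}))"
  have a: "j < a t \<longleftrightarrow> k j \<le> t" if "j < Suc r" for j t
    unfolding a_def by (rule card_below[OF k that])
  have b: "j < b t \<longleftrightarrow> l j \<le> t" if "j < r" for j t
    unfolding b_def by (rule card_below[OF l that])
  have a_le: "a t \<le> Suc r" for t
    unfolding a_def by (rule order.trans[OF card_mono card_image_le[of "{..<Suc r}" k, simplified]]) auto
  have b_le: "b t \<le> r" for t
    unfolding b_def by (rule order.trans[OF card_mono card_image_le[of "{..<r}" l, simplified]]) auto
  have elem: "int m - int n \<in> {0, 1} \<longleftrightarrow> n \<le> m \<and> m \<le> Suc n" for m n by auto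
  have "?counts \<longleftrightarrow> (\<forall>t\<le>N. b t \<le> a t \<and> a t \<le> Suc (b t))"
    by (simp only: a_def b_def elem)
  also have "\<dots> \<longleftrightarrow> ?il"
  proof
    assume *: "\<forall>t\<le>N. b t \<le> a t \<and> a t \<le> Suc (b t)"
    show ?il
    proof (intro allI impI conjI)
      fix j assume j: "j < r"
      have "l j \<in> {1..N}" using l(2) j by auto
      moreover have "k (Suc j) \<in> {1..N}" by (rule subsetD[OF k(2)]) (use j in simp)
      ultimately have "l j \<le> N" "k (Suc j) \<le> N" by auto
      hence 1: "b (l j) \<le> a (l j)" and 2: "a (k (Suc j)) \<le> Suc (b (k (Suc j)))" using * by auto
      show "k j \<le> l j" using 1 a[of j "l j"] b[of j "l j"] j by simp
      show "l j \<le> k (Suc j)" using 2 a[of "Suc j" "k (Suc j)"] b[of j "k (Suc j)"] j by simp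
    qed
  next
    assume il: ?il
    show "\<forall>t\<le>N. b t \<le> a t \<and> a t \<le> Suc (b t)"
    proof (intro allI impI conjI)
      fix t
      show "b t \<le> a t"
      proof (cases "b t")
        case (Suc m)
        hence m: "m < r" using b_le[of t] by simp
        hence "l m \<le> t" using b[of m t] Suc by simp
        hence "k m \<le> t" using il m by (meson le_trans)
        thus ?thesis using a[of m t] m Suc by simp
      qed simp
      show "a t \<le> Suc (b t)"
      proof (rule ccontr)
        assume "\<not> a t \<le> Suc (b t)"
        hence lt: "Suc (b t) < a t" by simp
        hence m: "b t < r" using a_le[of t] by simp
        hence "k (Suc (b t)) \<le> t" using a[of "Suc (b t)" t] lt by simp
        hence "l (b t) \<le> t" using il m by (meson le_trans)
        thus False using b[of "b t" t] m by simp
      qed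
    qed
  qed
  finally show ?thesis .
qed

definition column_sum :: "(nat \<Rightarrow> nat \<Rightarrow> int) \<Rightarrow> nat \<Rightarrow> nat \<Rightarrow> int" where
  "column_sum A i j = (\<Sum>i'=1..i. A i' j)"

text \<open>The first \<open>r\<close> rows of an alternating sign matrix, described by partial sums; \<open>k\<close> is row \<open>r\<close> of
  the monotone triangle.\<close>

definition partial_ASM :: "nat \<Rightarrow> nat \<Rightarrow> (nat \<Rightarrow> nat) \<Rightarrow> (nat \<Rightarrow> nat \<Rightarrow> int) set" where
  "partial_ASM N r k = {A.
     (\<forall>i j. i \<notin> {1..r} \<or> j \<notin> {1..N} \<longrightarrow> A i j = 0) \<and>
     (\<forall>i\<in>{1..r}. (\<forall>t\<le>N. (\<Sum>j=1..t. A i j) \<in> {0, 1}) \<and> (\<Sum>j=1..N. A i j) = 1) \<and>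
     (\<forall>j\<in>{1..N}. \<forall>i\<le>r. column_sum A i j \<in> {0, 1}) \<and>
     (\<forall>j\<in>{1..N}. column_sum A r j = (if j \<in> k ` {..<r} then 1 else 0))}"

text \<open>The bottom row \<open>1, ..., n\<close> of the triangle encodes that all column sums are
  1; it is \<open>Suc\<close> because positions start at 0.\<close>

lemma ASM_eq_partial: "ASM n = partial_ASM n n Suc"
proof -
  have im: "Suc ` {..<n} = {1..n}" by (auto simp: image_Suc_lessThan)
  show ?thesis
  proof (intro equalityI subsetI)
    fix A assume "A \<in> ASM n"
    note A = this[unfolded ASM_def mem_Collect_eq]
    have "\<forall>t\<le>n. (\<Sum>j=1..t. A i j) \<in> {0, 1}" if "i \<in> {1..n}" for i
      by (rule iffD1[OF alternating_partial_sums[where a = "A i"]]) (use A that in auto)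
    moreover have "\<forall>t\<le>n. (\<Sum>i=1..t. A i j) \<in> {0, 1}" if "j \<in> {1..n}" for j
      by (rule iffD1[OF alternating_partial_sums[where N = n and a = "\<lambda>i. A i j"]]) (use A that in auto)
    ultimately show "A \<in> partial_ASM n n Suc"
      using A by (auto simp: partial_ASM_def column_sum_def im)
  next
    fix A assume "A \<in> partial_ASM n n Suc"
    note A = this[unfolded partial_ASM_def mem_Collect_eq column_sum_def im]
    have r: "(\<forall>j\<in>{1..n}. A i j \<in> {-1, 0, 1}) \<and>
      (\<forall>j\<in>{1..n}. \<forall>j'\<in>{1..n}. j < j' \<longrightarrow> A i j \<noteq> 0 \<longrightarrow> A i j' \<noteq> 0 \<longrightarrow>
        (\<forall>k\<in>{j<..<j'}. A i k = 0) \<longrightarrow> A i j' = - A i j)" if "i \<in> {1..n}" for i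
      by (rule iffD2[OF alternating_partial_sums[where N = n and a = "A i"]]) (use A that in auto)
    have c: "(\<forall>i\<in>{1..n}. A i j \<in> {-1, 0, 1}) \<and>
      (\<forall>i\<in>{1..n}. \<forall>i'\<in>{1..n}. i < i' \<longrightarrow> A i j \<noteq> 0 \<longrightarrow> A i' j \<noteq> 0 \<longrightarrow>
        (\<forall>k\<in>{i<..<i'}. A k j = 0) \<longrightarrow> A i' j = - A i j)" if "j \<in> {1..n}" for j
      by (rule iffD2[OF alternating_partial_sums[where N = n and a = "\<lambda>i. A i j"]]) (use A that in auto)
    have s: "(\<Sum>i=1..n. A i j) = 1" if "j \<in> {1..n}" for j using A that by simp
    show "A \<in> ASM n"
      unfolding ASM_def
    proof (intro CollectI conjI)
      show "\<forall>i j. i \<notin> {1..n} \<or> j \<notin> {1..n} \<longrightarrow> A i j = 0" using A by blast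
      show "\<forall>i\<in>{1..n}. \<forall>j\<in>{1..n}. A i j \<in> {-1, 0, 1}"
        by (rule ballI, rule conjunct1[OF r])
      show "\<forall>i\<in>{1..n}. (\<Sum>j=1..n. A i j) = 1" using A by blast
      show "\<forall>j\<in>{1..n}. (\<Sum>i=1..n. A i j) = 1" by (rule ballI, rule s)
    qed (rule ballI, rule conjunct2[OF r] conjunct2[OF c], assumption)+
  qed
qed

lemma finite_partial_ASM: "finite (partial_ASM N r k)"
proof (rule finite_subset)
  let ?D = "{1..r} \<times> {1..N}"
  let ?F = "{f. \<forall>c. (c \<in> ?D \<longrightarrow> f c \<in> {-1..1::int}) \<and> (c \<notin> ?D \<longrightarrow> f c = 0)}"
  show "partial_ASM N r k \<subseteq> (\<lambda>f i j. f (i, j)) ` ?F"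
  proof
    fix A assume "A \<in> partial_ASM N r k"
    note A = this[unfolded partial_ASM_def mem_Collect_eq]
    have "A i j \<in> {-1..1}" if "i \<in> {1..r}" "j \<in> {1..N}" for i j
    proof -
      have "\<forall>t\<le>N. (\<Sum>k=1..t. A i k) \<in> {0, 1}" using A that(1) by blast
      moreover have "j \<le> N" "j - 1 \<le> N" using that(2) by auto
      ultimately have "(\<Sum>k=1..j. A i k) \<in> {0, 1}" "(\<Sum>k=1..j - 1. A i k) \<in> {0, 1}"
        by blast+
      moreover have "(\<Sum>k=1..j. A i k) = (\<Sum>k=1..j - 1. A i k) + A i j"
        using that by (cases j) auto
      ultimately show ?thesis by auto
    qed
    thus "A \<in> (\<lambda>f i j. f (i, j)) ` ?F"
      using A by (intro image_eqI[of _ _ "\<lambda>(i, j). A i j"]) auto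
  qed
  show "finite ((\<lambda>f i j. f (i, j)) ` ?F)"
    by (intro finite_imageI finite_set_of_finite_funs) auto
qed

lemma interlacing_image:
  assumes "l \<in> interlacing k r" "strict_below (Suc r) k" "k ` {..<Suc r} \<subseteq> {1..N}"
  shows "l ` {..<r} \<subseteq> {1..N}"
proof clarify
  fix j assume j: "j < r"
  have "k j \<in> {1..N}" "k (Suc j) \<in> {1..N}"
    by (rule subsetD[OF assms(3)]; use j in simp)+
  moreover have "k j \<le> l j" "l j \<le> k (Suc j)" using assms(1) j by (auto simp: interlacing_def)
  ultimately show "l j \<in> {1..N}" by auto
qed

lemma column_sum_upd: "i \<le> r \<Longrightarrow> column_sum (A(Suc r := d)) i j = column_sum A i j"
  by (auto simp: column_sum_def intro!: sum.cong)

lemma column_sum_Suc: "column_sum A (Suc r) j = column_sum A r j + A (Suc r) j"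
  by (simp add: column_sum_def)

lemma sum_indicator_diff:
  fixes K L :: "nat set"
  assumes "finite K" "finite L"
  shows "(\<Sum>j=1..t. (if j \<in> K then 1 else 0) - (if j \<in> L then 1 else 0) :: int)
    = int (card (K \<inter> {1..t})) - int (card (L \<inter> {1..t}))"
proof -
  have "(\<Sum>j=1..t. if j \<in> K then 1 else 0 :: int) = int (card (K \<inter> {1..t}))" for K :: "nat set"
    by (simp add: sum.If_cases Int_commute)
  thus ?thesis by (simp add: sum_subtractf)
qed

lemma partial_ASM_extend:
  assumes k: "strict_below (Suc r) k" "k ` {..<Suc r} \<subseteq> {1..N}"
    and l: "l \<in> interlacing k r" and A: "A \<in> partial_ASM N r l"
  shows "A(Suc r := \<lambda>j. (if j \<in> k ` {..<Suc r} then 1 else 0) - (if j \<in> l ` {..<r} then 1 else 0)) \<in> partial_ASM N (Suc r) k"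
proof -
  define D where "D = (\<lambda>l j. (if j \<in> k ` {..<Suc r} then 1 else 0) - (if j \<in> l ` {..<r} then 1 else 0) :: int)"
  note A' = A[unfolded partial_ASM_def mem_Collect_eq]
  note st = strict_below_interlacing[OF l]
  note sub = interlacing_image[OF l k]
  have sumD: "(\<Sum>j=1..t. D l j) = int (card (k ` {..<Suc r} \<inter> {1..t})) - int (card (l ` {..<r} \<inter> {1..t}))" for l t
    unfolding D_def by (rule sum_indicator_diff) simp_all
  have il: "\<forall>t\<le>N. (\<Sum>j=1..t. D l j) \<in> {0, 1}"
    using l by (subst sumD, subst interlacing_iff_counts[OF k st sub]) (simp add: interlacing_def)
  have col: "column_sum A r j = (if j \<in> l ` {..<r} then 1 else 0)" if "j \<in> {1..N}" for j
    using A' that by blast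
  have "A(Suc r := D l) \<in> partial_ASM N (Suc r) k"
    unfolding partial_ASM_def mem_Collect_eq
proof (intro conjI allI ballI impI)
  fix i j assume ij: "i \<notin> {1..Suc r} \<or> j \<notin> {1..N}"
  show "(A(Suc r := D l)) i j = 0"
  proof (cases "i = Suc r")
    case True
    hence "j \<notin> k ` {..<Suc r}" "j \<notin> l ` {..<r}" using ij k(2) sub by auto
    thus ?thesis using True by (simp add: D_def)
  next
    case False
    thus ?thesis using A' ij by auto
  qed
next
  fix i t assume "i \<in> {1..Suc r}" "t \<le> N"
  thus "(\<Sum>j=1..t. (A(Suc r := D l)) i j) \<in> {0, 1}"
    using A' il by (cases "i = Suc r") auto
next
  fix i assume i: "i \<in> {1..Suc r}"
  have "card (k ` {..<Suc r} \<inter> {1..N}) = Suc r"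
    using card_image[OF strict_below_inj[OF k(1)]] k(2) by (simp add: Int_absorb2 del: image_Suc_lessThan)
  moreover have "card (l ` {..<r} \<inter> {1..N}) = r"
    using card_image[OF strict_below_inj[OF st]] sub by (simp add: Int_absorb2)
  ultimately have "(\<Sum>j=1..N. D l j) = 1" by (simp only: sumD)
  thus "(\<Sum>j=1..N. (A(Suc r := D l)) i j) = 1"
    using A' i by (cases "i = Suc r") auto
next
  fix j i assume ji: "j \<in> {1..N}" "i \<le> Suc r"
  show "column_sum (A(Suc r := D l)) i j \<in> {0, 1}"
  proof (cases "i = Suc r")
    case True
    thus ?thesis using col[OF ji(1)] by (simp add: column_sum_Suc column_sum_upd D_def)
  next
    case False
    hence "i \<le> r" using ji by simp
    moreover have "column_sum A i j \<in> {0, 1}" using A' ji(1) \<open>i \<le> r\<close> by blast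
    ultimately show ?thesis by (simp only: column_sum_upd)
  qed
next
  fix j assume j: "j \<in> {1..N}"
  show "column_sum (A(Suc r := D l)) (Suc r) j = (if j \<in> k ` {..<Suc r} then 1 else 0)"
    using col[OF j] by (simp add: column_sum_Suc column_sum_upd D_def)
qed
  thus ?thesis by (simp only: D_def)
qed

text \<open>The last matrix row is determined by the last two triangle rows, so deleting it while
  recording the previous triangle row \<open>l\<close> loses nothing.\<close>

lemma sum_partial_ASM_Suc:
  fixes G :: "(nat \<Rightarrow> nat \<Rightarrow> int) \<Rightarrow> 'a::comm_monoid_add"
  assumes k: "strict_below (Suc r) k" "k ` {..<Suc r} \<subseteq> {1..N}"
  defines "D \<equiv> \<lambda>l j. (if j \<in> k ` {..<Suc r} then 1 else 0) - (if j \<in> l ` {..<r} then 1 else 0) :: int"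
  shows "(\<Sum>A\<in>partial_ASM N (Suc r) k. G A)
    = (\<Sum>l\<in>interlacing k r. \<Sum>A\<in>partial_ASM N r l. G (A(Suc r := D l)))"
proof -
  define R where "R = (\<lambda>A. {c \<in> {1..N}. column_sum A r c = 1})"
  define en where "en = (\<lambda>A j. if j < r then sorted_list_of_set (R A) ! j else 0)"
  have sumD: "(\<Sum>j=1..t. D l j) = int (card (k ` {..<Suc r} \<inter> {1..t})) - int (card (l ` {..<r} \<inter> {1..t}))" for l t
    unfolding D_def by (rule sum_indicator_diff) simp_all
  have il: "(\<forall>t\<le>N. (\<Sum>j=1..t. D l j) \<in> {0, 1}) \<longleftrightarrow> (\<forall>j<r. k j \<le> l j \<and> l j \<le> k (Suc j))"
    if "strict_below r l" "l ` {..<r} \<subseteq> {1..N}" for l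
    unfolding sumD by (rule interlacing_iff_counts[OF k that])
  have fwd: "en A \<in> interlacing k r \<and> A(Suc r := \<lambda>_. 0) \<in> partial_ASM N r (en A) \<and> A (Suc r) = D (en A)"
    if A: "A \<in> partial_ASM N (Suc r) k" for A
  proof -
    note A' = A[unfolded partial_ASM_def mem_Collect_eq]
    have c01: "column_sum A i j \<in> {0, 1}" if "i \<le> Suc r" "j \<in> {1..N}" for i j using A' that by blast
    have rows: "(\<Sum>j=1..N. A i j) = 1" "\<forall>t\<le>N. (\<Sum>j=1..t. A i j) \<in> {0, 1}" if "i \<in> {1..Suc r}" for i
      using A' that by blast+
    \<comment> \<open>The first \<open>r\<close> rows have sum 1 each, so their column sums add up
      to \<open>r\<close>; being 0 or 1, exactly \<open>r\<close> of them are 1.\<close>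
    have "int (card (R A)) = (\<Sum>j=1..N. if column_sum A r j = 1 then 1 else 0)"
      by (simp add: R_def sum.If_cases Int_def)
    also have "\<dots> = (\<Sum>j=1..N. column_sum A r j)"
      by (rule sum.cong) (use c01[of r] in auto)
    also have "\<dots> = (\<Sum>i=1..r. \<Sum>j=1..N. A i j)"
      unfolding column_sum_def by (rule sum.swap)
    also have "\<dots> = (\<Sum>i=1..r. 1)" by (rule sum.cong) (use rows in auto)
    finally have card: "card (R A) = r" by simp
    have fin: "finite (R A)" by (simp add: R_def)
    have en: "strict_below r (en A)" "en A ` {..<r} = R A"
      using nth_sorted_list_strict[OF fin card] by (auto simp: en_def strict_below_def image_def)
    have sub: "en A ` {..<r} \<subseteq> {1..N}" unfolding en(2) by (auto simp: R_def)
    have D: "A (Suc r) j = D (en A) j" for j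
    proof (cases "j \<in> {1..N}")
      case True
      have "column_sum A (Suc r) j = (if j \<in> k ` {..<Suc r} then 1 else 0)" using A' True by blast
      moreover have "column_sum A r j = (if j \<in> R A then 1 else 0)"
        using c01[of r j] True by (auto simp: R_def)
      ultimately show ?thesis using column_sum_Suc[of A r j] by (simp only: D_def en(2))
    next
      case False
      hence "A (Suc r) j = 0" "j \<notin> k ` {..<Suc r}" "j \<notin> en A ` {..<r}"
        using A' k(2) sub by blast+
      thus ?thesis by (simp only: D_def if_False)
    qed
    have "\<forall>t\<le>N. (\<Sum>j=1..t. D (en A) j) \<in> {0, 1}" using rows(2)[of "Suc r"] by (simp add: D)
    hence "en A \<in> interlacing k r"
      using il[OF en(1) sub] strict_below_Suc[OF en(1)] by (auto simp: interlacing_def en_def)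
    moreover have "A(Suc r := \<lambda>_. 0) \<in> partial_ASM N r (en A)"
      unfolding partial_ASM_def mem_Collect_eq
    proof (intro conjI allI ballI impI)
      fix i j assume "i \<notin> {1..r} \<or> j \<notin> {1..N}"
      thus "(A(Suc r := \<lambda>_. 0)) i j = 0" using A' by (auto simp: le_Suc_eq)
    next
      fix i t assume "i \<in> {1..r}" "t \<le> N"
      thus "(\<Sum>j=1..t. (A(Suc r := \<lambda>_. 0)) i j) \<in> {0, 1}" using rows(2)[of i] by simp
    next
      fix i assume "i \<in> {1..r}"
      thus "(\<Sum>j=1..N. (A(Suc r := \<lambda>_. 0)) i j) = 1" using rows(1)[of i] by simp
    next
      fix j i assume "j \<in> {1..N}" "i \<le> r"
      thus "column_sum (A(Suc r := \<lambda>_. 0)) i j \<in> {0, 1}" using c01[of i j] by (simp only: column_sum_upd le_SucI)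
    next
      fix j assume "j \<in> {1..N}"
      thus "column_sum (A(Suc r := \<lambda>_. 0)) r j = (if j \<in> en A ` {..<r} then 1 else 0)"
        using c01[of r j] by (auto simp: column_sum_upd en(2) R_def)
    qed
    ultimately show ?thesis using D by auto
  qed
  have bwd: "A(Suc r := D l) \<in> partial_ASM N (Suc r) k \<and> en (A(Suc r := D l)) = l \<and> A (Suc r) = (\<lambda>_. 0)"
    if l: "l \<in> interlacing k r" and A: "A \<in> partial_ASM N r l" for l A
  proof -
    note A' = A[unfolded partial_ASM_def mem_Collect_eq]
    note st = strict_below_interlacing[OF l]
    note sub = interlacing_image[OF l k]
    have col: "column_sum A r j = (if j \<in> l ` {..<r} then 1 else 0)" if "j \<in> {1..N}" for j
      using A' that by blast
    have "R (A(Suc r := D l)) = l ` {..<r}"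
      using col sub by (auto simp: R_def column_sum_upd split: if_splits)
    hence "en (A(Suc r := D l)) = l"
      using l by (auto simp: en_def sorted_list_of_image[OF st] interlacing_def fun_eq_iff)
    moreover have "A(Suc r := D l) \<in> partial_ASM N (Suc r) k"
      unfolding D_def by (rule partial_ASM_extend[OF k l A])
    moreover have "A (Suc r) = (\<lambda>_. 0)" using A' by auto
    ultimately show ?thesis by blast
  qed
  have "(\<Sum>A\<in>partial_ASM N (Suc r) k. G A)
    = (\<Sum>(l, A)\<in>(SIGMA l:interlacing k r. partial_ASM N r l). G (A(Suc r := D l)))"
  proof (rule sum.reindex_bij_witness[where i = "\<lambda>(l, A). A(Suc r := D l)" and j = "\<lambda>A. (en A, A(Suc r := \<lambda>_. 0))"], goal_cases)
    case (1 A)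
    thus ?case using fwd[OF 1] by (auto simp: fun_eq_iff)
  next
    case (2 A)
    thus ?case using fwd[OF 2] by auto
  next
    case (3 y)
    thus ?case using bwd by (auto simp: fun_eq_iff)
  next
    case (4 y)
    thus ?case using bwd by auto
  next
    case (5 A)
    have "A(Suc r := D (en A)) = A" using fwd[OF 5] by auto
    thus ?case by simp
  qed
  also have "\<dots> = (\<Sum>l\<in>interlacing k r. \<Sum>A\<in>partial_ASM N r l. G (A(Suc r := D l)))"
    by (rule sum.Sigma[symmetric]) (auto intro: finite_interlacing finite_partial_ASM)
  finally show ?thesis .
qed

text \<open>The leading \<open>X\<close> compensates the \<open>- 1\<close> in \<open>d_hat\<close>,
  as the normalization of \<open>triangle_sum\<close> requires. The index \<open>r\<close> is that
  of the upper of the two rows compared, while \<open>X\<close> belongs to the lower one.\<close>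

definition row_weight :: "'a::field \<Rightarrow> 'a \<Rightarrow> 'a \<Rightarrow> 'a \<Rightarrow> (nat \<Rightarrow> nat \<Rightarrow> nat) \<Rightarrow> nat \<Rightarrow> 'a" where
  "row_weight u v w X M r = X * (u ^ right_count M r * v ^ left_count M r
     * (X powi d_hat M (Suc r) * (u * X + w + v * inverse X) ^ special_count M r))"

lemma row_weight_cong:
  "M r = M' r \<Longrightarrow> M (Suc r) = M' (Suc r) \<Longrightarrow> row_weight u v w X M r = row_weight u v w X M' r"
  by (simp add: row_weight_def d_hat_def right_count_def left_count_def special_count_def)

lemma card_shift:
  fixes P :: "nat \<Rightarrow> bool"
  shows "card {j \<in> {1..r}. P (j - 1)} = card {j. j < r \<and> P j}"
proof -
  have "{j \<in> {1..r}. P (j - 1)} = Suc ` {j. j < r \<and> P j}"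
  proof (intro equalityI subsetI)
    fix j assume "j \<in> {j \<in> {1..r}. P (j - 1)}"
    thus "j \<in> Suc ` {j. j < r \<and> P j}" by (cases j) auto
  qed auto
  thus ?thesis by (simp add: card_image)
qed

text \<open>Since \<open>k\<close> is strict, no entry leans both ways; the sets \<open>L\<close>,
  \<open>R\<close> and \<open>S\<close> partition the positions, and the counts become products over
  them.\<close>

lemma row_weight_eq:
  assumes X: "X \<noteq> 0" and k: "strict_below (Suc r) k" and l: "l \<in> interlacing k r"
    and M: "\<And>j. j \<in> {1..Suc r} \<Longrightarrow> M (Suc r) j = k (j - 1)" "\<And>j. j \<in> {1..r} \<Longrightarrow> M r j = l (j - 1)"
  shows "row_weight u v w X M r
    = X ^ (\<Sum>j\<le>r. k j) * (\<Prod>j<r. entry_weight u v w X (k j) (k (Suc j)) (l j) / X ^ l j)"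
proof -
  let ?e = "\<lambda>j. entry_weight u v w X (k j) (k (Suc j)) (l j)"
  define L where "L = {j. j < r \<and> l j = k j}"
  define R where "R = {j. j < r \<and> l j = k (Suc j)}"
  define S where "S = {j. j < r \<and> k j < l j \<and> l j < k (Suc j)}"
  have il: "k j \<le> l j" "l j \<le> k (Suc j)" "k j < k (Suc j)" if "j < r" for j
    using l k that by (auto simp: interlacing_def strict_below_def)
  have "left_count M r = card {j \<in> {1..r}. l (j - 1) = k (j - 1)}"
    unfolding left_count_def by (rule arg_cong[where f = card]) (use M in auto)
  hence cL: "left_count M r = card L"
    using card_shift[of r "\<lambda>j. l j = k j"] by (simp add: L_def)
  have "right_count M r = card {j \<in> {1..r}. l (j - 1) = k (Suc (j - 1))}"
    unfolding right_count_def by (rule arg_cong[where f = card]) (use M in auto)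
  hence cR: "right_count M r = card R"
    using card_shift[of r "\<lambda>j. l j = k (Suc j)"] by (simp add: R_def)
  have "special_count M r = card {j \<in> {1..r}. k (j - 1) < l (j - 1) \<and> l (j - 1) < k (Suc (j - 1))}"
    unfolding special_count_def by (rule arg_cong[where f = card]) (use M in auto)
  hence cS: "special_count M r = card S"
    using card_shift[of r "\<lambda>j. k j < l j \<and> l j < k (Suc j)"] by (simp add: S_def)
  have sk: "(\<Sum>j=1..Suc r. int (M (Suc r) j)) = int (\<Sum>j\<le>r. k j)"
  proof -
    have "(\<Sum>j=1..Suc r. int (M (Suc r) j)) = (\<Sum>j=1..Suc r. int (k (j - 1)))"
      by (rule sum.cong) (use M(1) in auto)
    also have "\<dots> = (\<Sum>j\<le>r. int (k j))"
      by (rule sum.reindex_bij_witness[where i = Suc and j = "\<lambda>j. j - 1"]) auto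
    finally show ?thesis by simp
  qed
  have sl: "(\<Sum>j=1..r. int (M r j)) = int (\<Sum>j<r. l j)"
  proof -
    have "(\<Sum>j=1..r. int (M r j)) = (\<Sum>j=1..r. int (l (j - 1)))"
      by (rule sum.cong) (use M(2) in auto)
    also have "\<dots> = (\<Sum>j<r. int (l j))"
      by (rule sum.reindex_bij_witness[where i = Suc and j = "\<lambda>j. j - 1"]) auto
    finally show ?thesis by simp
  qed
  have d: "d_hat M (Suc r) = int (\<Sum>j\<le>r. k j) - int (\<Sum>j<r. l j) + int (card R) - int (card L) - 1"
    using sk sl cL cR by (simp only: d_hat_def diff_Suc_1)
  have "(\<Prod>j<r. entry_weight u v w X (k j) (k (Suc j)) (l j))
    = (\<Prod>j\<in>L. v / X) * (\<Prod>j\<in>R. u * X) * (\<Prod>j\<in>S. u * X + w + v / X)"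
  proof -
    have un: "{..<r} = L \<union> R \<union> S" using il by (force simp: L_def R_def S_def)
    have fin: "finite L" "finite R" "finite S" by (simp_all add: L_def R_def S_def)
    have disj: "L \<inter> R = {}" "(L \<union> R) \<inter> S = {}" using il(3) by (force simp: L_def R_def S_def)+
    have "(\<Prod>j<r. ?e j) = (\<Prod>j\<in>L. ?e j) * (\<Prod>j\<in>R. ?e j) * (\<Prod>j\<in>S. ?e j)"
      unfolding un using fin disj by (simp add: prod.union_disjoint)
    also have "(\<Prod>j\<in>L. ?e j) = (\<Prod>j\<in>L. v / X)"
      by (rule prod.cong) (auto simp: L_def entry_weight_def)
    also have "(\<Prod>j\<in>R. ?e j) = (\<Prod>j\<in>R. u * X)"
    proof (rule prod.cong[OF refl])
      fix j assume "j \<in> R"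
      thus "?e j = u * X" using il(3)[of j] by (simp add: R_def entry_weight_def)
    qed
    also have "(\<Prod>j\<in>S. ?e j) = (\<Prod>j\<in>S. u * X + w + v / X)"
      by (rule prod.cong) (auto simp: S_def entry_weight_def)
    finally show ?thesis .
  qed
  hence e: "(\<Prod>j<r. ?e j / X ^ l j)
    = (v / X) ^ card L * (u * X) ^ card R * (u * X + w + v / X) ^ card S / X ^ (\<Sum>j<r. l j)"
    by (simp add: prod_dividef power_sum)
  have "X powi (int a - int b + int c - int d - 1) = X ^ a * X ^ c / (X ^ b * X ^ d * X)" for a b c d
    using X by (simp add: power_int_diff power_int_add power_int_of_nat field_simps)
  hence pd: "X powi d_hat M (Suc r) = X ^ (\<Sum>j\<le>r. k j) * X ^ card R / (X ^ (\<Sum>j<r. l j) * X ^ card L * X)"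
    unfolding d .
  have s: "u * X + w + v * inverse X = u * X + w + v / X" by (simp add: divide_inverse)
  have gen: "X * (p * q * (a * c / (b * d * X) * s)) = a * (q / d * (p * c) * s / b)"
    if "b \<noteq> 0" "d \<noteq> 0" for p q a b c d s :: 'a
    using X that by (simp add: field_simps)
  show ?thesis
    unfolding row_weight_def e cL cR cS pd s power_mult_distrib power_divide
    by (rule gen) (use X in simp_all)
qed

lemma monotone_triangle_row:
  assumes "A \<in> partial_ASM N r k" "strict_below r k" "k ` {..<r} \<subseteq> {1..N}" "j \<in> {1..r}"
  shows "monotone_triangle N A r j = k (j - 1)"
proof -
  have "{c \<in> {1..N}. (\<Sum>i'=1..r. A i' c) = 1} = k ` {..<r}"
    using assms(1,3) by (auto simp: partial_ASM_def column_sum_def split: if_splits)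
  thus ?thesis using assms(4) by (auto simp: monotone_triangle_def sorted_list_of_image[OF assms(2)])
qed

lemma monotone_triangle_upd:
  assumes "i \<le> r"
  shows "monotone_triangle N (A(Suc r := d)) i = monotone_triangle N A i"
  using column_sum_upd[OF assms, of A d] by (simp add: monotone_triangle_def column_sum_def fun_eq_iff)

lemma partial_ASM_sum:
  assumes "strict_below r k" "k ` {..<r} \<subseteq> {1..N}" "\<And>i. i < r \<Longrightarrow> x i \<noteq> (0 :: 'a::field)"
  shows "(\<Sum>A\<in>partial_ASM N r k. \<Prod>i<r. row_weight u v w (x i) (monotone_triangle N A) i)
    = triangle_sum u v w x r k"
  using assms
proof (induction r arbitrary: k)
  case 0
  have "partial_ASM N 0 k = {\<lambda>_ _. 0}" by (auto simp: partial_ASM_def column_sum_def fun_eq_iff)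
  thus ?case by simp
next
  case (Suc r)
  define D where "D = (\<lambda>l j. (if j \<in> k ` {..<Suc r} then 1 else 0) - (if j \<in> l ` {..<r} then 1 else 0) :: int)"
  let ?W = "\<lambda>A i. row_weight u v w (x i) (monotone_triangle N A) i"
  let ?E = "\<lambda>l. x r ^ (\<Sum>j\<le>r. k j)
    * (\<Prod>j<r. entry_weight u v w (x r) (k j) (k (Suc j)) (l j) / x r ^ l j)"
  have "(\<Sum>A\<in>partial_ASM N (Suc r) k. \<Prod>i<Suc r. ?W A i)
    = (\<Sum>l\<in>interlacing k r. \<Sum>A\<in>partial_ASM N r l. \<Prod>i<Suc r. ?W (A(Suc r := D l)) i)"
    unfolding D_def by (rule sum_partial_ASM_Suc[OF Suc.prems(1,2)])
  also have "\<dots> = (\<Sum>l\<in>interlacing k r. \<Sum>A\<in>partial_ASM N r l.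
      ?E l
      * (\<Prod>i<r. ?W A i))"
  proof (intro sum.cong refl)
    fix l A assume l: "l \<in> interlacing k r" and A: "A \<in> partial_ASM N r l"
    let ?A = "A(Suc r := D l)"
    note st = strict_below_interlacing[OF l]
    note sub = interlacing_image[OF l Suc.prems(1,2)]
    have A': "?A \<in> partial_ASM N (Suc r) k"
      unfolding D_def by (rule partial_ASM_extend[OF Suc.prems(1,2) l A])
    have "?W ?A i = ?W A i" if "i < r" for i
      by (rule row_weight_cong) (use that in \<open>auto intro!: monotone_triangle_upd\<close>)
    moreover have "?W ?A r = ?E l"
    proof (rule row_weight_eq[OF _ Suc.prems(1) l])
      show "x r \<noteq> 0" using Suc.prems(3) by simp
      show "monotone_triangle N ?A (Suc r) j = k (j - 1)" if "j \<in> {1..Suc r}" for j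
        by (rule monotone_triangle_row[OF A' Suc.prems(1,2) that])
      show "monotone_triangle N ?A r j = l (j - 1)" if "j \<in> {1..r}" for j
        unfolding monotone_triangle_upd[OF le_refl] by (rule monotone_triangle_row[OF A st sub that])
    qed
    ultimately show "(\<Prod>i<Suc r. ?W ?A i)
      = ?E l
      * (\<Prod>i<r. ?W A i)"
      by (simp add: mult.commute)
  qed
  also have "\<dots> = (\<Sum>l\<in>interlacing k r. ?E l * triangle_sum u v w x r l)"
  proof (rule sum.cong[OF refl])
    fix l assume l: "l \<in> interlacing k r"
    have "(\<Sum>A\<in>partial_ASM N r l. \<Prod>i<r. ?W A i) = triangle_sum u v w x r l"
      by (rule Suc.IH) (use strict_below_interlacing[OF l] interlacing_image[OF l Suc.prems(1,2)] Suc.prems(3) in auto)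
    thus "(\<Sum>A\<in>partial_ASM N r l.
      ?E l
      * (\<Prod>i<r. ?W A i)) = ?E l * triangle_sum u v w x r l"
      by (simp flip: sum_distrib_left)
  qed
  finally show ?case by simp
qed

theorem ASM_triangle_sum:
  fixes x :: "nat \<Rightarrow> 'a::field"
  assumes "\<And>i. i < n \<Longrightarrow> x (Suc i) \<noteq> 0" "n \<ge> 1"
  shows "(\<Sum>A\<in>ASM n. asm_weight n u v w x A) * (\<Prod>i<n. x (Suc i)) = triangle_sum u v w (\<lambda>i. x (Suc i)) n Suc"
proof -
  have "asm_weight n u v w x A * (\<Prod>i<n. x (Suc i))
    = (\<Prod>i<n. row_weight u v w (x (Suc i)) (monotone_triangle n A) i)" for A
  proof -
    let ?M = "monotone_triangle n A"
    \<comment> \<open>Row 0 is empty and has count 0, so it can join the sums; each row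
      \<open>i < n\<close> is then paired with the variable of row \<open>i + 1\<close>.\<close>
    have shift: "(\<Sum>i=1..n-1. c i) = (\<Sum>i<n. c i)" if "c 0 = 0" for c :: "nat \<Rightarrow> nat"
    proof -
      have "{..<n} = insert 0 {1..n-1}" using assms(2) by auto
      thus ?thesis using that by simp
    qed
    have shift': "(\<Prod>i=1..n. f i) = (\<Prod>i<n. f (Suc i))" for f :: "nat \<Rightarrow> 'a"
      by (rule prod.reindex_bij_witness[where i = Suc and j = "\<lambda>j. j - 1"]) auto
    have "(\<Sum>i=1..n-1. right_count ?M i) = (\<Sum>i<n. right_count ?M i)"
      "(\<Sum>i=1..n-1. left_count ?M i) = (\<Sum>i<n. left_count ?M i)"
      by (rule shift; simp add: right_count_def left_count_def)+
    thus ?thesis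
      unfolding asm_weight_def Let_def shift' by (simp add: row_weight_def prod.distrib power_sum mult_ac)
  qed
  hence "(\<Sum>A\<in>ASM n. asm_weight n u v w x A) * (\<Prod>i<n. x (Suc i))
    = (\<Sum>A\<in>partial_ASM n n Suc. \<Prod>i<n. row_weight u v w (x (Suc i)) (monotone_triangle n A) i)"
    by (simp add: sum_distrib_right ASM_eq_partial)
  also have "\<dots> = triangle_sum u v w (\<lambda>i. x (Suc i)) n Suc"
    by (rule partial_ASM_sum) (use assms in \<open>auto simp: strict_below_def\<close>)
  finally show ?thesis .
qed

section \<open>Conjugation and Frobenius notation\<close>

lemma conjugate_iff:
  assumes "is_partition q" "1 \<le> i" "1 \<le> j"
  shows "i \<le> Defs.conjugate q j \<longleftrightarrow> j \<le> q i"
proof -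
  let ?S = "{i. 1 \<le> i \<and> j \<le> q i}"
  have fin: "finite ?S"
    by (rule finite_subset[of _ "{i. q i \<noteq> 0}"]) (use assms in \<open>auto simp: is_partition_def\<close>)
  have "?S = {1..card ?S}"
  proof (rule down_closed_nat[where N = "Max ?S"])
    show "?S \<subseteq> {1..Max ?S}" using fin by auto
    show "i \<in> ?S" if "1 \<le> i" "Suc i \<in> ?S" for i
      using that partition_antimono[OF assms(1), of i "Suc i"] by auto
  qed
  hence "i \<in> ?S \<longleftrightarrow> i \<in> {1..card ?S}" by (rule arg_cong)
  thus ?thesis using assms(2,3) by (simp add: Defs.conjugate_def)
qed

text \<open>Conjugate parts and Durfee sides are accessible through inequalities such as
  \<open>conjugate_iff\<close>, so equalities are proved by comparing lower bounds.\<close>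

lemma nat_eq_by_le: "(\<And>i. 1 \<le> i \<Longrightarrow> i \<le> a \<longleftrightarrow> i \<le> b) \<Longrightarrow> a = (b::nat)"
  by (metis le_antisym le_refl not_less_eq_eq zero_le One_nat_def Suc_le_eq gr0I)

lemma is_partition_conjugate:
  assumes "is_partition q"
  shows "is_partition (Defs.conjugate q)"
proof -
  have "Defs.conjugate q j \<le> Defs.conjugate q i" if "1 \<le> i" "i \<le> j" for i j
  proof (cases "Defs.conjugate q j = 0")
    case False
    hence "j \<le> q (Defs.conjugate q j)" using conjugate_iff[OF assms, of "Defs.conjugate q j" j] that by simp
    thus ?thesis using conjugate_iff[OF assms, of "Defs.conjugate q j" i] that False by simp
  qed simp
  moreover have "Defs.conjugate q j = 0" if "q 1 < j" for j
    using conjugate_iff[OF assms, of 1 j] that by simp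
  hence "{i. Defs.conjugate q i \<noteq> 0} \<subseteq> {..q 1}" by (auto simp: not_less[symmetric])
  hence "finite {i. Defs.conjugate q i \<noteq> 0}" by (rule finite_subset) simp
  ultimately show ?thesis by (simp add: is_partition_def Defs.conjugate_def)
qed

lemma durfee_iff:
  assumes "is_partition q" "1 \<le> i"
  shows "i \<le> durfee q \<longleftrightarrow> i \<le> q i"
proof -
  let ?S = "{i. i \<le> q i}"
  have le1: "i \<le> q 1" if "i \<le> q i" for i
    using that partition_antimono[OF assms(1), of 1 i] by (cases "i = 0") auto
  have fin: "finite ?S"
  proof (rule finite_subset)
    show "?S \<subseteq> {..q 1}"
    proof
      fix i assume "i \<in> ?S"
      thus "i \<in> {..q 1}" using le1[of i] by simp
    qed
  qed simp
  have "durfee q \<in> ?S" unfolding durfee_def by (rule Max_in[OF fin]) auto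
  hence "i \<le> q i" if "i \<le> durfee q"
    using that partition_antimono[OF assms, of "durfee q"] by simp
  moreover have "i \<le> durfee q" if "i \<le> q i"
    unfolding durfee_def by (rule Max_ge[OF fin]) (use that in simp)
  ultimately show ?thesis by blast
qed

lemma durfee_conjugate:
  assumes "is_partition q" "1 \<le> i" "i \<le> durfee q"
  shows "i \<le> Defs.conjugate q i"
  using conjugate_iff[OF assms(1), of i i] durfee_iff[OF assms(1,2)] assms by simp

lemma above_durfee:
  assumes "is_partition q" "durfee q < i"
  shows "q i \<le> durfee q"
proof -
  have "\<not> Suc (durfee q) \<le> q (Suc (durfee q))"
    using durfee_iff[OF assms(1), of "Suc (durfee q)"] by simp
  thus ?thesis using partition_antimono[OF assms(1), of "Suc (durfee q)" i] assms(2) by simp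
qed

text \<open>Rows up to \<open>l\<close> are given by the arms. The lower rows have length at most
  \<open>l\<close>, so they lie in the first \<open>l\<close> columns, whose heights are given by
  the legs.\<close>

lemma has_frobenius_unique:
  assumes "has_frobenius p l a b" "has_frobenius q l a b"
  shows "p = q"
proof
  have main: "q i = a i + i" "Defs.conjugate q i = b i + i"
    if "has_frobenius q l a b" "1 \<le> i" "i \<le> l" for q i
  proof -
    have q: "is_partition q" "durfee q = l" "q i - i = a i" "Defs.conjugate q i - i = b i"
      using that by (auto simp: has_frobenius_def frob_a_def frob_b_def)
    show "q i = a i + i" using durfee_iff[OF q(1) that(2)] q that by simp
    show "Defs.conjugate q i = b i + i" using durfee_conjugate[OF q(1) that(2)] q that by simp
  qed
  have out: "j \<le> q i \<longleftrightarrow> j \<le> l \<and> i \<le> b j + j"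
    if "has_frobenius q l a b" "l < i" "1 \<le> j" for q i j
  proof -
    have q: "is_partition q" "durfee q = l" using that(1) by (auto simp: has_frobenius_def)
    have "q i \<le> l" using above_durfee[OF q(1), of i] q(2) that(2) by simp
    hence "j \<le> q i \<longleftrightarrow> j \<le> l \<and> i \<le> Defs.conjugate q j"
      using conjugate_iff[OF q(1), of i j] that by auto
    thus ?thesis using main(2)[OF that(1,3)] by auto
  qed
  fix i
  show "p i = q i"
  proof (cases "i = 0")
    case True
    thus ?thesis using assms by (simp add: has_frobenius_def is_partition_def)
  next
    case False
    show ?thesis
    proof (cases "i \<le> l")
      case True
      thus ?thesis using main(1)[OF assms(1)] main(1)[OF assms(2)] False by simp
    next
      case beyond: False
      show ?thesis
        by (rule nat_eq_by_le) (use out[OF assms(1)] out[OF assms(2)] beyond in simp)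
    qed
  qed
qed

text \<open>Lengthening all legs by 1 amounts to inserting a part equal to the side of the Durfee square.\<close>

definition lengthen_legs :: "(nat \<Rightarrow> nat) \<Rightarrow> nat \<Rightarrow> nat" where
  "lengthen_legs d i = (if i \<le> durfee d then d i else if i = Suc (durfee d) then durfee d else d (i - 1))"

lemma is_partition_lengthen_legs:
  assumes "is_partition d"
  shows "is_partition (lengthen_legs d)"
proof -
  let ?l = "durfee d" and ?p = "lengthen_legs d"
  have step: "?p (Suc i) \<le> ?p i" if "1 \<le> i" for i
  proof -
    consider "Suc i \<le> ?l" | "i = ?l" | "i = Suc ?l" | "Suc ?l < i" by linarith
    thus ?thesis
    proof cases
      case 2
      thus ?thesis using durfee_iff[OF assms that] that by (simp add: lengthen_legs_def)
    next
      case 3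
      thus ?thesis using above_durfee[OF assms, of i] by (simp add: lengthen_legs_def)
    qed (use partition_antimono[OF assms, of i "Suc i"] partition_antimono[OF assms, of "i - 1" i] that
        in \<open>auto simp: lengthen_legs_def\<close>)
  qed
  have "?p j \<le> ?p i" if "1 \<le> i" "i \<le> j" for i j
    using that(2,1)
  proof (induction j rule: dec_induct)
    case (step n)
    thus ?case using \<open>\<And>i. 1 \<le> i \<Longrightarrow> ?p (Suc i) \<le> ?p i\<close>[of n] by simp
  qed simp
  moreover have "finite {i. ?p i \<noteq> 0}"
  proof (rule finite_subset)
    show "{i. ?p i \<noteq> 0} \<subseteq> {..Suc ?l} \<union> Suc ` {i. d i \<noteq> 0}"
    proof
      fix i assume "i \<in> {i. ?p i \<noteq> 0}"
      thus "i \<in> {..Suc ?l} \<union> Suc ` {i. d i \<noteq> 0}"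
        by (cases i) (auto simp: lengthen_legs_def split: if_splits)
    qed
    show "finite ({..Suc ?l} \<union> Suc ` {i. d i \<noteq> 0})"
      using assms by (simp add: is_partition_def)
  qed
  moreover have "?p 0 = 0" using assms by (simp add: lengthen_legs_def is_partition_def)
  ultimately show ?thesis by (simp add: is_partition_def)
qed

lemma has_frobenius_lengthen_legs:
  assumes d: "is_partition d"
  shows "has_frobenius (lengthen_legs d) (durfee d) (frob_a d) (\<lambda>i. frob_b d i + 1)"
proof -
  let ?l = "durfee d" and ?p = "lengthen_legs d"
  note p = is_partition_lengthen_legs[OF d]
  have dp: "durfee ?p = ?l"
  proof (rule nat_eq_by_le)
    fix i :: nat assume i: "1 \<le> i"
    have "\<not> i \<le> ?p i" if "?l < i"
    proof (cases "i = Suc ?l")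
      case False
      hence "?l < i - 1" using that by simp
      thus ?thesis using above_durfee[OF d, of "i - 1"] that by (simp add: lengthen_legs_def)
    qed (simp add: lengthen_legs_def)
    moreover have "i \<le> ?p i" if "i \<le> ?l" using durfee_iff[OF d i] that by (simp add: lengthen_legs_def)
    ultimately show "i \<le> durfee ?p \<longleftrightarrow> i \<le> ?l" using durfee_iff[OF p i] by (metis not_le)
  qed
  have conj: "Defs.conjugate ?p i = Suc (Defs.conjugate d i)" if i: "1 \<le> i" "i \<le> ?l" for i
  proof (rule nat_eq_by_le)
    fix h :: nat assume h: "1 \<le> h"
    have l: "?l \<le> Defs.conjugate d i"
      using conjugate_iff[OF d, of ?l i] durfee_iff[OF d, of ?l] i by simp
    have "i \<le> ?p h \<longleftrightarrow> h \<le> Suc (Defs.conjugate d i)"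
    proof (cases "h \<le> Suc ?l")
      case True
      have "i \<le> ?p h"
      proof (cases "h = Suc ?l")
        case False
        hence "h \<le> ?l" using True by simp
        hence "?l \<le> d h"
          using durfee_iff[OF d, of ?l] partition_antimono[OF d, of h ?l] i h by simp
        thus ?thesis using i \<open>h \<le> ?l\<close> by (simp add: lengthen_legs_def)
      qed (use i in \<open>simp add: lengthen_legs_def\<close>)
      thus ?thesis using True l by simp
    next
      case False
      hence "?p h = d (h - 1)" by (simp add: lengthen_legs_def)
      moreover have "1 \<le> h - 1" using False i by simp
      ultimately show ?thesis using conjugate_iff[OF d, of "h - 1" i] i by auto
    qed
    thus "h \<le> Defs.conjugate ?p i \<longleftrightarrow> h \<le> Suc (Defs.conjugate d i)"
      using conjugate_iff[OF p h i(1)] by simp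
  qed
  show ?thesis
    using p dp conj durfee_conjugate[OF d]
    by (auto simp: has_frobenius_def frob_a_def frob_b_def lengthen_legs_def Suc_diff_le)
qed

lemma of_frobenius_lengthen_legs:
  assumes "is_partition d"
  shows "of_frobenius (durfee d) (frob_a d) (\<lambda>i. frob_b d i + 1) = lengthen_legs d"
  unfolding of_frobenius_def
  by (rule the_equality) (use has_frobenius_lengthen_legs[OF assms] has_frobenius_unique in blast)+

section \<open>Totally symmetric plane partitions as arrays\<close>

text \<open>One cell per orbit suffices, the one with weakly decreasing coordinates:
  \<open>t\<close> is the difference of its two largest coordinates and \<open>Suc c\<close> the
  smallest.\<close>

definition tspp_slices :: "nat \<Rightarrow> (nat \<Rightarrow> nat \<Rightarrow> nat) \<Rightarrow> nat \<Rightarrow> nat \<Rightarrow> nat" where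
  "tspp_slices m T t c = card {j. Suc c \<le> j \<and> (j + t, j, Suc c) \<in> cells m T}"

lemma cells_bound: "(i, j, c) \<in> cells m T \<Longrightarrow> i \<in> {1..m} \<and> j \<in> {1..m} \<and> 1 \<le> c \<and> c \<le> T i j"
  by (simp add: cells_def)

lemma cells_perm:
  assumes "T \<in> TSPP m" "(i, j, c) \<in> cells m T"
  shows "(j, i, c) \<in> cells m T" "(i, c, j) \<in> cells m T" "(c, j, i) \<in> cells m T" "(j, c, i) \<in> cells m T" "(c, i, j) \<in> cells m T"
proof -
  have "\<forall>i j c. (i, j, c) \<in> cells m T \<longrightarrow>
        (i, c, j) \<in> cells m T \<and> (j, i, c) \<in> cells m T \<and> (j, c, i) \<in> cells m T \<and>
        (c, i, j) \<in> cells m T \<and> (c, j, i) \<in> cells m T"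
    using assms(1) unfolding TSPP_def by (elim CollectE conjE)
  thus "(j, i, c) \<in> cells m T" "(i, c, j) \<in> cells m T" "(c, j, i) \<in> cells m T" "(j, c, i) \<in> cells m T" "(c, i, j) \<in> cells m T"
    using assms(2) by blast+
qed

text \<open>By definition of \<open>cells\<close> the third coordinate can be lowered; symmetry
  brings each of the others to the third place.\<close>

lemma cells_down:
  assumes T: "T \<in> TSPP m" and c: "(i, j, c) \<in> cells m T"
    and "1 \<le> i'" "i' \<le> i" "1 \<le> j'" "j' \<le> j" "1 \<le> c'" "c' \<le> c"
  shows "(i', j', c') \<in> cells m T"
proof -
  have last: "(i, j, c') \<in> cells m T" if "(i, j, c) \<in> cells m T" "1 \<le> c'" "c' \<le> c" for i j c c'
    using that by (auto simp: cells_def)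
  have "(i, j, c') \<in> cells m T" using last[OF c] assms by simp
  hence "(i, c', j) \<in> cells m T" using cells_perm[OF T] by blast
  hence "(i, c', j') \<in> cells m T" using last assms by blast
  hence "(c', j', i) \<in> cells m T" using cells_perm[OF T] by blast
  hence "(c', j', i') \<in> cells m T" using last assms by blast
  thus ?thesis using cells_perm[OF T] by blast
qed

text \<open>Lowering the two larger coordinates together preserves \<open>t\<close> and
  \<open>c\<close>, so the admissible \<open>y\<close> form a segment starting at
  \<open>Suc c\<close>, and their number decides membership.\<close>

lemma tspp_slices_iff:
  assumes T: "T \<in> TSPP m" and "Suc c \<le> y"
  shows "y - Suc c < tspp_slices m T t c \<longleftrightarrow> (y + t, y, Suc c) \<in> cells m T"
proof -
  let ?S = "{d. (d + Suc c + t, d + Suc c, Suc c) \<in> cells m T}"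
  have "{j. Suc c \<le> j \<and> (j + t, j, Suc c) \<in> cells m T} = (\<lambda>d. d + Suc c) ` ?S"
  proof (intro equalityI subsetI)
    fix j assume "j \<in> {j. Suc c \<le> j \<and> (j + t, j, Suc c) \<in> cells m T}"
    thus "j \<in> (\<lambda>d. d + Suc c) ` ?S" by (intro image_eqI[of _ _ "j - Suc c"]) auto
  qed auto
  hence "tspp_slices m T t c = card ?S"
    by (simp add: tspp_slices_def card_image inj_on_def)
  moreover have "?S = {..<card ?S}"
  proof (rule down_closed_lessThan)
    show "finite ?S"
      by (rule finite_subset[of _ "{..m}"]) (auto dest!: cells_bound)
    show "i \<in> ?S" if "j \<in> ?S" "i \<le> j" for i j
      using that cells_down[OF T, of "j + Suc c + t" "j + Suc c" "Suc c" "i + Suc c + t" "i + Suc c" "Suc c"]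
      by simp
  qed
  hence "y - Suc c \<in> ?S \<longleftrightarrow> y - Suc c \<in> {..<card ?S}" by (rule arg_cong)
  ultimately show ?thesis using assms(2) by simp
qed

text \<open>Each condition on slices says that lowering one coordinate of a sorted cell stays
  inside: the smallest for strictness, the largest for
  \<open>\<alpha> (Suc t) c \<le> \<alpha> t c\<close>, the middle one for
  \<open>\<alpha> t c \<le> Suc (\<alpha> (Suc t) c)\<close>.\<close>

lemma tspp_slices_in:
  assumes T: "T \<in> TSPP m"
  shows "tspp_slices m T \<in> slice_arrays m"
proof -
  let ?\<alpha> = "tspp_slices m T"
  have top: "(Suc c + a + t, Suc c + a, Suc c) \<in> cells m T \<longleftrightarrow> a < ?\<alpha> t c" for a t c
    using tspp_slices_iff[OF T, of c "Suc c + a" t] by simp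
  have "?\<alpha> t (Suc c) < ?\<alpha> t c \<or> ?\<alpha> t (Suc c) = 0" for t c
  proof (cases "?\<alpha> t (Suc c)")
    case (Suc a)
    hence "(Suc (Suc c) + a + t, Suc (Suc c) + a, Suc (Suc c)) \<in> cells m T" using top[of "Suc c" a t] by simp
    hence "(Suc c + Suc a + t, Suc c + Suc a, Suc c) \<in> cells m T"
      by (rule cells_down[OF T]) auto
    thus ?thesis using top[of c "Suc a" t] Suc by simp
  qed simp
  moreover have "?\<alpha> (Suc t) c \<le> ?\<alpha> t c" for t c
  proof (cases "?\<alpha> (Suc t) c")
    case (Suc a)
    hence "(Suc c + a + Suc t, Suc c + a, Suc c) \<in> cells m T" using top[of c a "Suc t"] by simp
    hence "(Suc c + a + t, Suc c + a, Suc c) \<in> cells m T"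
      by (rule cells_down[OF T]) auto
    thus ?thesis using top Suc by simp
  qed simp
  moreover have "?\<alpha> t c \<le> Suc (?\<alpha> (Suc t) c)" for t c
  proof (rule ccontr)
    define a where "a = ?\<alpha> (Suc t) c"
    assume "\<not> ?\<alpha> t c \<le> Suc (?\<alpha> (Suc t) c)"
    hence "(Suc c + Suc a + t, Suc c + Suc a, Suc c) \<in> cells m T" using top[of c "Suc a" t] by (simp add: a_def)
    hence "(Suc c + a + Suc t, Suc c + a, Suc c) \<in> cells m T"
      by (rule cells_down[OF T]) auto
    thus False using top[of c a "Suc t"] by (simp add: a_def)
  qed
  moreover have "?\<alpha> t c = 0" if "m \<le> t" for t c
  proof -
    have "(Suc c + 0 + t, Suc c + 0, Suc c) \<notin> cells m T" using that by (auto dest!: cells_bound)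
    thus ?thesis using top[of c 0 t] by simp
  qed
  ultimately show ?thesis
    by (auto simp: slice_arrays_def lifts_def strict_parts_def fun_eq_iff)
qed

text \<open>Membership of \<open>(i, j, c)\<close> is decided by the decreasing rearrangement \<open>(x, y, z)\<close>.\<close>

definition slice_cell :: "(nat \<Rightarrow> nat \<Rightarrow> nat) \<Rightarrow> nat \<Rightarrow> nat \<Rightarrow> nat \<Rightarrow> bool" where
  "slice_cell \<alpha> i j c = (let x = max i (max j c); z = min i (min j c); y = i + j + c - x - z in
     1 \<le> z \<and> y - z < \<alpha> (x - y) (z - 1))"

definition of_slices :: "(nat \<Rightarrow> nat \<Rightarrow> nat) \<Rightarrow> nat \<Rightarrow> nat \<Rightarrow> nat" where
  "of_slices \<alpha> i j = card {c. slice_cell \<alpha> i j c}"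

lemma slice_cell_sorted:
  "y \<le> x \<Longrightarrow> z \<le> y \<Longrightarrow> slice_cell \<alpha> x y z \<longleftrightarrow> 1 \<le> z \<and> y - z < \<alpha> (x - y) (z - 1)"
  by (simp add: slice_cell_def Let_def max.absorb1 max.coboundedI2 min.absorb2 min.coboundedI2)

lemma slice_cell_perm:
  "slice_cell \<alpha> i j c = slice_cell \<alpha> j i c" "slice_cell \<alpha> i j c = slice_cell \<alpha> i c j"
  unfolding slice_cell_def by (simp_all only: max.left_commute max.commute min.left_commute min.commute add_ac)

text \<open>The coordinate \<open>c\<close> that is lowered may be the largest, the middle or the
  smallest of the three; each case uses one of the three conditions on consecutive entries of the
  array.\<close>

lemma slice_cell_pred:
  assumes \<alpha>: "\<alpha> \<in> slice_arrays m" and "slice_cell \<alpha> i j (Suc c)" "1 \<le> c"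
  shows "slice_cell \<alpha> i j c"
proof -
  have step: "\<alpha> (Suc t) c \<le> \<alpha> t c" "\<alpha> t c \<le> Suc (\<alpha> (Suc t) c)" "\<alpha> t (Suc c) < \<alpha> t c \<or> \<alpha> t (Suc c) = 0" for t c
    using \<alpha> by (auto simp: slice_arrays_def lifts_def strict_parts_def)
  have main: "slice_cell \<alpha> i j c" if "slice_cell \<alpha> i j (Suc c)" "j \<le> i" for i j
  proof -
    consider "i \<le> c" | "c < i" "j \<le> c" | "c < j" by linarith
    thus ?thesis
    proof cases
      case 1
      hence "slice_cell \<alpha> (Suc c) i j" using that(1) slice_cell_perm by metis
      hence "1 \<le> j" "i - j < \<alpha> (Suc (c - i)) (j - 1)"
        using 1 that(2) by (simp_all add: slice_cell_sorted Suc_diff_le)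
      hence "slice_cell \<alpha> c i j" using 1 that(2) step(1)[of "c - i" "j - 1"] by (simp add: slice_cell_sorted)
      thus ?thesis using slice_cell_perm by metis
    next
      case 2
      hence "slice_cell \<alpha> i (Suc c) j" using that(1) slice_cell_perm by metis
      hence "1 \<le> j" "Suc c - j < \<alpha> (i - Suc c) (j - 1)"
        using 2 by (simp_all add: slice_cell_sorted)
      moreover have "i - c = Suc (i - Suc c)" using 2 by simp
      ultimately have "slice_cell \<alpha> i c j" using 2 step(2)[of "i - Suc c" "j - 1"]
        by (simp add: slice_cell_sorted Suc_diff_le)
      thus ?thesis using slice_cell_perm by metis
    next
      case 3
      hence "j - Suc c < \<alpha> (i - j) c" using that by (simp add: slice_cell_sorted)
      hence "j - c < \<alpha> (i - j) (c - 1)" using step(3)[of "i - j" "c - 1"] assms(3) 3 by simp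
      thus ?thesis using 3 that(2) assms(3) by (simp add: slice_cell_sorted)
    qed
  qed
  show ?thesis
  proof (cases "j \<le> i")
    case False
    hence "slice_cell \<alpha> j i c" using main[of j i] assms(2) slice_cell_perm(1) by (metis nat_le_linear)
    thus ?thesis using slice_cell_perm(1) by metis
  qed (use main assms(2) in blast)
qed

lemma slice_cell_down:
  assumes "\<alpha> \<in> slice_arrays m" "slice_cell \<alpha> i j c" "1 \<le> c'" "c' \<le> c"
  shows "slice_cell \<alpha> i j c'"
  using assms(4,3,2) by (induction c' rule: inc_induct) (auto intro: slice_cell_pred[OF assms(1)])

text \<open>Layer \<open>m\<close> is 0 and each layer inwards adds at most 1, so
  \<open>\<alpha> t 0 \<le> m - t\<close>. Strictness lowers this by a further \<open>z - 1\<close>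
  at place \<open>z - 1\<close>, which bounds the largest coordinate by \<open>m\<close>.\<close>

lemma slice_cell_bound:
  assumes \<alpha>: "\<alpha> \<in> slice_arrays m" and c: "slice_cell \<alpha> i j c"
  shows "i \<in> {1..m} \<and> j \<in> {1..m} \<and> c \<in> {1..m}"
proof -
  define x z where "x = max i (max j c)" and "z = min i (min j c)"
  define y where "y = i + j + c - x - z"
  have "z \<le> y" "y \<le> x" by (auto simp: x_def y_def z_def)
  have z: "1 \<le> z" and *: "y - z < \<alpha> (x - y) (z - 1)" using c by (simp_all add: slice_cell_def Let_def x_def y_def z_def)
  note strict_parts_le[OF slice_arrays_strict[OF \<alpha>], of "x - y" "z - 1"]
  moreover have "\<alpha> (x - y) 0 \<le> m - (x - y)"
  proof (cases "x - y \<le> m")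
    case True
    have "\<alpha> m 0 = 0" using \<alpha> by (simp add: slice_arrays_def)
    thus ?thesis using slice_arrays_decreasing(2)[OF \<alpha>, of "x - y" 0 "m - (x - y)"] True by simp
  next
    case False
    hence "\<alpha> (x - y) 0 = 0" using \<alpha> by (simp add: slice_arrays_def)
    thus ?thesis by simp
  qed
  ultimately have "x \<le> m" using * z \<open>z \<le> y\<close> \<open>y \<le> x\<close> by linarith
  thus ?thesis using z by (auto simp: x_def z_def)
qed

lemma cells_of_slices:
  assumes "\<alpha> \<in> slice_arrays m"
  shows "(i, j, c) \<in> cells m (of_slices \<alpha>) \<longleftrightarrow> slice_cell \<alpha> i j c"
proof -
  have "{c. slice_cell \<alpha> i j c} = {1..card {c. slice_cell \<alpha> i j c}}"
    by (rule down_closed_nat[where N = m])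
      (use slice_cell_bound[OF assms] slice_cell_pred[OF assms] in auto)
  hence "slice_cell \<alpha> i j c \<longleftrightarrow> c \<in> {1..of_slices \<alpha> i j}" by (auto simp: of_slices_def)
  moreover have "i \<in> {1..m} \<and> j \<in> {1..m}" if "slice_cell \<alpha> i j c" using slice_cell_bound[OF assms that] by simp
  ultimately show ?thesis by (auto simp: cells_def)
qed

lemma of_slices_TSPP:
  assumes \<alpha>: "\<alpha> \<in> slice_arrays m"
  shows "of_slices \<alpha> \<in> TSPP m"
proof -
  have fin: "finite {c. slice_cell \<alpha> i j c}" for i j
    by (rule finite_subset[of _ "{1..m}"]) (use slice_cell_bound[OF \<alpha>] in auto)
  have zero: "of_slices \<alpha> i j = 0" if "i \<notin> {1..m} \<or> j \<notin> {1..m}" for i j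
  proof -
    have "{c. slice_cell \<alpha> i j c} = {}" using slice_cell_bound[OF \<alpha>, of i j] that by blast
    thus ?thesis by (simp add: of_slices_def)
  qed
  have le: "of_slices \<alpha> i j \<le> m" for i j
  proof -
    have "{c. slice_cell \<alpha> i j c} \<subseteq> {1..m}" using slice_cell_bound[OF \<alpha>] by blast
    from card_mono[OF _ this] show ?thesis by (simp add: of_slices_def)
  qed
  have mono: "of_slices \<alpha> i j' \<le> of_slices \<alpha> i j" if "1 \<le> j" "j \<le> j'" for i j j'
    unfolding of_slices_def
  proof (rule card_mono[OF fin], intro subsetI CollectI)
    fix c assume "c \<in> {c. slice_cell \<alpha> i j' c}"
    hence "slice_cell \<alpha> i c j'" using slice_cell_perm(2) by blast
    hence "slice_cell \<alpha> i c j" using slice_cell_down[OF \<alpha>] that by blast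
    thus "slice_cell \<alpha> i j c" using slice_cell_perm(2) by blast
  qed
  have sym: "of_slices \<alpha> i j = of_slices \<alpha> j i" for i j
    unfolding of_slices_def by (intro arg_cong[where f = card] Collect_cong slice_cell_perm(1))
  show ?thesis
    unfolding TSPP_def
  proof (intro CollectI conjI)
    show "\<forall>i j c. (i, j, c) \<in> cells m (of_slices \<alpha>) \<longrightarrow>
        (i, c, j) \<in> cells m (of_slices \<alpha>) \<and> (j, i, c) \<in> cells m (of_slices \<alpha>) \<and> (j, c, i) \<in> cells m (of_slices \<alpha>) \<and>
        (c, i, j) \<in> cells m (of_slices \<alpha>) \<and> (c, j, i) \<in> cells m (of_slices \<alpha>)"
      unfolding cells_of_slices[OF \<alpha>] using slice_cell_perm by metis
    show "\<forall>i\<in>{1..m}. \<forall>i'\<in>{1..m}. \<forall>j\<in>{1..m}. i \<le> i' \<longrightarrow> of_slices \<alpha> i' j \<le> of_slices \<alpha> i j"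
      using mono sym by (metis atLeastAtMost_iff)
  qed (use zero le mono in auto)
qed

lemma TSPP_eqI:
  assumes "T \<in> TSPP m" "T' \<in> TSPP m" "cells m T = cells m T'"
  shows "T = T'"
proof (intro ext)
  fix i j
  show "T i j = T' i j"
  proof (cases "i \<in> {1..m} \<and> j \<in> {1..m}")
    case True
    show ?thesis
    proof (rule nat_eq_by_le)
      fix c :: nat assume "1 \<le> c"
      hence "c \<le> T i j \<longleftrightarrow> (i, j, c) \<in> cells m T" "c \<le> T' i j \<longleftrightarrow> (i, j, c) \<in> cells m T'" for T
        using True by (auto simp: cells_def)
      thus "c \<le> T i j \<longleftrightarrow> c \<le> T' i j" using assms(3) by blast
    qed
  next
    case False
    hence z: "T i j = 0" if "T \<in> TSPP m" for T using that by (auto simp: TSPP_def)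
    show ?thesis using z[OF assms(1)] z[OF assms(2)] by simp
  qed
qed

lemma slice_cell_tspp_slices:
  assumes T: "T \<in> TSPP m"
  shows "slice_cell (tspp_slices m T) i j c \<longleftrightarrow> (i, j, c) \<in> cells m T"
proof -
  have sorted: "slice_cell (tspp_slices m T) x y z \<longleftrightarrow> (x, y, z) \<in> cells m T" if "y \<le> x" "z \<le> y" for x y z
  proof (cases z)
    case 0
    thus ?thesis using that by (auto simp: slice_cell_sorted dest: cells_bound)
  next
    case (Suc c)
    thus ?thesis using that tspp_slices_iff[OF T, of c y "x - y"] by (simp add: slice_cell_sorted)
  qed
  have perm: "(i, j, c) \<in> cells m T \<longleftrightarrow> (j, i, c) \<in> cells m T" "(i, j, c) \<in> cells m T \<longleftrightarrow> (i, c, j) \<in> cells m T" for i j c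
    using cells_perm[OF T] by blast+
  have wlog: "slice_cell (tspp_slices m T) i j c \<longleftrightarrow> (i, j, c) \<in> cells m T" if "j \<le> i" for i j c
  proof -
    consider "i \<le> c" | "c < i" "j \<le> c" | "c < j" by linarith
    thus ?thesis
    proof cases
      case 1
      thus ?thesis using sorted[of i c j] that slice_cell_perm perm by metis
    next
      case 2
      thus ?thesis using sorted[of c i j] slice_cell_perm perm by (metis less_imp_le)
    next
      case 3
      thus ?thesis using sorted[of j i c] that by simp
    qed
  qed
  show ?thesis
    using wlog[of j i c] wlog[of i j c] slice_cell_perm(1) perm(1) by (metis nat_le_linear)
qed

lemma bij_betw_tspp_slices: "bij_betw (tspp_slices m) (TSPP m) (slice_arrays m)"
proof (rule bij_betw_byWitness[where f' = of_slices])
  show "\<forall>T\<in>TSPP m. of_slices (tspp_slices m T) = T"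
  proof
    fix T assume T: "T \<in> TSPP m"
    note \<alpha> = tspp_slices_in[OF T]
    show "of_slices (tspp_slices m T) = T"
      by (rule TSPP_eqI[OF of_slices_TSPP[OF \<alpha>] T])
        (auto simp: cells_of_slices[OF \<alpha>] slice_cell_tspp_slices[OF T])
  qed
  show "\<forall>\<alpha>\<in>slice_arrays m. tspp_slices m (of_slices \<alpha>) = \<alpha>"
  proof (intro ballI ext)
    fix \<alpha> t c assume \<alpha>: "\<alpha> \<in> slice_arrays m"
    have "{j. Suc c \<le> j \<and> (j + t, j, Suc c) \<in> cells m (of_slices \<alpha>)} = {Suc c..<Suc c + \<alpha> t c}"
      by (auto simp: cells_of_slices[OF \<alpha>] slice_cell_sorted)
    thus "tspp_slices m (of_slices \<alpha>) t c = \<alpha> t c" by (simp add: tspp_slices_def)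
  qed
qed (use tspp_slices_in of_slices_TSPP in auto)

section \<open>The diagonal of a totally symmetric plane partition\<close>

context
  fixes m :: nat and T :: "nat \<Rightarrow> nat \<Rightarrow> nat" and \<alpha> :: "nat \<Rightarrow> nat \<Rightarrow> nat" and d :: "nat \<Rightarrow> nat" and l :: nat
  assumes T: "T \<in> TSPP m"
  defines "\<alpha> \<equiv> tspp_slices m T" and "d \<equiv> tspp_diag T"
  defines "l \<equiv> num_parts (\<alpha> 0)"
begin

lemma slices_mem: "\<alpha> \<in> slice_arrays m"
  unfolding \<alpha>_def by (rule tspp_slices_in[OF T])

lemma is_partition_diagonal: "is_partition (\<lambda>i. T i i)"
proof -
  have out: "T i i = 0" if "i \<notin> {1..m}" for i using T that by (auto simp: TSPP_def)
  have "T j j \<le> T i i" if "1 \<le> i" "i \<le> j" for i j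
  proof (cases "j \<le> m \<and> 0 < T j j")
    case True
    hence "(j, j, T j j) \<in> cells m T" using that by (auto simp: cells_def)
    hence "(i, i, T j j) \<in> cells m T" by (rule cells_down[OF T]) (use that True in auto)
    thus ?thesis by (simp add: cells_def)
  next
    case False
    thus ?thesis using out[of j] by (cases "j \<le> m") auto
  qed
  moreover have "finite {i. T i i \<noteq> 0}"
  proof (rule finite_subset)
    show "{i. T i i \<noteq> 0} \<subseteq> {1..m}"
    proof
      fix i assume "i \<in> {i. T i i \<noteq> 0}"
      thus "i \<in> {1..m}" using out[of i] by (cases "i \<in> {1..m}") simp_all
    qed
  qed simp
  ultimately show ?thesis using out[of 0] by (simp add: is_partition_def)
qed

lemma is_partition_tspp_diag: "is_partition d"
  unfolding d_def tspp_diag_def by (rule is_partition_conjugate[OF is_partition_diagonal])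

text \<open>The layer of \<open>T\<close> at height \<open>h\<close> is a self-conjugate partition,
  and \<open>d h\<close> is the side of its Durfee square.\<close>

lemma le_diag_iff:
  assumes "1 \<le> i" "1 \<le> h"
  shows "i \<le> d h \<longleftrightarrow> (i, i, h) \<in> cells m T"
proof -
  have "i \<le> d h \<longleftrightarrow> h \<le> T i i"
    unfolding d_def tspp_diag_def by (rule conjugate_iff[OF is_partition_diagonal assms])
  also have "\<dots> \<longleftrightarrow> (i, i, h) \<in> cells m T"
  proof -
    have "T i i = 0" if "i \<notin> {1..m}" using T that by (auto simp: TSPP_def)
    thus ?thesis using assms by (cases "i \<in> {1..m}") (auto simp: cells_def)
  qed
  finally show ?thesis .
qed

lemma parts_iff: "c < l \<longleftrightarrow> 0 < \<alpha> 0 c"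
  unfolding l_def by (rule num_parts_iff[OF slice_arrays_strict[OF slices_mem]])

lemma durfee_tspp_diag: "durfee d = l"
proof (rule nat_eq_by_le)
  fix i :: nat assume i: "1 \<le> i"
  have "i \<le> durfee d \<longleftrightarrow> (i, i, i) \<in> cells m T"
    using durfee_iff[OF is_partition_tspp_diag i] le_diag_iff[OF i i] by simp
  also have "\<dots> \<longleftrightarrow> 0 < \<alpha> 0 (i - 1)"
    using tspp_slices_iff[OF T, of "i - 1" i 0] i by (simp add: \<alpha>_def)
  also have "\<dots> \<longleftrightarrow> i \<le> l" using parts_iff[of "i - 1"] i by auto
  finally show "i \<le> durfee d \<longleftrightarrow> i \<le> l" .
qed

lemma diag_part: "c < l \<Longrightarrow> d (Suc c) = c + \<alpha> 0 c"
proof (rule nat_eq_by_le)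
  fix y :: nat assume c: "c < l" and y: "1 \<le> y"
  show "y \<le> d (Suc c) \<longleftrightarrow> y \<le> c + \<alpha> 0 c"
  proof (cases "Suc c \<le> y")
    case True
    have "y \<le> d (Suc c) \<longleftrightarrow> y - Suc c < \<alpha> 0 c"
      using le_diag_iff[OF y, of "Suc c"] tspp_slices_iff[OF T True, of 0] by (simp add: \<alpha>_def)
    thus ?thesis using True by auto
  next
    case False
    have "Suc c \<le> d (Suc c)"
      using durfee_iff[OF is_partition_tspp_diag, of "Suc c"] durfee_tspp_diag c by simp
    thus ?thesis using False by simp
  qed
qed

text \<open>By symmetry the cell \<open>(Suc c, Suc c, y)\<close> becomes
  \<open>(y, Suc c, Suc c)\<close>, the first possible cell for \<open>c\<close> in layer
  \<open>y - Suc c\<close>. Hence legs count the layers in which part \<open>c\<close> is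
  present.\<close>

lemma diag_conjugate: "c < l \<Longrightarrow> Defs.conjugate d (Suc c) = c + heights \<alpha> c"
proof (rule nat_eq_by_le)
  fix y :: nat assume c: "c < l" and y: "1 \<le> y"
  show "y \<le> Defs.conjugate d (Suc c) \<longleftrightarrow> y \<le> c + heights \<alpha> c"
  proof (cases "Suc c \<le> y")
    case True
    have "y \<le> Defs.conjugate d (Suc c) \<longleftrightarrow> Suc c \<le> d y"
      by (rule conjugate_iff[OF is_partition_tspp_diag y]) simp
    also have "\<dots> \<longleftrightarrow> (Suc c, Suc c, y) \<in> cells m T" using le_diag_iff[OF _ y, of "Suc c"] by simp
    also have "\<dots> \<longleftrightarrow> (y, Suc c, Suc c) \<in> cells m T" using cells_perm[OF T] by blast
    also have "\<dots> \<longleftrightarrow> 0 < \<alpha> (y - Suc c) c"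
      using tspp_slices_iff[OF T, of c "Suc c" "y - Suc c"] True by (simp add: \<alpha>_def)
    also have "\<dots> \<longleftrightarrow> y - Suc c < heights \<alpha> c"
      by (rule slice_arrays_positive[OF slices_mem])
    finally show ?thesis using True by auto
  next
    case False
    have "Suc c \<le> Defs.conjugate d (Suc c)"
      using durfee_conjugate[OF is_partition_tspp_diag, of "Suc c"] durfee_tspp_diag c by simp
    thus ?thesis using False by simp
  qed
qed

lemma frob_tspp_diag:
  assumes "c < l"
  shows "frob_a d (Suc c) = \<alpha> 0 c - 1" "frob_b d (Suc c) = heights \<alpha> c - 1"
  using diag_part[OF assms] diag_conjugate[OF assms] by (simp_all add: frob_a_def frob_b_def)

lemma heights_bound: "heights \<alpha> c \<le> m"
proof -
  have "{t. 0 < \<alpha> t c} \<subseteq> {..<m}"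
  proof
    fix t assume "t \<in> {t. 0 < \<alpha> t c}"
    thus "t \<in> {..<m}" using slices_mem by (cases "m \<le> t") (auto simp: slice_arrays_def)
  qed
  from card_mono[OF _ this] show ?thesis by (simp add: heights_def)
qed

lemma tspp_pi_1: "tspp_pi 1 T = lengthen_legs d"
  unfolding tspp_pi_def d_def[symmetric] by (rule of_frobenius_lengthen_legs[OF is_partition_tspp_diag])

lemma diag_le: "d i \<le> m"
proof (cases "i = 0 \<or> d i = 0")
  case False
  hence "(d i, d i, i) \<in> cells m T" using le_diag_iff[of "d i" i] by simp
  thus ?thesis by (auto dest: cells_bound)
qed (use is_partition_tspp_diag in \<open>auto simp: is_partition_def\<close>)

lemma parts_le: "l \<le> m"
proof (cases "l = 0")
  case False
  hence "l \<le> d l" using durfee_iff[OF is_partition_tspp_diag, of l] durfee_tspp_diag by simp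
  thus ?thesis using diag_le[of l] by simp
qed simp

text \<open>The partition \<open>d\<close> has at most \<open>m\<close> rows, and lengthening
  inserts one more: as many as there are variables.\<close>

lemma lengthen_legs_top: "lengthen_legs d (Suc (Suc m)) = 0"
proof -
  have "\<not> 1 \<le> d (Suc m)"
    using le_diag_iff[of 1 "Suc m"] cells_bound[of 1 1 "Suc m" m T] cells_perm(3)[OF T, of 1 1 "Suc m"] cells_bound[of "Suc m" 1 1 m T]
    by auto
  thus ?thesis using parts_le by (simp add: lengthen_legs_def durfee_tspp_diag)
qed

text \<open>If part \<open>Suc c\<close> is still present in layer \<open>h\<close>, strictness
  makes part \<open>c\<close> at least 2 there. It drops by at most 1, so it survives to layer
  \<open>Suc h\<close>.\<close>

lemma heights_less: "c < c' \<Longrightarrow> c' < l \<Longrightarrow> heights \<alpha> c' < heights \<alpha> c"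
proof -
  have step: "heights \<alpha> (Suc c) < heights \<alpha> c" if "Suc c < l" for c
  proof -
    define h where "h = heights \<alpha> (Suc c) - 1"
    have "0 < heights \<alpha> (Suc c)" using heights_pos_iff[OF slices_mem, of "Suc c"] that by (simp add: l_def)
    hence h: "heights \<alpha> (Suc c) = Suc h" by (simp add: h_def)
    hence "0 < \<alpha> h (Suc c)" using slice_arrays_positive[OF slices_mem, of h "Suc c"] by simp
    moreover have "\<alpha> h (Suc c) < \<alpha> h c \<or> \<alpha> h (Suc c) = 0" "\<alpha> h c \<le> Suc (\<alpha> (Suc h) c)"
      using slices_mem by (auto simp: slice_arrays_def lifts_def strict_parts_def)
    ultimately have "0 < \<alpha> (Suc h) c" by linarith
    thus ?thesis using slice_arrays_positive[OF slices_mem, of "Suc h" c] h by simp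
  qed
  assume "c < c'" "c' < l"
  thus "heights \<alpha> c' < heights \<alpha> c"
  proof (induction c')
    case (Suc c')
    thus ?case using step[of c'] by (cases "c = c'") auto
  qed simp
qed

lemma legs_inj: "inj_on (\<lambda>c. heights \<alpha> c - 1) {..<l}"
proof (rule inj_onI)
  fix c c' assume c: "c \<in> {..<l}" "c' \<in> {..<l}" and eq: "heights \<alpha> c - 1 = heights \<alpha> c' - 1"
  have "0 < heights \<alpha> c" "0 < heights \<alpha> c'"
    using heights_pos_iff[OF slices_mem] c by (auto simp: l_def)
  thus "c = c'"
    using eq heights_less[of c c'] heights_less[of c' c] c by (cases c c' rule: linorder_cases) auto
qed

lemma legs_subset: "(\<lambda>c. heights \<alpha> c - 1) ` {..<l} \<subseteq> {..<m}"
proof (rule image_subsetI)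
  fix c assume "c \<in> {..<l}"
  hence "0 < heights \<alpha> c" using heights_pos_iff[OF slices_mem, of c] by (simp add: l_def)
  thus "heights \<alpha> c - 1 \<in> {..<m}" using heights_bound[of c] by simp
qed

lemma set_free_legs: "set (free_legs m \<alpha>) = {..<m} - (\<lambda>c. heights \<alpha> c - 1) ` {..<l}"
  by (auto simp: free_legs_def l_def)

lemma distinct_free_legs: "distinct (free_legs m \<alpha>)"
  by (simp add: free_legs_def)

text \<open>Used and free legs together are the numbers \<open>0, ..., m - 1\<close>. This converts
  the exponent of \<open>v\<close> in the weight of a plane partition into a sum over free
  legs.\<close>

lemma sum_free_legs:
  "(\<Sum>b\<leftarrow>free_legs m \<alpha>. Suc b) + (\<Sum>c<l. heights \<alpha> c) = Suc m choose 2"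
proof -
  let ?B = "(\<lambda>c. heights \<alpha> c - 1) ` {..<l}"
  have "(\<Sum>b\<leftarrow>free_legs m \<alpha>. Suc b) = (\<Sum>b\<in>{..<m} - ?B. Suc b)"
    by (simp only: sum_list_distinct_conv_sum_set[OF distinct_free_legs] set_free_legs)
  moreover have "(\<Sum>c<l. heights \<alpha> c) = (\<Sum>b\<in>?B. Suc b)"
    unfolding sum.reindex[OF legs_inj]
  proof (rule sum.cong[OF refl])
    fix c assume "c \<in> {..<l}"
    hence "0 < heights \<alpha> c" using heights_pos_iff[OF slices_mem, of c] by (simp add: l_def)
    thus "heights \<alpha> c = (Suc \<circ> (\<lambda>c. heights \<alpha> c - 1)) c" by simp
  qed
  ultimately have "(\<Sum>b\<leftarrow>free_legs m \<alpha>. Suc b) + (\<Sum>c<l. heights \<alpha> c) = (\<Sum>b<m. Suc b)"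
    using sum.subset_diff[OF legs_subset, of Suc] by simp
  also have "\<dots> = Suc m choose 2"
    by (induction m) (simp_all add: numeral_2_eq_2)
  finally show ?thesis .
qed

text \<open>The beta numbers above \<open>m\<close> come from the arms, those below \<open>m\<close>
  are the complement of the values given by the legs, and \<open>m\<close> itself belongs to the row
  inserted by \<open>lengthen_legs\<close>. Both lists are strictly increasing of equal length, so
  one inclusion of their sets suffices.\<close>

lemma beta_numbers_tspp:
  "map (beta_numbers (Suc m) (tspp_pi 1 T)) [0..<Suc m]
    = map (\<lambda>b. m - Suc b) (free_legs m \<alpha>) @ [m] @ map (\<lambda>c. m + \<alpha> 0 c) (rev [0..<l])" (is "?L = ?R")
proof (rule sorted_distinct_set_unique)
  let ?p = "lengthen_legs d"
  note d = is_partition_tspp_diag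
  have "beta_numbers (Suc m) ?p i < beta_numbers (Suc m) ?p j" if "i < j" "j < Suc m" for i j
  proof -
    have "1 \<le> Suc m - j" "Suc m - j \<le> Suc m - i" using that by auto
    hence "?p (Suc m - i) \<le> ?p (Suc m - j)"
      by (rule partition_antimono[OF is_partition_lengthen_legs[OF d]])
    thus ?thesis using that(1) by (simp add: beta_numbers_def)
  qed
  hence sw: "sorted_wrt (<) ?L"
    unfolding tspp_pi_1 by (simp add: sorted_wrt_iff_nth_less del: upt_Suc)
  thus "sorted ?L" "distinct ?L" by (simp_all only: strict_sorted_iff)
  have dec: "sorted_wrt (>) (free_legs m \<alpha>)"
    unfolding free_legs_def by (rule sorted_wrt_filter) (simp add: sorted_wrt_rev)
  have fm: "b < m" if "b \<in> set (free_legs m \<alpha>)" for b using that by (simp add: set_free_legs)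
  have "sorted_wrt (<) (map (\<lambda>b. m - Suc b) (free_legs m \<alpha>))"
    unfolding sorted_wrt_map
  proof (rule sorted_wrt_mono_rel[OF _ dec])
    fix x y assume "x \<in> set (free_legs m \<alpha>)" "y < x"
    thus "m - Suc x < m - Suc y" using fm[of x] by linarith
  qed
  moreover have "sorted_wrt (<) (map (\<lambda>c. m + \<alpha> 0 c) (rev [0..<l]))"
  proof -
    have "\<alpha> 0 c' < \<alpha> 0 c" if "c < c'" "c' < l" for c c'
      using that
    proof (induction c')
      case (Suc c')
      have "\<alpha> 0 (Suc c') < \<alpha> 0 c' \<or> \<alpha> 0 (Suc c') = 0"
        using slice_arrays_strict[OF slices_mem, of 0] by (simp add: strict_parts_def)
      hence "\<alpha> 0 (Suc c') < \<alpha> 0 c'" using parts_iff[of "Suc c'"] Suc.prems by simp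
      thus ?case using Suc by (cases "c = c'") auto
    qed simp
    thus ?thesis by (simp add: sorted_wrt_map sorted_wrt_iff_nth_less rev_nth)
  qed
  moreover have "0 < \<alpha> 0 c" if "c < l" for c using that parts_iff by simp
  ultimately have "sorted_wrt (<) ?R" by (auto simp: sorted_wrt_append dest: fm)
  thus "sorted ?R" "distinct ?R" by (simp_all only: strict_sorted_iff)
  have "set ?L \<subseteq> set ?R"
  proof
    fix y assume "y \<in> set ?L"
    then obtain i where i: "i \<le> m" "y = ?p (Suc m - i) + i"
      unfolding tspp_pi_1 by (auto simp: beta_numbers_def less_Suc_eq_le simp del: upt_Suc)
    define h where "h = Suc m - i"
    have h: "1 \<le> h" "h \<le> Suc m" "y = ?p h + (Suc m - h)" using i by (auto simp: h_def)
    consider "h \<le> l" | "h = Suc l" | "Suc l < h" by linarith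
    thus "y \<in> set ?R"
    proof cases
      case 1
      hence "y = m + \<alpha> 0 (h - 1)" "h - 1 < l"
        using h diag_part[of "h - 1"] parts_le by (auto simp: lengthen_legs_def durfee_tspp_diag)
      thus ?thesis by auto
    next
      case 2
      hence "y = m" using h by (simp add: lengthen_legs_def durfee_tspp_diag)
      thus ?thesis by simp
    next
      case 3
      define r where "r = h - 1"
      have r: "l < r" "r \<le> m" "y = d r + (m - r)" using h 3 by (auto simp: r_def lengthen_legs_def durfee_tspp_diag)
      have dr: "d r \<le> l" using above_durfee[OF d, of r] r by (simp add: durfee_tspp_diag)
      define b where "b = r - 1 - d r"
      have b: "b < m" "y = m - Suc b" using r dr by (auto simp: b_def)
      have "b \<noteq> heights \<alpha> c - 1" if c: "c < l" for c
      proof -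
        have h0: "0 < heights \<alpha> c" using heights_pos_iff[OF slices_mem, of c] c by (simp add: l_def)
        \<comment> \<open>If both sides hold, \<open>b\<close> is smaller than the leg
          \<open>heights \<alpha> c - 1\<close>; if both fail, it is larger.\<close>
        have iff: "r \<le> c + heights \<alpha> c \<longleftrightarrow> Suc c \<le> d r"
          using conjugate_iff[OF d, of r "Suc c"] diag_conjugate[OF c] r by simp
        show ?thesis
        proof (cases "Suc c \<le> d r")
          case True
          thus ?thesis using iff h0 r dr by (simp add: b_def)
        next
          case False
          thus ?thesis using iff h0 r dr by (simp add: b_def)
        qed
      qed
      hence "b \<in> set (free_legs m \<alpha>)" using b by (auto simp: set_free_legs)
      thus ?thesis using b by auto
    qed
  qed
  moreover have "card (set ?R) \<le> card (set ?L)"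
  proof -
    have "length (free_legs m \<alpha>) = m - l"
      using distinct_card[OF distinct_free_legs] card_Diff_subset[OF _ legs_subset] card_image[OF legs_inj]
      by (simp add: set_free_legs)
    hence "length ?R = Suc m" using parts_le by simp
    moreover have "card (set ?L) = Suc m" using distinct_card[OF \<open>distinct ?L\<close>] by simp
    ultimately show ?thesis using card_length[of ?R] by (simp only:)
  qed
  ultimately show "set ?L = set ?R" by (intro card_seteq) auto
qed

end

section \<open>The identity for distinct variables\<close>

lemma sum_from_1: "(\<Sum>i=1..l. f i) = (\<Sum>c<l. f (Suc c))" for f :: "nat \<Rightarrow> 'a::comm_monoid_add"
  by (rule sum.reindex_bij_witness[where i = Suc and j = "\<lambda>j. j - 1"]) auto

lemma prod_neq_0I: "finite A \<Longrightarrow> (\<And>y. y \<in> A \<Longrightarrow> f y \<noteq> 0) \<Longrightarrow> prod f A \<noteq> (0 :: 'a::field)"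
  by (simp add: prod_zero_iff)

lemma prod_list_power: "(\<Prod>b\<leftarrow>bs. v ^ f b) = (v :: 'a::comm_monoid_mult) ^ (\<Sum>b\<leftarrow>bs. f b)"
  by (induction bs) (simp_all add: power_add)

text \<open>The integer exponents are natural numbers here, so the weight is a polynomial in
  \<open>u\<close>, \<open>v\<close>, \<open>w\<close>. This also serves the final specialization,
  where these parameters may be 0.\<close>

lemma tspp_weight_eq:
  fixes u v w :: "'a::field"
  assumes T: "T \<in> TSPP m"
  defines "\<alpha> \<equiv> tspp_slices m T"
  shows "tspp_weight (Suc m) 1 u v w T
    = slice_weight u w \<alpha> * u ^ num_parts (\<alpha> 0) * v ^ (\<Sum>b\<leftarrow>free_legs m \<alpha>. Suc b)"
proof -
  define d where "d = tspp_diag T"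
  define l where "l = num_parts (\<alpha> 0)"
  define h where "h = heights \<alpha>"
  note \<alpha> = slices_mem[OF T, folded \<alpha>_def]
  have l: "durfee d = l" using durfee_tspp_diag[OF T] by (simp add: d_def l_def \<alpha>_def)
  have pos: "0 < \<alpha> 0 c" "\<alpha> 0 c \<le> h c" if "c < l" for c
    using parts_iff[OF T, of c] that slice_arrays_le_heights[OF \<alpha>, of c] by (simp_all add: l_def \<alpha>_def h_def)
  have ab: "frob_a d (Suc c) = \<alpha> 0 c - 1" "frob_b d (Suc c) = h c - 1" if "c < l" for c
    using frob_tspp_diag[OF T, of c] that by (simp_all add: d_def l_def \<alpha>_def h_def)
  have "(\<Sum>i=1..l. frob_a d i + 1) = (\<Sum>c<l. \<alpha> 0 c)"
    unfolding sum_from_1 by (rule sum.cong) (use ab pos in auto)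
  moreover have "(\<Sum>i=1..l. int (frob_b d i) + 1) = int (\<Sum>c<l. h c)"
    unfolding sum_from_1 of_nat_sum
  proof (rule sum.cong[OF refl])
    fix c assume "c \<in> {..<l}"
    thus "int (frob_b d (Suc c)) + 1 = int (h c)" using ab[of c] pos[of c] by simp
  qed
  moreover have "(\<Sum>i=1..l. int (frob_b d i) - int (frob_a d i)) = int (\<Sum>c<l. h c - \<alpha> 0 c)"
    unfolding sum_from_1 of_nat_sum
  proof (rule sum.cong[OF refl])
    fix c assume "c \<in> {..<l}"
    thus "int (frob_b d (Suc c)) - int (frob_a d (Suc c)) = int (h c - \<alpha> 0 c)" using ab[of c] pos[of c] by simp
  qed
  moreover have "int (Suc m choose 2) - int (\<Sum>c<l. h c) = int (\<Sum>b\<leftarrow>free_legs m \<alpha>. Suc b)"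
  proof -
    have "(\<Sum>b\<leftarrow>free_legs m \<alpha>. Suc b) + (\<Sum>c<l. h c) = Suc m choose 2"
      using sum_free_legs[OF T] by (simp only: l_def \<alpha>_def h_def)
    thus ?thesis by (metis add_diff_cancel_right' of_nat_add)
  qed
  ultimately have "tspp_weight (Suc m) 1 u v w T
    = u ^ (\<Sum>c<l. \<alpha> 0 c) * v ^ (\<Sum>b\<leftarrow>free_legs m \<alpha>. Suc b) * w ^ (\<Sum>c<l. h c - \<alpha> 0 c)"
    unfolding tspp_weight_def d_def[symmetric] Let_def l by (simp only: power_int_of_nat power_one mult_1)
  moreover have "slice_weight u w \<alpha> * u ^ l = w ^ (\<Sum>c<l. h c - \<alpha> 0 c) * u ^ (\<Sum>c<l. \<alpha> 0 c)"
  proof -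
    have "(\<Prod>c<l. u ^ (\<alpha> 0 c - 1)) * u ^ l = (\<Prod>c<l. u ^ (\<alpha> 0 c - 1) * u)"
      by (simp add: prod.distrib)
    also have "\<dots> = (\<Prod>c<l. u ^ \<alpha> 0 c)"
      by (rule prod.cong[OF refl], rule power_minus_mult) (use pos in simp)
    finally show ?thesis
      by (simp add: slice_weight_def prod.distrib power_sum l_def[symmetric] h_def[symmetric] mult.assoc)
  qed
  ultimately show ?thesis by (simp add: l_def[symmetric] mult_ac)
qed

text \<open>The functions \<open>e\<close> take up the factor \<open>- u\<close> of the binomially
  expanded term. Moving \<open>z t ^ m\<close> past them to its place among increasing exponents
  yields one sign per part, which cancels these minus signs and leaves the \<open>u\<close> missing
  from \<open>slice_weight\<close>.\<close>

lemma alt_expand_tspp: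
  fixes u v w :: "'a::field" and z :: "nat \<Rightarrow> 'a"
  shows "alt (map (\<lambda>b t. v ^ Suc b * z t ^ (m - Suc b) - (-1) ^ b * (u * z t ^ Suc m * (w + u * z t) ^ b)) (rev [0..<m])
        @ [\<lambda>t. z t ^ m])
    = (\<Sum>T\<in>TSPP m. tspp_weight (Suc m) 1 u v w T * alt (map (\<lambda>i t. z t ^ beta_numbers (Suc m) (tspp_pi 1 T) i) [0..<Suc m]))"
proof -
  define Q where "Q = (\<lambda>b t. v ^ Suc b * z t ^ (m - Suc b))"
  define e where "e = (\<lambda>a t. - u * z t ^ (Suc m + a))"
  let ?c = "\<lambda>\<alpha>. slice_weight u w \<alpha> * u ^ num_parts (\<alpha> 0) * v ^ (\<Sum>b\<leftarrow>free_legs m \<alpha>. Suc b)"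
  let ?E = "\<lambda>\<alpha>. map (\<lambda>b. m - Suc b) (free_legs m \<alpha>) @ [m] @ map (\<lambda>c. m + \<alpha> 0 c) (rev [0..<num_parts (\<alpha> 0)])"
  have col: "v ^ Suc b * z t ^ (m - Suc b) - (-1) ^ b * (u * z t ^ Suc m * (w + u * z t) ^ b)
    = Q b t + (-1) ^ b * (\<Sum>a\<le>b. of_nat (b choose a) * w ^ (b - a) * u ^ a * e a t)" for b t
  proof -
    have "(w + u * z t) ^ b = (\<Sum>a\<le>b. of_nat (b choose a) * (u * z t) ^ a * w ^ (b - a))"
      by (subst add.commute) (rule binomial_ring)
    hence "u * z t ^ Suc m * (w + u * z t) ^ b
      = - (\<Sum>a\<le>b. of_nat (b choose a) * w ^ (b - a) * u ^ a * e a t)"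
      by (simp add: e_def sum_distrib_left sum_negf power_mult_distrib power_add mult_ac)
    thus ?thesis by (simp add: Q_def)
  qed
  have "alt (map Q (free_legs m \<alpha>) @ map (\<lambda>c. e (\<alpha> 0 c - 1)) (rev [0..<num_parts (\<alpha> 0)]) @ [\<lambda>t. z t ^ m])
    = u ^ num_parts (\<alpha> 0) * v ^ (\<Sum>b\<leftarrow>free_legs m \<alpha>. Suc b) * alt (map (\<lambda>k t. z t ^ k) (?E \<alpha>))"
    if \<alpha>: "\<alpha> \<in> slice_arrays m" for \<alpha>
  proof -
    let ?l = "num_parts (\<alpha> 0)" and ?F = "free_legs m \<alpha>"
    let ?zs = "map (\<lambda>c t. z t ^ (m + \<alpha> 0 c)) (rev [0..<?l])"
    have e: "map (\<lambda>c. e (\<alpha> 0 c - 1)) (rev [0..<?l]) = map (\<lambda>c t. - u * z t ^ (m + \<alpha> 0 c)) (rev [0..<?l])"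
    proof (rule map_cong[OF refl])
      fix c assume "c \<in> set (rev [0..<?l])"
      hence "0 < \<alpha> 0 c" using num_parts_iff[OF slice_arrays_strict[OF \<alpha>]] by simp
      hence "Suc m + (\<alpha> 0 c - 1) = m + \<alpha> 0 c" by simp
      thus "e (\<alpha> 0 c - 1) = (\<lambda>t. - u * z t ^ (m + \<alpha> 0 c))" by (simp only: e_def)
    qed
    have "alt (map Q ?F @ map (\<lambda>c. e (\<alpha> 0 c - 1)) (rev [0..<?l]) @ [\<lambda>t. z t ^ m])
      = (-1) ^ ?l * alt ((map Q ?F @ [\<lambda>t. z t ^ m]) @ map (\<lambda>c t. - u * z t ^ (m + \<alpha> 0 c)) (rev [0..<?l]) @ [])"
      unfolding e using alt_move[of "map Q ?F" "map (\<lambda>c t. - u * z t ^ (m + \<alpha> 0 c)) (rev [0..<?l])" "\<lambda>t. z t ^ m" "[]"]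
      by simp
    also have "\<dots> = (-1) ^ ?l * ((- u) ^ ?l * alt ((map Q ?F @ [\<lambda>t. z t ^ m]) @ ?zs @ []))"
    proof -
      have "(\<Prod>c\<leftarrow>rev [0..<?l]. - u) = (- u) ^ ?l" by (simp add: map_replicate_const)
      thus ?thesis
        using alt_segment_cmult[of "map Q ?F @ [\<lambda>t. z t ^ m]" "\<lambda>_. - u" "\<lambda>c t. z t ^ (m + \<alpha> 0 c)" "rev [0..<?l]" "[]"]
        by (simp only:)
    qed
    also have "\<dots> = u ^ ?l * alt ([] @ map Q ?F @ ([\<lambda>t. z t ^ m] @ ?zs))"
      by (simp flip: mult.assoc power_mult_distrib)
    also have "alt ([] @ map Q ?F @ ([\<lambda>t. z t ^ m] @ ?zs))
      = (\<Prod>b\<leftarrow>?F. v ^ Suc b) * alt ([] @ map (\<lambda>b t. z t ^ (m - Suc b)) ?F @ ([\<lambda>t. z t ^ m] @ ?zs))"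
      unfolding Q_def by (rule alt_segment_cmult)
    also have "(\<Prod>b\<leftarrow>?F. v ^ Suc b) = v ^ (\<Sum>b\<leftarrow>?F. Suc b)" by (rule prod_list_power)
    finally show ?thesis by (simp add: o_def mult.assoc)
  qed
  hence "alt (map (\<lambda>b t. Q b t + (-1) ^ b * (\<Sum>a\<le>b. of_nat (b choose a) * w ^ (b - a) * u ^ a * e a t)) (rev [0..<m]) @ [\<lambda>t. z t ^ m])
    = (\<Sum>\<alpha>\<in>slice_arrays m. ?c \<alpha> * alt (map (\<lambda>k t. z t ^ k) (?E \<alpha>)))"
    unfolding alt_expand_slice_arrays by (intro sum.cong refl) (simp add: mult.assoc)
  also have "\<dots> = (\<Sum>T\<in>TSPP m. ?c (tspp_slices m T) * alt (map (\<lambda>k t. z t ^ k) (?E (tspp_slices m T))))"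
    by (rule sum.reindex_bij_betw[OF bij_betw_tspp_slices, symmetric])
  also have "\<dots> = (\<Sum>T\<in>TSPP m. tspp_weight (Suc m) 1 u v w T * alt (map (\<lambda>i t. z t ^ beta_numbers (Suc m) (tspp_pi 1 T) i) [0..<Suc m]))"
  proof (rule sum.cong[OF refl])
    fix T assume T: "T \<in> TSPP m"
    have "map (\<lambda>k t. z t ^ k) (?E (tspp_slices m T)) = map (\<lambda>i t. z t ^ beta_numbers (Suc m) (tspp_pi 1 T) i) [0..<Suc m]"
      unfolding beta_numbers_tspp[OF T, symmetric] map_map o_def ..
    thus "?c (tspp_slices m T) * alt (map (\<lambda>k t. z t ^ k) (?E (tspp_slices m T)))
      = tspp_weight (Suc m) 1 u v w T * alt (map (\<lambda>i t. z t ^ beta_numbers (Suc m) (tspp_pi 1 T) i) [0..<Suc m])"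
      by (simp only: tspp_weight_eq[OF T])
  qed
  finally show ?thesis by (simp only: col)
qed

text \<open>Distinct variables make the Vandermonde product \<open>V\<close> nonzero, so that it can
  be cancelled.\<close>

lemma ASM_eq_TSPP_distinct:
  fixes u v w :: "'a::field" and x :: "nat \<Rightarrow> 'a"
  assumes x: "\<And>i. i \<in> {1..Suc m} \<Longrightarrow> x i \<noteq> 0" and inj: "inj_on x {1..Suc m}"
  shows "(\<Sum>A\<in>ASM (Suc m). asm_weight (Suc m) u v w x A) = tspp_gf (Suc m) 1 1 u v w x"
proof -
  let ?n = "Suc m"
  define z where "z = (\<lambda>i. x (Suc i))"
  have z: "z i \<noteq> 0" if "i < ?n" for i using x[of "Suc i"] that by (simp add: z_def)
  define V where "V = pair_prod (\<lambda>s t. t - s) ?n z"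
  have "V \<noteq> 0"
    unfolding V_def pair_prod_def
  proof (rule prod_neq_0I[OF finite_pairs])
    fix y assume "y \<in> {(i, j). i < j \<and> j < ?n}"
    then obtain i j where y: "y = (i, j)" "i < j" "j < ?n" by auto
    have "x (Suc i) \<noteq> x (Suc j)" using inj_onD[OF inj, of "Suc i" "Suc j"] y by auto
    thus "(case y of (i, j) \<Rightarrow> z j - z i) \<noteq> 0" by (simp add: y z_def)
  qed
  define L where "L = (\<Sum>A\<in>ASM ?n. asm_weight ?n u v w x A)"
  \<comment> \<open>This product enters on both sides: on the left through the normalization of
    \<open>triangle_sum\<close>, on the right because the bottom row starts at 1 rather than
    0.\<close>
  define Z where "Z = (\<Prod>i<?n. z i)"
  have "Z \<noteq> 0" unfolding Z_def by (rule prod_neq_0I) (use z in auto)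
  have "L * Z * V = triangle_sum u v w z ?n Suc * V"
    using ASM_triangle_sum[of ?n x u v w] x by (simp only: L_def Z_def z_def) simp
  also have "\<dots> = antisymmetrize ?n (\<lambda>p. pair_prod (edge_weight u v w) ?n (z \<circ> p) * (\<Prod>i<?n. z (p i) ^ Suc i))"
    unfolding V_def by (rule triangle_sum_antisymmetrize) (use z in auto)
  also have "\<dots> = antisymmetrize ?n (\<lambda>p. Z * (pair_prod (edge_weight u v w) ?n (z \<circ> p) * (\<Prod>i<?n. z (p i) ^ i)))"
  proof (rule antisymmetrize_cong)
    fix p assume p: "p permutes {0..<?n}"
    have "(\<Prod>i<?n. z (p i) ^ Suc i) = (\<Prod>i<?n. z (p i)) * (\<Prod>i<?n. z (p i) ^ i)"
      by (simp only: power_Suc prod.distrib)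
    also have "(\<Prod>i<?n. z (p i)) = Z"
      using prod.permute[OF p, of z] by (simp only: atLeast0LessThan o_def Z_def)
    finally show "pair_prod (edge_weight u v w) ?n (z \<circ> p) * (\<Prod>i<?n. z (p i) ^ Suc i)
      = Z * (pair_prod (edge_weight u v w) ?n (z \<circ> p) * (\<Prod>i<?n. z (p i) ^ i))"
      by (simp only: mult_ac)
  qed
  also have "\<dots> = Z * (\<Sum>T\<in>TSPP m. tspp_weight ?n 1 u v w T * alt (map (\<lambda>i t. z t ^ beta_numbers ?n (tspp_pi 1 T) i) [0..<?n]))"
    unfolding antisymmetrize_cmult alt_expand_tspp[symmetric]
    by (rule arg_cong[where f = "(*) Z"], rule antisymmetrize_edge_weight) (rule z)
  also have "(\<Sum>T\<in>TSPP m. tspp_weight ?n 1 u v w T * alt (map (\<lambda>i t. z t ^ beta_numbers ?n (tspp_pi 1 T) i) [0..<?n]))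
    = (\<Sum>T\<in>TSPP m. tspp_weight ?n 1 u v w T * (schur ?n (tspp_pi 1 T) x * V))"
  proof (rule sum.cong[OF refl])
    fix T assume T: "T \<in> TSPP m"
    have "schur ?n (tspp_pi 1 T) x * pair_prod (\<lambda>s t. t - s) ?n (\<lambda>i. x (Suc i))
      = alt (map (\<lambda>i t. x (Suc t) ^ beta_numbers ?n (tspp_pi 1 T) i) [0..<?n])"
    proof (rule schur_alternant)
      show "is_partition (tspp_pi 1 T)" "tspp_pi 1 T (Suc ?n) = 0"
        unfolding tspp_pi_1[OF T] using lengthen_legs_top[OF T] is_partition_lengthen_legs[OF is_partition_tspp_diag[OF T]] by auto
    qed (use x in auto)
    thus "tspp_weight ?n 1 u v w T * alt (map (\<lambda>i t. z t ^ beta_numbers ?n (tspp_pi 1 T) i) [0..<?n])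
      = tspp_weight ?n 1 u v w T * (schur ?n (tspp_pi 1 T) x * V)"
      by (simp only: V_def z_def)
  qed
  also have "\<dots> = tspp_gf ?n 1 1 u v w x * V"
    by (simp add: tspp_gf_def sum_distrib_right mult.assoc)
  finally have "L * (Z * V) = tspp_gf ?n 1 1 u v w x * (Z * V)" by (simp only: mult_ac)
  thus ?thesis using \<open>Z \<noteq> 0\<close> \<open>V \<noteq> 0\<close> by (simp add: L_def)
qed

section \<open>Specialization of generic variables\<close>

text \<open>The specialization of the series variable to 0. It is a relation, since a series with a
  pole has no value; Laurent series are taken because the identity for distinct variables lives in a
  field.\<close>

definition has_constant_term :: "'a::field fls \<Rightarrow> 'a \<Rightarrow> bool" where
  "has_constant_term F a \<longleftrightarrow> (\<exists>g. F = fps_to_fls g \<and> fps_nth g 0 = a)"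

lemma has_constant_term_unique: "has_constant_term F a \<Longrightarrow> has_constant_term F b \<Longrightarrow> a = b"
  by (auto simp: has_constant_term_def)

lemma has_constant_term_const: "has_constant_term (fps_to_fls (fps_const a)) a"
  unfolding has_constant_term_def by (intro exI[of _ "fps_const a"]) simp

lemma has_constant_term_0: "has_constant_term 0 0"
  unfolding has_constant_term_def by (intro exI[of _ 0]) simp

lemma has_constant_term_1: "has_constant_term 1 1"
  unfolding has_constant_term_def by (intro exI[of _ 1]) simp

lemma has_constant_term_add:
  assumes "has_constant_term F a" "has_constant_term G b"
  shows "has_constant_term (F + G) (a + b)"
proof -
  obtain f g where "F = fps_to_fls f" "fps_nth f 0 = a" "G = fps_to_fls g" "fps_nth g 0 = b"
    using assms by (auto simp: has_constant_term_def)
  thus ?thesis unfolding has_constant_term_def by (intro exI[of _ "f + g"]) simp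
qed

lemma has_constant_term_mult:
  assumes "has_constant_term F a" "has_constant_term G b"
  shows "has_constant_term (F * G) (a * b)"
proof -
  obtain f g where "F = fps_to_fls f" "fps_nth f 0 = a" "G = fps_to_fls g" "fps_nth g 0 = b"
    using assms by (auto simp: has_constant_term_def)
  thus ?thesis unfolding has_constant_term_def by (intro exI[of _ "f * g"]) (simp add: fls_times_fps_to_fls)
qed

lemma has_constant_term_inverse:
  assumes "has_constant_term F a" "a \<noteq> 0"
  shows "has_constant_term (inverse F) (inverse a)"
proof -
  obtain f where "F = fps_to_fls f" "fps_nth f 0 = a" using assms(1) by (auto simp: has_constant_term_def)
  thus ?thesis unfolding has_constant_term_def using assms(2)
    by (intro exI[of _ "inverse f"]) (simp add: fls_inverse_fps_to_fls)
qed

lemma has_constant_term_power: "has_constant_term F a \<Longrightarrow> has_constant_term (F ^ k) (a ^ k)"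
  by (induction k) (simp_all add: has_constant_term_1 has_constant_term_mult)

lemma has_constant_term_power_int:
  "has_constant_term F a \<Longrightarrow> a \<noteq> 0 \<Longrightarrow> has_constant_term (F powi k) (a powi k)"
  by (auto simp: power_int_def intro!: has_constant_term_power has_constant_term_inverse)

lemma has_constant_term_sum:
  "(\<And>i. i \<in> I \<Longrightarrow> has_constant_term (F i) (a i)) \<Longrightarrow> has_constant_term (\<Sum>i\<in>I. F i) (\<Sum>i\<in>I. a i)"
  by (induction I rule: infinite_finite_induct) (simp_all add: has_constant_term_0 has_constant_term_add)

lemma has_constant_term_prod:
  "(\<And>i. i \<in> I \<Longrightarrow> has_constant_term (F i) (a i)) \<Longrightarrow> has_constant_term (\<Prod>i\<in>I. F i) (\<Prod>i\<in>I. a i)"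
  by (induction I rule: infinite_finite_induct) (simp_all add: has_constant_term_1 has_constant_term_mult)

lemmas has_constant_term_intros = has_constant_term_add has_constant_term_mult has_constant_term_inverse
  has_constant_term_power has_constant_term_power_int has_constant_term_sum has_constant_term_prod

theorem theorem1:
  fixes n :: nat and u v w :: "'a::field" and x :: "nat \<Rightarrow> 'a"
  assumes "n \<ge> 1"
    and "\<And>i. i \<in> {1..n} \<Longrightarrow> x i \<noteq> 0"
  shows "(\<Sum>A\<in>ASM n. asm_weight n u v w x A) = tspp_gf n 1 1 u v w x"
proof -
  obtain m where n: "n = Suc m" using assms(1) by (cases n) auto
  let ?C = "\<lambda>a :: 'a. fps_to_fls (fps_const a)"
  \<comment> \<open>The positive exponents \<open>i\<close> differ, so the perturbed variables are
    distinct even where values of \<open>x\<close> coincide, and their constant terms are still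
    \<open>x i\<close>.\<close>
  define X where "X = (\<lambda>i. fps_to_fls (fps_const (x i) + fps_X ^ i))"
  have X: "has_constant_term (X i) (x i)" if "1 \<le> i" for i
    unfolding has_constant_term_def X_def using that
    by (intro exI[of _ "fps_const (x i) + fps_X ^ i"]) (simp add: fps_X_power_nth)
  have nz: "X i \<noteq> 0" if "i \<in> {1..n}" for i
  proof
    assume "X i = 0"
    hence "has_constant_term 0 (x i)" using X[of i] that by simp
    hence "x i = 0" using has_constant_term_unique[OF _ has_constant_term_0] by blast
    thus False using assms(2)[OF that] by simp
  qed
  have "inj_on X {1..n}"
  proof (rule inj_onI)
    fix i j assume ij: "i \<in> {1..n}" "j \<in> {1..n}" "X i = X j"
    from ij(3) have "fps_nth (fps_const (x i) + fps_X ^ i) i = fps_nth (fps_const (x j) + fps_X ^ j) i"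
      unfolding X_def fps_to_fls_eq_iff by (rule arg_cong)
    thus "i = j" using ij(1) by (auto simp: fps_X_power_nth split: if_splits)
  qed
  hence eq: "(\<Sum>A\<in>ASM n. asm_weight n (?C u) (?C v) (?C w) X A) = tspp_gf n 1 1 (?C u) (?C v) (?C w) X"
    unfolding n by (intro ASM_eq_TSPP_distinct) (use nz n in auto)
  have "has_constant_term (\<Sum>A\<in>ASM n. asm_weight n (?C u) (?C v) (?C w) X A) (\<Sum>A\<in>ASM n. asm_weight n u v w x A)"
    unfolding asm_weight_def Let_def
    by (intro has_constant_term_intros has_constant_term_const X assms(2)) auto
  moreover have "has_constant_term (tspp_gf n 1 1 (?C u) (?C v) (?C w) X) (tspp_gf n 1 1 u v w x)"
  proof -
    have "has_constant_term (schur n p X) (schur n p x)" for p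
      unfolding schur_def
      by (intro has_constant_term_sum has_constant_term_prod) (auto simp: SSYT_def intro!: X)
    \<comment> \<open>Integer powers specialize only at nonzero values, whereas \<open>v\<close> and
      \<open>w\<close> may be 0; hence the weight is first rewritten with natural exponents.\<close>
    moreover have "has_constant_term (tspp_weight n 1 (?C u) (?C v) (?C w) T) (tspp_weight n 1 u v w T)"
      if "T \<in> TSPP m" for T
      unfolding n tspp_weight_eq[OF that] slice_weight_def
      by (intro has_constant_term_intros has_constant_term_const)
    ultimately show ?thesis
      unfolding tspp_gf_def by (intro has_constant_term_sum has_constant_term_mult) (simp_all add: n)
  qed
  ultimately show ?thesis using eq has_constant_term_unique by metis
qed

end
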